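(* Let $m\ge 3$, let $E_1,E_2,\dots,E_m$ be spectral measures on a Hilbert space $\mathcal H$, and let $\Psi\in L^\infty(E_1)\otimes_{\rm h}L^\infty(E_2)\otimes_{\rm h}\cdots\otimes_{\rm h}L^\infty(E_m)$. Let $p,q\in[2,\infty]$ and suppose that $T_2,\dots,T_{m-2}$ are bounded linear operators on $\mathcal H$ (no such operators if $m=3$), $T_1\in\boldsymbol S_p$ and $T_{m-1}\in\boldsymbol S_q$. Then $$\int\cdots\int\Psi(x_1,\dots,x_m)\,dE_1(x_1)T_1\,dE_2(x_2)T_2\cdots T_{m-1}\,dE_m(x_m)\in\boldsymbol S_r,\qquad\text{where } \frac1r=\frac1p+\frac1q,$$ and $$\left\|\int\cdots\int\Psi\,dE_1T_1\,dE_2T_2\cdots T_{m-1}\,dE_m\right\|_{\boldsymbol S_r}\le\|\Psi\|_{L^\infty\otimes_{\rm h}\cdots\otimes_{\rm h}L^\infty}\,\|T_1\|_{\boldsymbol S_p}\,\|T_2\|\cdots\|T_{m-2}\|\cdot\|T_{m-1}\|_{\boldsymbol S_q}.$$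
   Context: $\boldsymbol S_p$ ($0<p<\infty$) is the Schatten--von Neumann class; $1/\infty=0$, and $T\in\boldsymbol S_\infty$ means that $T$ is a bounded linear operator, with $\|T\|_{\boldsymbol S_\infty}=\|T\|$. $\mathcal B$ denotes the space of infinite matrices that induce bounded operators on $\ell^2$, with the operator norm. Let $E_1,\dots,E_m$ be spectral measures on a Hilbert space $\mathcal H$, where $E_i$ is defined on a measurable space $\mathcal X_i$. The Haagerup tensor product $L^\infty(E_1)\otimes_{\rm h}\cdots\otimes_{\rm h}L^\infty(E_m)$ is the space of functions $\Psi$ on $\mathcal X_1\times\cdots\times\mathcal X_m$ of the form $$\Psi(x_1,\dots,x_m)=\sum_{j_1,\dots,j_{m-1}\ge0}\alpha^{(1)}_{j_1}(x_1)\,\alpha^{(2)}_{j_1j_2}(x_2)\cdots\alpha^{(m-1)}_{j_{m-2}j_{m-1}}(x_{m-1})\,\alpha^{(m)}_{j_{m-1}}(x_m)$$ with measurable coefficient functions such that $\{\alpha^{(1)}_j\}_{j\ge0}\in L^\infty_{E_1}(\ell^2)$, $\{\alpha^{(m)}_j\}_{j\ge0}\in L^\infty_{E_m}(\ell^2)$, and $\{\alpha^{(i)}_{jk}\}_{j,k\ge0}\in L^\infty_{E_i}(\mathcal B)$ for $2\le i\le m-1$. Here the $L^\infty(\ell^2)$ norm is the essential supremum of the $\ell^2$-norm and the $L^\infty(\mathcal B)$ norm is the essential supremum of the operator norm of the matrix, with respect to the corresponding spectral measure. The sum is the (a.e. existing) limit of the rectangular partial sums as all upper summation limits tend to infinity.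 The norm $\|\Psi\|_{L^\infty\otimes_{\rm h}\cdots\otimes_{\rm h}L^\infty}$ is the infimum, over all such representations, of the product of the $m$ norms of the coefficient families. For bounded operators $T_1,\dots,T_{m-1}$ the multiple operator integral with integrand $\Psi$ is defined by $$\int\cdots\int\Psi\,dE_1T_1\,dE_2T_2\cdots T_{m-1}\,dE_m=\sum_{j_1,\dots,j_{m-1}\ge0}A^{(1)}_{j_1}T_1A^{(2)}_{j_1j_2}T_2\cdots A^{(m-1)}_{j_{m-2}j_{m-1}}T_{m-1}A^{(m)}_{j_{m-1}},$$ where $A^{(i)}_{\cdot}=\int\alpha^{(i)}_{\cdot}\,dE_i$; the series (limit of rectangular partial sums) converges in the weak operator topology, and its sum does not depend on the choice of the representation of $\Psi$. *)

theory Defs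
  imports "HOL-Analysis.Analysis"
begin

section \<open>Complex Hilbert spaces and bounded operators\<close>

text \<open>
  The inner product is linear in the first argument. Completeness is part of \<^class>\<open>banach\<close>;
  no separability and no restriction on the dimension is imposed.
\<close>

class complex_hilbert_space = banach +
  fixes scaleC :: "complex \<Rightarrow> 'a \<Rightarrow> 'a"  (infixr "*\<^sub>C" 75)
    and cinner :: "'a \<Rightarrow> 'a \<Rightarrow> complex"
  assumes scaleC_add_right: "c *\<^sub>C (x + y) = c *\<^sub>C x + c *\<^sub>C y"
    and scaleC_add_left: "(c + d) *\<^sub>C x = c *\<^sub>C x + d *\<^sub>C x"
    and scaleC_scaleC: "c *\<^sub>C d *\<^sub>C x = (c * d) *\<^sub>C x"
    and scaleC_one: "1 *\<^sub>C x = x"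
    and scaleR_scaleC: "a *\<^sub>R x = complex_of_real a *\<^sub>C x"
    and cinner_commute: "cinner x y = cnj (cinner y x)"
    and cinner_add_left: "cinner (x + y) z = cinner x z + cinner y z"
    and cinner_scaleC_left: "cinner (c *\<^sub>C x) y = c * cinner x y"
    and cinner_self: "cinner x x = complex_of_real ((norm x)\<^sup>2)"

global_interpretation complex_vector:
  vector_space "scaleC :: complex \<Rightarrow> 'a \<Rightarrow> 'a::complex_hilbert_space"
  by unfold_locales
    (simp_all add: scaleC_add_right scaleC_add_left scaleC_scaleC scaleC_one)

text \<open>The operator norm of a bounded operator \<open>T\<close> is \<^term>\<open>onorm T\<close>.\<close>

definition bounded_clinear :: "('h \<Rightarrow> 'h::complex_hilbert_space) \<Rightarrow> bool" where
  "bounded_clinear T \<longleftrightarrow> bounded_linear T \<and> (\<forall>c x. T (c *\<^sub>C x) = c *\<^sub>C T x)"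

section \<open>Schatten--von Neumann classes\<close>

definition rank_at_most :: "('h \<Rightarrow> 'h::complex_hilbert_space) \<Rightarrow> nat \<Rightarrow> bool" where
  "rank_at_most F n \<longleftrightarrow> (\<exists>B. finite B \<and> card B \<le> n \<and> range F \<subseteq> complex_vector.span B)"

text \<open>
  \<open>s\<^sub>n(T)\<close> (\<open>n \<ge> 0\<close>) is the distance from \<open>T\<close> to the operators of rank at most \<open>n\<close>. For compact \<open>T\<close>
  these are the eigenvalues of \<open>(T\<^sup>*T)\<^sup>1\<^sup>/\<^sup>2\<close> in decreasing order; for noncompact \<open>T\<close> they do not tend to \<open>0\<close>.
\<close>

definition singular_value :: "('h \<Rightarrow> 'h::complex_hilbert_space) \<Rightarrow> nat \<Rightarrow> real" where
  "singular_value T n = Inf {onorm (\<lambda>x. T x - F x) |F. bounded_clinear F \<and> rank_at_most F n}"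

definition schatten_class :: "ennreal \<Rightarrow> ('h \<Rightarrow> 'h::complex_hilbert_space) set" where
  "schatten_class p = {T. bounded_clinear T \<and>
     (p \<noteq> \<infinity> \<longrightarrow> summable (\<lambda>n. singular_value T n powr enn2real p))}"

definition schatten_norm :: "ennreal \<Rightarrow> ('h \<Rightarrow> 'h::complex_hilbert_space) \<Rightarrow> real" where
  "schatten_norm p T = (if p = \<infinity> then onorm T
     else (\<Sum>n. singular_value T n powr enn2real p) powr (1 / enn2real p))"

section \<open>Spectral measures\<close>

definition orthogonal_projection :: "('h \<Rightarrow> 'h::complex_hilbert_space) \<Rightarrow> bool" where
  "orthogonal_projection P \<longleftrightarrow> bounded_clinear P \<and> P \<circ> P = P \<and>
     (\<forall>x y. cinner (P x) y = cinner x (P y))"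

text \<open>
  The measurable space is given by \<^term>\<open>space M\<close> and \<^term>\<open>sets M\<close>; the measure carried by \<open>M\<close>
  is never used. Countable additivity is in the strong operator topology; it includes
  \<open>E {} = 0\<close> (take all sets empty) and forces projections of disjoint sets to be orthogonal.
\<close>

definition spectral_measure :: "'x measure \<Rightarrow> ('x set \<Rightarrow> 'h \<Rightarrow> 'h::complex_hilbert_space) \<Rightarrow> bool" where
  "spectral_measure M E \<longleftrightarrow>
     (\<forall>A\<in>sets M. orthogonal_projection (E A)) \<and>
     E (space M) = id \<and>
     (\<forall>A h. range A \<subseteq> sets M \<longrightarrow> disjoint_family A \<longrightarrow>
        (\<lambda>n::nat. E (A n) h) sums E (\<Union>n. A n) h)"

text \<open>The finite positive measure \<open>A \<mapsto> (E(A) h, h)\<close>.\<close>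

definition scalar_measure ::
    "'x measure \<Rightarrow> ('x set \<Rightarrow> 'h \<Rightarrow> 'h) \<Rightarrow> 'h::complex_hilbert_space \<Rightarrow> 'x measure" where
  "scalar_measure M E h = measure_of (space M) (sets M) (\<lambda>A. ennreal (Re (cinner (E A h) h)))"

text \<open>
  \<open>\<integral> f dE\<close>: the bounded operator \<open>A\<close> with \<open>(A h, h) = \<integral> f d(E h, h)\<close> for all \<open>h\<close>; by polarization this
  determines \<open>A\<close>, and it exists for measurable \<open>E\<close>-essentially bounded \<open>f\<close>.
\<close>

definition spectral_integral ::
    "'x measure \<Rightarrow> ('x set \<Rightarrow> 'h \<Rightarrow> 'h::complex_hilbert_space) \<Rightarrow> ('x \<Rightarrow> complex) \<Rightarrow> 'h \<Rightarrow> 'h" where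
  "spectral_integral M E f = (THE A. bounded_clinear A \<and>
     (\<forall>h. cinner (A h) h = integral\<^sup>L (scalar_measure M E h) f))"

definition AE_spectral ::
    "'x measure \<Rightarrow> ('x set \<Rightarrow> 'h \<Rightarrow> 'h::complex_hilbert_space) \<Rightarrow> ('x \<Rightarrow> bool) \<Rightarrow> bool" where
  "AE_spectral M E P \<longleftrightarrow> (\<exists>N\<in>sets M. E N = (\<lambda>_. 0) \<and> (\<forall>x\<in>space M - N. P x))"

text \<open>
  A measurable subset of \<open>X\<^sub>1 \<times> \<dots> \<times> X\<^sub>m\<close> is null for the product of the \<open>E\<^sub>i\<close> if it is null for all
  products of the scalar measures \<open>(E\<^sub>i h\<^sub>i, h\<^sub>i)\<close>; equivalently, if it is null for the spectral measure
  \<open>E\<^sub>1 \<otimes> \<dots> \<otimes> E\<^sub>m\<close> on the \<open>m\<close>-fold Hilbert tensor power. (The \<open>E\<^sub>i\<close> need not commute,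
  so there is no product spectral measure on the original Hilbert space.)
\<close>

definition AE_product ::
    "nat \<Rightarrow> (nat \<Rightarrow> 'x measure) \<Rightarrow> (nat \<Rightarrow> 'x set \<Rightarrow> 'h \<Rightarrow> 'h::complex_hilbert_space)
      \<Rightarrow> ((nat \<Rightarrow> 'x) \<Rightarrow> bool) \<Rightarrow> bool" where
  "AE_product m M E P \<longleftrightarrow> (\<exists>N\<in>sets (Pi\<^sub>M {1..m} M).
     (\<forall>h. emeasure (Pi\<^sub>M {1..m} (\<lambda>i. scalar_measure (M i) (E i) (h i))) N = 0) \<and>
     (\<forall>x\<in>space (Pi\<^sub>M {1..m} M) - N. P x))"

section \<open>The spaces \<open>L\<^sup>\<infinity>(\<ell>\<^sup>2)\<close> and \<open>L\<^sup>\<infinity>(\<B>)\<close>\<close>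

definition ell2 :: "(nat \<Rightarrow> complex) set" where
  "ell2 = {u. summable (\<lambda>j. (cmod (u j))\<^sup>2)}"

definition ell2_norm :: "(nat \<Rightarrow> complex) \<Rightarrow> real" where
  "ell2_norm u = sqrt (\<Sum>j. (cmod (u j))\<^sup>2)"

definition matrix_bound :: "(nat \<Rightarrow> nat \<Rightarrow> complex) \<Rightarrow> real \<Rightarrow> bool" where
  "matrix_bound a C \<longleftrightarrow> 0 \<le> C \<and> (\<forall>u\<in>ell2.
     (\<forall>j. summable (\<lambda>k. a j k * u k)) \<and>
     (\<lambda>j. \<Sum>k. a j k * u k) \<in> ell2 \<and>
     ell2_norm (\<lambda>j. \<Sum>k. a j k * u k) \<le> C * ell2_norm u)"

definition bounded_matrices :: "(nat \<Rightarrow> nat \<Rightarrow> complex) set" where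
  "bounded_matrices = {a. \<exists>C. matrix_bound a C}"

definition matrix_norm :: "(nat \<Rightarrow> nat \<Rightarrow> complex) \<Rightarrow> real" where
  "matrix_norm a = Inf {C. matrix_bound a C}"

definition Linf_ell2 ::
    "'x measure \<Rightarrow> ('x set \<Rightarrow> 'h \<Rightarrow> 'h::complex_hilbert_space) \<Rightarrow> (nat \<Rightarrow> 'x \<Rightarrow> complex) set" where
  "Linf_ell2 M E = {\<alpha>. (\<forall>j. \<alpha> j \<in> borel_measurable M) \<and>
     (\<exists>C. AE_spectral M E (\<lambda>x. (\<lambda>j. \<alpha> j x) \<in> ell2 \<and> ell2_norm (\<lambda>j. \<alpha> j x) \<le> C))}"

definition Linf_ell2_norm ::
    "'x measure \<Rightarrow> ('x set \<Rightarrow> 'h \<Rightarrow> 'h::complex_hilbert_space) \<Rightarrow> (nat \<Rightarrow> 'x \<Rightarrow> complex) \<Rightarrow> real" where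
  "Linf_ell2_norm M E \<alpha> = Inf {C. 0 \<le> C \<and>
     AE_spectral M E (\<lambda>x. (\<lambda>j. \<alpha> j x) \<in> ell2 \<and> ell2_norm (\<lambda>j. \<alpha> j x) \<le> C)}"

definition Linf_matrix ::
    "'x measure \<Rightarrow> ('x set \<Rightarrow> 'h \<Rightarrow> 'h::complex_hilbert_space) \<Rightarrow> (nat \<Rightarrow> nat \<Rightarrow> 'x \<Rightarrow> complex) set" where
  "Linf_matrix M E = {\<alpha>. (\<forall>j k. \<alpha> j k \<in> borel_measurable M) \<and>
     (\<exists>C. AE_spectral M E (\<lambda>x. (\<lambda>j k. \<alpha> j k x) \<in> bounded_matrices \<and>
                                matrix_norm (\<lambda>j k. \<alpha> j k x) \<le> C))}"

definition Linf_matrix_norm ::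
    "'x measure \<Rightarrow> ('x set \<Rightarrow> 'h \<Rightarrow> 'h::complex_hilbert_space) \<Rightarrow> (nat \<Rightarrow> nat \<Rightarrow> 'x \<Rightarrow> complex) \<Rightarrow> real" where
  "Linf_matrix_norm M E \<alpha> = Inf {C. 0 \<le> C \<and>
     AE_spectral M E (\<lambda>x. (\<lambda>j k. \<alpha> j k x) \<in> bounded_matrices \<and>
                           matrix_norm (\<lambda>j k. \<alpha> j k x) \<le> C)}"

section \<open>Haagerup tensor products\<close>

text \<open>
  A multi-index \<open>(j\<^sub>1, \<dots>, j\<^sub>m\<^sub>-\<^sub>1)\<close> is an extensional function \<open>J\<close> on \<open>{1..m-1}\<close>. A rectangular partial
  sum runs over \<open>j\<^sub>i \<le> N\<^sub>i\<close>; along \<open>rect_limit m\<close> all the upper limits \<open>N\<^sub>1, \<dots>, N\<^sub>m\<^sub>-\<^sub>1\<close> tend to infinity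
  independently.
\<close>

definition rectangle :: "nat \<Rightarrow> (nat \<Rightarrow> nat) \<Rightarrow> (nat \<Rightarrow> nat) set" where
  "rectangle m N = (\<Pi>\<^sub>E i\<in>{1..m-1}. {..N i})"

definition rect_limit :: "nat \<Rightarrow> (nat \<Rightarrow> nat) filter" where
  "rect_limit m = (INF i\<in>{1..m-1}. filtercomap (\<lambda>N. N i) sequentially)"

text \<open>
  In a representation, \<open>a\<close> is the first coefficient family, \<open>b i\<close> (\<open>2 \<le> i \<le> m - 1\<close>) is the \<open>i\<close>-th one,
  and \<open>c\<close> is the last one.
\<close>

definition haagerup_representation ::
    "nat \<Rightarrow> (nat \<Rightarrow> 'x measure) \<Rightarrow> (nat \<Rightarrow> 'x set \<Rightarrow> 'h \<Rightarrow> 'h::complex_hilbert_space)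
      \<Rightarrow> ((nat \<Rightarrow> 'x) \<Rightarrow> complex) \<Rightarrow> (nat \<Rightarrow> 'x \<Rightarrow> complex)
      \<Rightarrow> (nat \<Rightarrow> nat \<Rightarrow> nat \<Rightarrow> 'x \<Rightarrow> complex) \<Rightarrow> (nat \<Rightarrow> 'x \<Rightarrow> complex) \<Rightarrow> bool" where
  "haagerup_representation m M E \<Psi> a b c \<longleftrightarrow>
     a \<in> Linf_ell2 (M 1) (E 1) \<and>
     (\<forall>i\<in>{2..m-1}. b i \<in> Linf_matrix (M i) (E i)) \<and>
     c \<in> Linf_ell2 (M m) (E m) \<and>
     AE_product m M E (\<lambda>x.
       ((\<lambda>N. \<Sum>J\<in>rectangle m N.
           a (J 1) (x 1) * (\<Prod>i\<in>{2..m-1}. b i (J (i-1)) (J i) (x i)) * c (J (m-1)) (x m))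
         \<longlongrightarrow> \<Psi> x) (rect_limit m))"

definition haagerup_space ::
    "nat \<Rightarrow> (nat \<Rightarrow> 'x measure) \<Rightarrow> (nat \<Rightarrow> 'x set \<Rightarrow> 'h \<Rightarrow> 'h::complex_hilbert_space)
      \<Rightarrow> ((nat \<Rightarrow> 'x) \<Rightarrow> complex) set" where
  "haagerup_space m M E = {\<Psi>. \<exists>a b c. haagerup_representation m M E \<Psi> a b c}"

definition haagerup_norm ::
    "nat \<Rightarrow> (nat \<Rightarrow> 'x measure) \<Rightarrow> (nat \<Rightarrow> 'x set \<Rightarrow> 'h \<Rightarrow> 'h::complex_hilbert_space)
      \<Rightarrow> ((nat \<Rightarrow> 'x) \<Rightarrow> complex) \<Rightarrow> real" where
  "haagerup_norm m M E \<Psi> = Inf {Linf_ell2_norm (M 1) (E 1) a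
       * (\<Prod>i\<in>{2..m-1}. Linf_matrix_norm (M i) (E i) (b i))
       * Linf_ell2_norm (M m) (E m) c
     |a b c. haagerup_representation m M E \<Psi> a b c}"

section \<open>Multiple operator integrals\<close>

text \<open>
  The term \<open>A\<^sub>1 T\<^sub>1 A\<^sub>2 T\<^sub>2 \<dots> A\<^sub>m\<^sub>-\<^sub>1 T\<^sub>m\<^sub>-\<^sub>1 A\<^sub>m\<close> of the operator series that belongs to the multi-index \<open>J\<close>.
\<close>

definition moi_term ::
    "nat \<Rightarrow> (nat \<Rightarrow> 'x measure) \<Rightarrow> (nat \<Rightarrow> 'x set \<Rightarrow> 'h \<Rightarrow> 'h::complex_hilbert_space)
      \<Rightarrow> (nat \<Rightarrow> 'x \<Rightarrow> complex) \<Rightarrow> (nat \<Rightarrow> nat \<Rightarrow> nat \<Rightarrow> 'x \<Rightarrow> complex) \<Rightarrow> (nat \<Rightarrow> 'x \<Rightarrow> complex)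
      \<Rightarrow> (nat \<Rightarrow> 'h \<Rightarrow> 'h) \<Rightarrow> (nat \<Rightarrow> nat) \<Rightarrow> 'h \<Rightarrow> 'h" where
  "moi_term m M E a b c T J =
     spectral_integral (M 1) (E 1) (a (J 1)) \<circ> T 1
     \<circ> foldr (\<circ>) (map (\<lambda>i. spectral_integral (M i) (E i) (b i (J (i-1)) (J i)) \<circ> T i) [2..<m]) id
     \<circ> spectral_integral (M m) (E m) (c (J (m-1)))"

definition moi_series_sum ::
    "nat \<Rightarrow> (nat \<Rightarrow> 'x measure) \<Rightarrow> (nat \<Rightarrow> 'x set \<Rightarrow> 'h \<Rightarrow> 'h::complex_hilbert_space)
      \<Rightarrow> (nat \<Rightarrow> 'x \<Rightarrow> complex) \<Rightarrow> (nat \<Rightarrow> nat \<Rightarrow> nat \<Rightarrow> 'x \<Rightarrow> complex) \<Rightarrow> (nat \<Rightarrow> 'x \<Rightarrow> complex)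
      \<Rightarrow> (nat \<Rightarrow> 'h \<Rightarrow> 'h) \<Rightarrow> ('h \<Rightarrow> 'h) \<Rightarrow> bool" where
  "moi_series_sum m M E a b c T S \<longleftrightarrow> bounded_clinear S \<and>
     (\<forall>g h. ((\<lambda>N. cinner (\<Sum>J\<in>rectangle m N. moi_term m M E a b c T J g) h)
               \<longlongrightarrow> cinner (S g) h) (rect_limit m))"

text \<open>
  The operator obtained from any representation of \<open>\<Psi>\<close>. Convergence and independence of the
  representation are what makes the description below meaningful.
\<close>

definition multiple_operator_integral ::
    "nat \<Rightarrow> (nat \<Rightarrow> 'x measure) \<Rightarrow> (nat \<Rightarrow> 'x set \<Rightarrow> 'h \<Rightarrow> 'h::complex_hilbert_space)
      \<Rightarrow> ((nat \<Rightarrow> 'x) \<Rightarrow> complex) \<Rightarrow> (nat \<Rightarrow> 'h \<Rightarrow> 'h) \<Rightarrow> 'h \<Rightarrow> 'h" where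
  "multiple_operator_integral m M E \<Psi> T = (THE S. \<exists>a b c.
     haagerup_representation m M E \<Psi> a b c \<and> moi_series_sum m M E a b c T S)"

end

theory Submission
  imports Defs
begin

text \<open>
  A coefficient family of norm \<open>C\<close> gives a block operator of norm at most \<open>C\<close> on
  \<open>\<ell>\<^sup>2\<close>-sequences of vectors: this is checked on step functions, for which one sees one scalar
  matrix per cell of a partition. The operator series is therefore the product of a row \<open>A\<^sub>1\<close>,
  of block matrices and of a column \<open>A\<^sub>m\<close> with the \<open>T\<^sub>i\<close> (acting diagonally) in between, and its
  rectangular partial sums are obtained by truncating the sequences, so they converge strongly.

  The sum \<open>S\<close> satisfies \<open>|(S g, h)| \<le> K \<nu>(h) \<mu>(g)\<close>, where \<open>\<mu>(g)\<^sup>2 = \<Sum>\<^sub>j \<parallel>T\<^sub>m\<^sub>-\<^sub>1 A\<^sub>m\<^sub>,\<^sub>j g\<parallel>\<^sup>2\<close> and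
  \<open>\<nu>(h)\<^sup>2 = \<Sum>\<^sub>j \<parallel>T\<^sub>1\<^sup>* A\<^sub>1\<^sub>,\<^sub>j\<^sup>* h\<parallel>\<^sup>2\<close>. Evaluated on orthonormal families, \<open>\<mu>\<^sup>2\<close> is obtained from the squared
  singular values of \<open>T\<^sub>m\<^sub>-\<^sub>1\<close> by a doubly substochastic matrix, so by convexity of \<open>x \<mapsto> x\<^sup>q\<^sup>/\<^sup>2\<close> its
  \<open>\<ell>\<^sup>q\<close>-norm is at most \<open>\<parallel>T\<^sub>m\<^sub>-\<^sub>1\<parallel>\<close> in \<open>S\<^sub>q\<close>, up to the factor \<open>C\<^sub>m\<close>, and likewise for \<open>\<nu>\<close>. Testing \<open>S\<close> on
  almost singular vectors and applying Hoelder's inequality gives the bound.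

  The sum depends only on \<open>\<Psi>\<close>: if all \<open>T\<^sub>i\<close> have rank one, polarization turns \<open>(S g, h)\<close> into a
  combination of integrals of \<open>\<Psi>\<close> over products of scalar measures, and a general \<open>T\<^sub>i\<close> can be
  replaced, one index at a time, by operators of finite rank.
\<close>

section \<open>Complex Hilbert spaces\<close>

text \<open>The singular values are distances to operators of finite rank on an arbitrary Hilbert
  space, and a bounded operator may have no singular vectors at all. Both halves of the Schatten
  estimate therefore work with approximate ones, a lower family to test \<open>S\<close> and an
  upper family to dominate \<open>(norm (T y))\<^sup>2\<close>, and the errors are removed by
  limits. The integral is a definite description ranging over all representations, so a bound
  obtained from one of them says something about the integral only once all of them are known to
  give the same operator; the infimum over representations is taken last, with the operator fixed.
  The spectral measures need not commute, so \<open>\<Psi>\<close> is integrated only against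
  products of scalar measures, which appear when every \<open>T i\<close> has rank one. A general
  \<open>T i\<close> is no norm limit of finite-rank operators; it is approximated only on the
  square summable sequence of vectors that reaches it inside the product.\<close>

lemma cinner_add_right: "cinner x (y + z) = cinner x y + cinner x z"
  by (metis cinner_add_left cinner_commute complex_cnj_add)

lemma cinner_scaleC_right: "cinner x (c *\<^sub>C y) = cnj c * cinner x y"
  by (metis cinner_commute cinner_scaleC_left complex_cnj_mult)

lemma cinner_scaleR_left: "cinner (a *\<^sub>R x) y = a *\<^sub>R cinner x y"
  by (simp add: scaleR_scaleC cinner_scaleC_left scaleR_conv_of_real)

lemma cinner_scaleR_right: "cinner x (a *\<^sub>R y) = a *\<^sub>R cinner x y"
  by (simp add: scaleR_scaleC cinner_scaleC_right scaleR_conv_of_real)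

lemma cinner_zero_left [simp]: "cinner 0 x = 0"
  by (metis cinner_scaleR_left scaleR_zero_left)

lemma cinner_zero_right [simp]: "cinner x 0 = 0"
  by (metis cinner_scaleR_right scaleR_zero_left)

lemma cinner_minus_left: "cinner (- x) y = - cinner x y"
  by (metis cinner_scaleR_left scaleR_minus1_left)

lemma cinner_minus_right: "cinner x (- y) = - cinner x y"
  by (metis cinner_scaleR_right scaleR_minus1_left)

lemma cinner_diff_left: "cinner (x - y) z = cinner x z - cinner y z"
  using cinner_add_left[of x "-y" z] by (simp add: cinner_minus_left)

lemma cinner_diff_right: "cinner x (y - z) = cinner x y - cinner x z"
  using cinner_add_right[of x y "-z"] by (simp add: cinner_minus_right)

lemma cinner_sum_left: "cinner (\<Sum>i\<in>I. f i) y = (\<Sum>i\<in>I. cinner (f i) y)"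
  by (induction I rule: infinite_finite_induct) (simp_all add: cinner_add_left)

lemma cinner_sum_right: "cinner y (\<Sum>i\<in>I. f i) = (\<Sum>i\<in>I. cinner y (f i))"
  by (induction I rule: infinite_finite_induct) (simp_all add: cinner_add_right)

lemmas cinner_simps = cinner_add_left cinner_add_right cinner_diff_left cinner_diff_right
  cinner_minus_left cinner_minus_right cinner_scaleC_left cinner_scaleC_right
  cinner_scaleR_left cinner_scaleR_right cinner_sum_left cinner_sum_right

lemma power2_norm_cinner: "(norm x)\<^sup>2 = Re (cinner x x)"
  by (simp add: cinner_self)

lemma norm_scaleC: "norm (c *\<^sub>C x) = cmod c * norm x"
proof -
  have "complex_of_real ((norm (c *\<^sub>C x))\<^sup>2) = c * cnj c * of_real ((norm x)\<^sup>2)"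
    by (simp only: cinner_self[symmetric] cinner_simps mult.assoc) (simp add: mult.left_commute)
  also have "\<dots> = of_real ((cmod c * norm x)\<^sup>2)"
    by (simp add: complex_norm_square[symmetric] power_mult_distrib)
  finally have "(norm (c *\<^sub>C x))\<^sup>2 = (cmod c * norm x)\<^sup>2"
    using of_real_eq_iff by blast
  then show ?thesis
    by (simp add: power2_eq_iff_nonneg)
qed

lemma power2_norm_add:
  "(norm (x + y))\<^sup>2 = (norm x)\<^sup>2 + 2 * Re (cinner x y) + (norm y)\<^sup>2"
  using cinner_commute[of y x]
  by (simp add: power2_norm_cinner cinner_simps)

lemma power2_norm_diff:
  "(norm (x - y))\<^sup>2 = (norm x)\<^sup>2 - 2 * Re (cinner x y) + (norm y)\<^sup>2"
  using cinner_commute[of y x]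
  by (simp add: power2_norm_cinner cinner_simps)

lemma cinner_eq_zero_iff: "cinner x x = 0 \<longleftrightarrow> x = 0"
  by (simp add: cinner_self)

lemma cmod_cinner_le: "cmod (cinner x y) \<le> norm x * norm y"
proof (cases "y = 0")
  case False
  define c where "c = cinner x y / of_real ((norm y)\<^sup>2)"
  have ny: "(norm y)\<^sup>2 > 0" using False by simp
  have cy: "c * of_real ((norm y)\<^sup>2) = cinner x y"
    using ny False by (simp add: c_def)
  have "0 \<le> (norm (x - c *\<^sub>C y))\<^sup>2" by simp
  also have "\<dots> = (norm x)\<^sup>2 - 2 * Re (cnj c * cinner x y) + (cmod c)\<^sup>2 * (norm y)\<^sup>2"
    by (simp add: power2_norm_diff cinner_simps norm_scaleC power_mult_distrib)
  also have "cnj c * cinner x y = of_real ((cmod c)\<^sup>2 * (norm y)\<^sup>2)"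
    unfolding cy[symmetric] using complex_norm_square[of c] by (simp add: mult_ac)
  finally have "(cmod c)\<^sup>2 * (norm y)\<^sup>2 \<le> (norm x)\<^sup>2" by (simp add: mult.commute)
  then have "(cmod c * norm y * norm y)\<^sup>2 \<le> (norm x * norm y)\<^sup>2"
    using ny by (simp add: power_mult_distrib)
  then have "cmod c * norm y * norm y \<le> norm x * norm y"
    by (rule power2_le_imp_le) simp
  moreover have "cmod (cinner x y) = cmod c * norm y * norm y"
    unfolding cy[symmetric] by (simp add: norm_mult power2_eq_square)
  ultimately show ?thesis by simp
qed simp

lemma bounded_bilinear_cinner: "bounded_bilinear cinner"
  by unfold_locales
    (auto simp: cinner_simps intro!: exI[of _ 1] cmod_cinner_le)

lemma bounded_linear_cinner_left: "bounded_linear (\<lambda>x. cinner x y)"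
  using bounded_bilinear.bounded_linear_left[OF bounded_bilinear_cinner] .

lemma tendsto_cinner:
  "(f \<longlongrightarrow> a) F \<Longrightarrow> (g \<longlongrightarrow> b) F \<Longrightarrow> ((\<lambda>x. cinner (f x) (g x)) \<longlongrightarrow> cinner a b) F"
  by (rule bounded_bilinear.tendsto[OF bounded_bilinear_cinner])

lemma bounded_bilinear_scaleC:
  "bounded_bilinear (\<lambda>c x. c *\<^sub>C (x::'h::complex_hilbert_space))"
  by unfold_locales
    (auto simp: scaleC_add_left scaleC_add_right scaleR_scaleC scaleC_scaleC norm_scaleC
        mult.commute scaleR_conv_of_real intro!: exI[of _ 1])

lemma tendsto_scaleC:
  fixes g :: "'a \<Rightarrow> 'h::complex_hilbert_space"
  shows "(f \<longlongrightarrow> a) F \<Longrightarrow> (g \<longlongrightarrow> b) F \<Longrightarrow> ((\<lambda>x. f x *\<^sub>C g x) \<longlongrightarrow> a *\<^sub>C b) F"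
  by (rule bounded_bilinear.tendsto[OF bounded_bilinear_scaleC])

lemma cinner_eqI:
  assumes "\<And>y. cinner x y = cinner x' y"
  shows "x = x'"
  using assms[of "x - x'"] cinner_eq_zero_iff[of "x - x'"] by (simp add: cinner_diff_left)

lemma cinner_eqI':
  assumes "\<And>y. cinner y x = cinner y x'"
  shows "x = x'"
  by (rule cinner_eqI) (metis assms cinner_commute)

lemma power2_norm_sum_orthogonal:
  assumes "finite I" "\<And>i j. i \<in> I \<Longrightarrow> j \<in> I \<Longrightarrow> i \<noteq> j \<Longrightarrow> cinner (f i) (f j) = 0"
  shows "(norm (\<Sum>i\<in>I. f i))\<^sup>2 = (\<Sum>i\<in>I. (norm (f i))\<^sup>2)"
  using assms
proof (induction I)
  case (insert a I)
  have "cinner (f a) (\<Sum>i\<in>I. f i) = 0"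
    using insert by (auto simp: cinner_sum_right intro!: sum.neutral)
  then show ?case using insert by (simp add: power2_norm_add)
qed simp

lemma parallelogram_law:
  fixes x y :: "'h::complex_hilbert_space"
  shows "(norm (x + y))\<^sup>2 + (norm (x - y))\<^sup>2 = 2 * (norm x)\<^sup>2 + 2 * (norm y)\<^sup>2"
  by (simp add: power2_norm_add power2_norm_diff)

section \<open>Bounded operators\<close>

lemma bounded_clinear_linear: "bounded_clinear T \<Longrightarrow> bounded_linear T"
  by (simp add: bounded_clinear_def)

lemma bounded_clinear_scaleC: "bounded_clinear T \<Longrightarrow> T (c *\<^sub>C x) = c *\<^sub>C T x"
  by (simp add: bounded_clinear_def)

lemma bounded_clinear_simps:
  assumes "bounded_clinear T"
  shows "T (x + y) = T x + T y" "T (x - y) = T x - T y" "T 0 = 0" "T (- x) = - T x"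
    "T (sum f I) = (\<Sum>i\<in>I. T (f i))" "T (c *\<^sub>C x) = c *\<^sub>C T x"
proof -
  interpret bounded_linear T using assms by (rule bounded_clinear_linear)
  show "T (x + y) = T x + T y" "T (x - y) = T x - T y" "T 0 = 0" "T (- x) = - T x"
    "T (sum f I) = (\<Sum>i\<in>I. T (f i))" by (simp_all add: add diff neg sum zero)
qed (rule bounded_clinear_scaleC[OF assms])

lemma onorm_clinear: "bounded_clinear T \<Longrightarrow> norm (T x) \<le> onorm T * norm x"
  by (simp add: bounded_clinear_linear onorm)

lemma onorm_clinear_nonneg: "bounded_clinear T \<Longrightarrow> 0 \<le> onorm T"
  by (simp add: bounded_clinear_linear onorm_pos_le)

lemma bounded_clinearI:
  assumes "\<And>x y. T (x + y) = T x + T y" "\<And>c x. T (c *\<^sub>C x) = c *\<^sub>C T x"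
    "\<And>x. norm (T x) \<le> norm x * K"
  shows "bounded_clinear T"
  unfolding bounded_clinear_def
  by (intro conjI allI bounded_linear_intro[where K=K]) (auto simp: assms scaleR_scaleC)

lemma bounded_clinear_zero [simp]: "bounded_clinear (\<lambda>_. 0)"
  by (simp add: bounded_clinear_def)

lemma bounded_clinear_id [simp]: "bounded_clinear id" "bounded_clinear (\<lambda>x. x)"
  by (simp_all add: bounded_clinear_def bounded_linear_ident id_def)

lemma bounded_clinear_compose:
  assumes "bounded_clinear S" "bounded_clinear T"
  shows "bounded_clinear (\<lambda>x. S (T x))"
  using assms bounded_linear_compose unfolding bounded_clinear_def by force

lemma bounded_clinear_comp:
  "bounded_clinear S \<Longrightarrow> bounded_clinear T \<Longrightarrow> bounded_clinear (S \<circ> T)"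
  using bounded_clinear_compose by (simp add: comp_def)

lemma bounded_clinear_add:
  "bounded_clinear S \<Longrightarrow> bounded_clinear T \<Longrightarrow> bounded_clinear (\<lambda>x. S x + T x)"
  by (simp add: bounded_clinear_def bounded_linear_add scaleC_add_right)

lemma bounded_clinear_diff:
  "bounded_clinear S \<Longrightarrow> bounded_clinear T \<Longrightarrow> bounded_clinear (\<lambda>x. S x - T x)"
  by (simp add: bounded_clinear_def bounded_linear_sub complex_vector.scale_right_diff_distrib)

lemma bounded_clinear_const_scaleC:
  assumes "bounded_clinear T"
  shows "bounded_clinear (\<lambda>x. c *\<^sub>C T x)"
proof (rule bounded_clinearI[where K = "cmod c * onorm T"])
  show "norm (c *\<^sub>C T x) \<le> norm x * (cmod c * onorm T)" for x
    using mult_left_mono[OF onorm_clinear[OF assms, of x], of "cmod c"]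
    by (simp add: norm_scaleC mult_ac)
qed (simp_all add: bounded_clinear_simps[OF assms] scaleC_add_right scaleC_scaleC mult.commute)

lemma bounded_clinear_sum:
  "(\<And>i. i \<in> I \<Longrightarrow> bounded_clinear (f i)) \<Longrightarrow> bounded_clinear (\<lambda>x. \<Sum>i\<in>I. f i x)"
  by (induction I rule: infinite_finite_induct) (auto intro: bounded_clinear_add)

lemma bounded_clinear_rank_one: "bounded_clinear (\<lambda>x. cinner x u *\<^sub>C v)"
  by (rule bounded_clinearI[where K = "norm u * norm v"])
    (auto simp: cinner_simps scaleC_add_left scaleC_scaleC norm_scaleC mult.assoc[symmetric]
      intro!: mult_right_mono cmod_cinner_le)

lemma polarization_clinear:
  fixes x y :: "'h::complex_hilbert_space"
  assumes "\<And>x y. B (x + y) = B x + B y" "\<And>c x. B (c *\<^sub>C x) = c *\<^sub>C B x"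
  shows "cinner (B x) y = (\<Sum>t<4. \<i> ^ t / 4 * cinner (B (x + \<i> ^ t *\<^sub>C y)) (x + \<i> ^ t *\<^sub>C y))"
proof -
  have "{..<4::nat} = {0,1,2,3}" by auto
  then show ?thesis
    by (simp add: assms cinner_simps power3_eq_cube algebra_simps)
qed

lemma polarization:
  assumes "bounded_clinear B"
  shows "cinner (B x) y = (\<Sum>t<4. \<i> ^ t / 4 * cinner (B (x + \<i> ^ t *\<^sub>C y)) (x + \<i> ^ t *\<^sub>C y))"
  by (rule polarization_clinear) (simp_all add: bounded_clinear_simps[OF assms])

lemma bounded_clinear_eqI:
  assumes "bounded_clinear A" "bounded_clinear B" "\<And>h. cinner (A h) h = cinner (B h) h"
  shows "A = B"
proof
  fix x
  show "A x = B x"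
  proof (rule cinner_eqI)
    fix y
    show "cinner (A x) y = cinner (B x) y"
      unfolding polarization[OF assms(1), of x y] polarization[OF assms(2), of x y] assms(3) ..
  qed
qed

text \<open>Polarization writes the sesquilinear form by four quadratic values; for unit vectors the
  squared norms of the four arguments add up to 8, which leaves \<open>8 * d / 4\<close>. Operators
  known only through their quadratic forms, such as spectral integrals, are compared in norm in this
  way.\<close>

lemma norm_le_numerical_radius:
  assumes B: "bounded_clinear B" and d: "\<And>h. cmod (cinner (B h) h) \<le> d * (norm h)\<^sup>2" and "0 \<le> d"
  shows "norm (B x) \<le> 2 * d * norm x"
proof -
  have unit: "cmod (cinner (B x) y) \<le> 2 * d" if "norm x = 1" "norm y = 1" for x y
  proof -
    have "cmod (cinner (B x) y) \<le> (\<Sum>t<4. d * (norm (x + \<i> ^ t *\<^sub>C y))\<^sup>2 / 4)"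
      unfolding polarization[OF B, of x y]
      by (rule norm_sum[THEN order_trans], rule sum_mono) (simp add: norm_mult norm_power d norm_divide)
    also have "\<dots> = d / 4 * (\<Sum>t<4::nat. (norm (x + \<i> ^ t *\<^sub>C y))\<^sup>2)"
      by (simp add: sum_distrib_left mult.commute)
    also have "(\<Sum>t<4::nat. (norm (x + \<i> ^ t *\<^sub>C y))\<^sup>2) = 8"
    proof -
      have "{..<4::nat} = {0,1,2,3}" by auto
      then show ?thesis
        using that by (simp add: power2_norm_add norm_scaleC norm_mult norm_power cinner_simps power3_eq_cube)
    qed
    finally show ?thesis by simp
  qed
  show ?thesis
  proof (cases "x = 0 \<or> B x = 0")
    case False
    define x' y' where "x' = (1 / norm x) *\<^sub>R x" and "y' = (1 / norm (B x)) *\<^sub>R B x"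
    have "norm x' = 1" "norm y' = 1" using False by (auto simp: x'_def y'_def)
    from unit[OF this] have "cmod (cinner (B x') y') \<le> 2 * d" .
    moreover have "B x' = (1 / norm x) *\<^sub>R B x"
      using bounded_clinear_simps(6)[OF B] by (simp add: x'_def scaleR_scaleC del: of_real_divide)
    ultimately have "norm (B x) / norm x \<le> 2 * d"
      using False by (simp add: y'_def cinner_simps cinner_self norm_mult norm_power power2_eq_square divide_simps)
    then show ?thesis using False by (simp add: divide_simps mult.commute)
  qed (use assms bounded_clinear_simps(3)[OF B] in auto)
qed

section \<open>Adjoints\<close>

text \<open>The representing vector of \<open>f\<close> minimises \<open>\<parallel>x\<parallel>\<^sup>2 - 2 Re (f x)\<close>.\<close>

lemma riesz_representation:
  fixes f :: "'h::complex_hilbert_space \<Rightarrow> complex"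
  assumes f: "bounded_linear f" and fc: "\<And>c x. f (c *\<^sub>C x) = c * f x"
  shows "\<exists>z. \<forall>x. f x = cinner x z"
proof -
  interpret f: bounded_linear f by (rule f)
  define K where "K = onorm f"
  have K: "cmod (f x) \<le> K * norm x" for x unfolding K_def by (rule onorm[OF f])
  define \<phi> where "\<phi> x = (norm x)\<^sup>2 - 2 * Re (f x)" for x :: 'h
  have "- K\<^sup>2 \<le> \<phi> x" for x
  proof -
    have "Re (f x) \<le> K * norm x" using K[of x] complex_Re_le_cmod[of "f x"] by linarith
    moreover have "0 \<le> (norm x - K)\<^sup>2" by simp
    ultimately show ?thesis by (simp add: \<phi>_def power2_eq_square algebra_simps)
  qed
  then have bdd: "bdd_below (range \<phi>)" by (intro bdd_belowI2) auto
  define I where "I = (INF x. \<phi> x)"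
  have I: "I \<le> \<phi> x" for x unfolding I_def by (rule cINF_lower[OF bdd]) simp
  have "\<exists>x. \<phi> x < I + 1 / Suc n" for n
    using cINF_less_iff[of UNIV \<phi> "I + 1 / Suc n"] bdd by (auto simp: I_def)
  then obtain X where X: "\<And>n. \<phi> (X n) < I + 1 / Suc n" by metis
  \<comment> \<open>The parallelogram law with the midpoint \<open>w\<close>, where
    \<open>\<phi>\<close> is at least \<open>I\<close>: two almost minimisers are close to each
    other.\<close>
  have par: "(norm (x - y))\<^sup>2 \<le> 2 * (\<phi> x - I) + 2 * (\<phi> y - I)" for x y
  proof -
    define w where "w = (1/2) *\<^sub>R (x + y)"
    have "(norm w)\<^sup>2 = (norm (x + y))\<^sup>2 / 4" by (simp add: w_def power_divide)
    moreover have "Re (f w) = (Re (f x) + Re (f y)) / 2" by (simp add: w_def f.scaleR f.add)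
    ultimately show ?thesis using I[of w] parallelogram_law[of x y] by (simp add: \<phi>_def)
  qed
  have "Cauchy X"
  proof (rule CauchyI)
    fix e :: real assume "0 < e"
    then obtain N where N: "4 / e\<^sup>2 < real N" using reals_Archimedean2 by blast
    have "norm (X m - X n) < e" if "m \<ge> N" "n \<ge> N" for m n
    proof -
      have *: "1 / Suc k < e\<^sup>2 / 4" if "k \<ge> N" for k
      proof -
        have "4 < e\<^sup>2 * real N" using N \<open>0 < e\<close> by (simp add: divide_simps mult.commute)
        also have "\<dots> \<le> e\<^sup>2 * real (Suc k)" using that by (intro mult_left_mono) auto
        finally show ?thesis by (simp add: divide_simps)
      qed
      have "(norm (X m - X n))\<^sup>2 < e\<^sup>2"
      proof -
        have "\<phi> (X m) - I < e\<^sup>2 / 4" "\<phi> (X n) - I < e\<^sup>2 / 4"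
          using less_trans[OF X add_strict_left_mono[OF *[OF that(1)]]]
            less_trans[OF X add_strict_left_mono[OF *[OF that(2)]]] by simp_all
        then have "2 * (\<phi> (X m) - I) + 2 * (\<phi> (X n) - I) < 2 * (e\<^sup>2 / 4) + 2 * (e\<^sup>2 / 4)"
          by (intro add_strict_mono mult_strict_left_mono) simp_all
        then show ?thesis using par[of "X m" "X n"] by simp
      qed
      then show ?thesis using \<open>0 < e\<close> by (simp add: power2_less_imp_less)
    qed
    then show "\<exists>M. \<forall>m\<ge>M. \<forall>n\<ge>M. norm (X m - X n) < e" by blast
  qed
  then obtain z where z: "X \<longlonglongrightarrow> z" using Cauchy_convergent convergent_def by blast
  have "(\<lambda>n. \<phi> (X n)) \<longlonglongrightarrow> \<phi> z"
    unfolding \<phi>_def by (intro tendsto_intros z f.tendsto)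
  moreover have "(\<lambda>n. I + 1 / Suc n) \<longlonglongrightarrow> I + 0"
    by (intro tendsto_intros LIMSEQ_Suc[OF lim_1_over_n])
  ultimately have zI: "\<phi> z \<le> I"
    using X by (intro LIMSEQ_le[where X="\<lambda>n. \<phi> (X n)"]) (auto intro: less_imp_le)
  have Re_eq: "Re (f x) = Re (cinner x z)" for x
  proof -
    \<comment> \<open>First variation at the minimiser: a quadratic in \<open>t\<close> that is
      nonnegative and vanishes at 0 has no linear term. The choice \<open>t = - (D/n)\<close> below
      makes this explicit; the added 1 in \<open>n\<close> keeps the quotient meaningful for
      \<open>x = 0\<close>.\<close>
    have *: "0 \<le> t\<^sup>2 * (norm x)\<^sup>2 + 2 * t * (Re (cinner x z) - Re (f x))" for t
      using I[of "z + t *\<^sub>R x"] zI cinner_commute[of x z]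
      by (simp add: \<phi>_def power2_norm_add cinner_simps f.add f.scaleR power_mult_distrib algebra_simps)
    define D where "D = Re (cinner x z) - Re (f x)"
    define n where "n = (norm x)\<^sup>2 + 1"
    have n: "n > 0" "(norm x)\<^sup>2 \<le> n" by (auto simp: n_def add_nonneg_pos)
    have "0 \<le> (D/n)\<^sup>2 * (norm x)\<^sup>2 - 2 * (D/n) * D" using *[of "- (D/n)"] unfolding D_def[symmetric] by simp
    also have "\<dots> \<le> (D/n)\<^sup>2 * n - 2 * (D/n) * D" using n by (simp add: mult_left_mono)
    also have "\<dots> = - D\<^sup>2 / n" using n by (simp add: field_simps power2_eq_square)
    finally have "D = 0" using n by (simp add: divide_simps)
    then show ?thesis by (simp add: D_def)
  qed
  have "f x = cinner x z" for x
    using Re_eq[of x] Re_eq[of "\<i> *\<^sub>C x"] by (simp add: complex_eq_iff fc cinner_simps)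
  then show ?thesis by blast
qed

definition cadjoint :: "('h \<Rightarrow> 'h::complex_hilbert_space) \<Rightarrow> 'h \<Rightarrow> 'h" where
  "cadjoint T y = (SOME z. \<forall>x. cinner (T x) y = cinner x z)"

lemma cinner_cadjoint:
  assumes "bounded_clinear T"
  shows "cinner (T x) y = cinner x (cadjoint T y)"
proof -
  have "\<exists>z. \<forall>x. cinner (T x) y = cinner x z"
    by (rule riesz_representation)
      (use assms in \<open>auto simp: bounded_clinear_simps cinner_simps
        intro: bounded_linear_compose[OF bounded_linear_cinner_left bounded_clinear_linear]\<close>)
  from someI_ex[OF this] show ?thesis unfolding cadjoint_def by blast
qed

lemma norm_cadjoint_le:
  assumes T: "bounded_clinear T" and K: "\<And>x. norm (T x) \<le> K * norm x"
  shows "norm (cadjoint T y) \<le> K * norm y"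
proof (cases "cadjoint T y = 0")
  case True
  \<comment> \<open>A negative \<open>K\<close> can satisfy the hypothesis only if every vector is
    zero.\<close>
  have "0 \<le> K * norm y \<or> K < 0" by (simp add: zero_le_mult_iff) linarith
  then show ?thesis
  proof
    assume "K < 0"
    then have "norm y \<le> 0"
      using K[of y] norm_ge_zero[of "T y"] by (smt (verit) mult_neg_pos)
    then show ?thesis using True by simp
  qed (use True in simp)
next
  case False
  have "(norm (cadjoint T y))\<^sup>2 = cmod (cinner (cadjoint T y) (cadjoint T y))"
    by (simp add: cinner_self norm_power)
  also have "\<dots> = cmod (cinner (T (cadjoint T y)) y)"
    by (simp add: cinner_cadjoint[OF T])
  also have "\<dots> \<le> (K * norm (cadjoint T y)) * norm y"
    by (rule order_trans[OF cmod_cinner_le]) (simp add: K mult_right_mono)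
  finally show ?thesis using False by (simp add: power2_eq_square mult.assoc)
qed

lemma bounded_clinear_cadjoint:
  assumes T: "bounded_clinear T"
  shows "bounded_clinear (cadjoint T)"
proof (rule bounded_clinearI)
  show "cadjoint T (x + y) = cadjoint T x + cadjoint T y" for x y
    by (rule cinner_eqI') (simp add: cinner_simps cinner_cadjoint[OF T, symmetric])
  show "cadjoint T (c *\<^sub>C x) = c *\<^sub>C cadjoint T x" for c x
    by (rule cinner_eqI') (simp add: cinner_simps cinner_cadjoint[OF T, symmetric])
  show "norm (cadjoint T x) \<le> norm x * onorm T" for x
    using norm_cadjoint_le[OF T onorm_clinear[OF T], of x] by (simp add: mult.commute)
qed

lemma onorm_cadjoint_le:
  assumes T: "bounded_clinear T"
  shows "onorm (cadjoint T) \<le> onorm T"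
  by (rule onorm_bound) (auto intro: norm_cadjoint_le onorm_clinear onorm_clinear_nonneg T)

lemma cadjoint_eqI:
  assumes "bounded_clinear T" "\<And>x. cinner (T x) y = cinner x z"
  shows "cadjoint T y = z"
  by (rule cinner_eqI') (simp add: cinner_cadjoint[OF assms(1), symmetric] assms(2))

section \<open>Orthogonal families\<close>

text \<open>Bessel's inequality is what makes row and column sums of squared coefficients small, and
  it survives the presence of zero vectors; test families are therefore specified by it
  alone.\<close>

definition bessel_family :: "'i set \<Rightarrow> ('i \<Rightarrow> 'h::complex_hilbert_space) \<Rightarrow> bool" where
  "bessel_family I g \<longleftrightarrow> (\<forall>y. (\<Sum>i\<in>I. (cmod (cinner y (g i)))\<^sup>2) \<le> (norm y)\<^sup>2)"

text \<open>Zero vectors are allowed, so that a family can be padded to any prescribed length.\<close>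

definition orthonormal0 :: "'i set \<Rightarrow> ('i \<Rightarrow> 'h::complex_hilbert_space) \<Rightarrow> bool" where
  "orthonormal0 I g \<longleftrightarrow> (\<forall>i\<in>I. g i = 0 \<or> norm (g i) = 1) \<and>
     (\<forall>i\<in>I. \<forall>j\<in>I. i \<noteq> j \<longrightarrow> cinner (g i) (g j) = 0)"

lemma orthonormal0_cinner_sum:
  assumes "finite I" "orthonormal0 I g" "j \<in> I"
  shows "cinner (\<Sum>i\<in>I. c i *\<^sub>C g i) (g j) = (if g j = 0 then 0 else c j)"
proof -
  have "cinner (\<Sum>i\<in>I. c i *\<^sub>C g i) (g j) = (\<Sum>i\<in>I. if i = j then c j * cinner (g j) (g j) else 0)"
    unfolding cinner_sum_left cinner_scaleC_left
    by (rule sum.cong) (use assms in \<open>auto simp: orthonormal0_def\<close>)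
  also have "\<dots> = c j * cinner (g j) (g j)" using assms by simp
  finally show ?thesis using assms by (auto simp: orthonormal0_def cinner_self)
qed

lemma orthonormal0_norm_sum:
  assumes "finite I" "orthonormal0 I g"
  shows "(norm (\<Sum>i\<in>I. c i *\<^sub>C g i))\<^sup>2 = (\<Sum>i\<in>I. (cmod (c i))\<^sup>2 * (norm (g i))\<^sup>2)"
  using assms
  by (subst power2_norm_sum_orthogonal)
    (auto simp: orthonormal0_def cinner_simps norm_scaleC power_mult_distrib)

lemma orthonormal0_pythagoras:
  assumes "finite I" "orthonormal0 I g"
  shows "(norm y)\<^sup>2 = (\<Sum>i\<in>I. (cmod (cinner y (g i)))\<^sup>2)
    + (norm (y - (\<Sum>i\<in>I. cinner y (g i) *\<^sub>C g i)))\<^sup>2"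
proof -
  define P where "P = (\<Sum>i\<in>I. cinner y (g i) *\<^sub>C g i)"
  have Pg: "cinner P (g j) = cinner y (g j)" if "j \<in> I" for j
    using orthonormal0_cinner_sum[OF assms that] by (auto simp: P_def)
  have "cinner (y - P) P = (\<Sum>j\<in>I. cnj (cinner y (g j)) * cinner (y - P) (g j))"
    by (subst (2) P_def) (simp add: cinner_sum_right cinner_scaleC_right)
  also have "\<dots> = 0" by (intro sum.neutral) (simp add: cinner_diff_left Pg)
  finally have "(norm y)\<^sup>2 = (norm (y - P))\<^sup>2 + (norm P)\<^sup>2"
    using power2_norm_add[of "y - P" P] by simp
  moreover have "(norm P)\<^sup>2 = (\<Sum>i\<in>I. (cmod (cinner y (g i)))\<^sup>2)"
  proof -
    have "(cmod (cinner y (g i)))\<^sup>2 * (norm (g i))\<^sup>2 = (cmod (cinner y (g i)))\<^sup>2" if "i \<in> I" for i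
      using assms(2) that by (auto simp: orthonormal0_def)
    then show ?thesis unfolding P_def orthonormal0_norm_sum[OF assms] by (rule sum.cong[OF refl])
  qed
  ultimately show ?thesis by (simp add: P_def)
qed

lemma orthonormal0_bessel:
  assumes "finite I" "orthonormal0 I g"
  shows "bessel_family I g"
  unfolding bessel_family_def
proof
  fix y
  show "(\<Sum>i\<in>I. (cmod (cinner y (g i)))\<^sup>2) \<le> (norm y)\<^sup>2"
    unfolding orthonormal0_pythagoras[OF assms, of y] by simp
qed

text \<open>Bessel's inequality for \<open>y = g i\<close> contains the term
  \<open>norm (g i) ^ 4\<close> on the left and only \<open>norm (g i) ^ 2\<close> on the
  right.\<close>

lemma bessel_family_norm_le:
  assumes "bessel_family I g" "i \<in> I" "finite I"
  shows "norm (g i) \<le> 1"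
proof (cases "g i = 0")
  case False
  have "(cmod (cinner (g i) (g i)))\<^sup>2 \<le> (\<Sum>j\<in>I. (cmod (cinner (g i) (g j)))\<^sup>2)"
    by (rule member_le_sum) (use assms in auto)
  also have "\<dots> \<le> (norm (g i))\<^sup>2" using assms(1) by (simp add: bessel_family_def)
  finally have "((norm (g i))\<^sup>2)\<^sup>2 \<le> (norm (g i))\<^sup>2 * 1" by (simp add: cinner_self norm_power)
  then have "(norm (g i))\<^sup>2 \<le> 1"
    using False unfolding power2_eq_square[of "(norm (g i))\<^sup>2"]
    by (subst (asm) mult_le_cancel_left_pos) simp_all
  then show ?thesis by (simp add: power2_le_iff_abs_le abs_square_le_1)
qed simp

text \<open>The bound on \<open>card U\<close> is what later turns a spanning set of the range of
  \<open>F\<close> into a bound on the rank of the adjoint of \<open>F\<close>.\<close>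

lemma gram_schmidt:
  fixes B :: "'h::complex_hilbert_space set"
  assumes "finite B"
  shows "\<exists>U. finite U \<and> card U \<le> card B \<and> orthonormal0 U (\<lambda>u. u) \<and> B \<subseteq> complex_vector.span U"
  using assms
proof (induction B)
  case empty
  then show ?case by (intro exI[of _ "{}"]) (auto simp: orthonormal0_def)
next
  case (insert b B)
  then obtain U where U: "finite U" "card U \<le> card B" "orthonormal0 U (\<lambda>u. u)"
    "B \<subseteq> complex_vector.span U" by blast
  define P where "P = (\<Sum>u\<in>U. cinner b u *\<^sub>C u)"
  define v where "v = (1 / norm (b - P)) *\<^sub>R (b - P)"
  have vspan: "P \<in> complex_vector.span U" unfolding P_def
    by (intro complex_vector.span_sum complex_vector.span_scale complex_vector.span_base)
  have bP: "cinner (b - P) u = 0" if "u \<in> U" for u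
    using orthonormal0_cinner_sum[OF U(1,3) that, of "\<lambda>u. cinner b u"]
    by (auto simp: cinner_simps P_def)
  show ?case
  proof (cases "b = P")
    case True
    then show ?thesis using U insert(1,2) vspan by (intro exI[of _ U]) auto
  next
    case False
    have vu: "cinner v u = 0" "cinner u v = 0" if "u \<in> U" for u
      using bP[OF that] cinner_commute[of u v] by (simp_all add: v_def cinner_simps)
    have "orthonormal0 (insert v U) (\<lambda>u. u)"
      using U(3) False vu by (auto simp: orthonormal0_def v_def)
    moreover have "b \<in> complex_vector.span (insert v U)"
    proof -
      have b: "b = P + complex_of_real (norm (b - P)) *\<^sub>C v"
        using False by (simp add: v_def scaleR_scaleC[symmetric])
      show ?thesis
        by (subst b, intro complex_vector.span_add complex_vector.span_scale)
          (use vspan complex_vector.span_mono[of U "insert v U"] in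
            \<open>auto intro: complex_vector.span_base\<close>)
    qed
    moreover have "B \<subseteq> complex_vector.span (insert v U)"
      using U(4) complex_vector.span_mono[of U "insert v U"] by auto
    moreover have "card (insert v U) \<le> card (insert b B)"
      using U(1,2) insert(1,2) by (simp add: card_insert_if)
    ultimately show ?thesis using U(1) by (intro exI[of _ "insert v U"]) auto
  qed
qed

lemma orthonormal0_expand:
  assumes "finite U" "orthonormal0 U (\<lambda>u. u)" "y \<in> complex_vector.span U"
  shows "(\<Sum>u\<in>U. cinner y u *\<^sub>C u) = y"
proof -
  obtain c where y: "y = (\<Sum>u\<in>U. c u *\<^sub>C u)"
    using assms(3) unfolding complex_vector.span_finite[OF assms(1)] by blast
  have "cinner y u *\<^sub>C u = c u *\<^sub>C u" if "u \<in> U" for u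
    using orthonormal0_cinner_sum[OF assms(1,2) that, of c] by (auto simp: y)
  then have "(\<Sum>u\<in>U. cinner y u *\<^sub>C u) = (\<Sum>u\<in>U. c u *\<^sub>C u)" by (rule sum.cong[OF refl])
  then show ?thesis using y by simp
qed

section \<open>Singular values\<close>

lemma singular_value_le:
  assumes "bounded_clinear T" "bounded_clinear F" "rank_at_most F n"
  shows "singular_value T n \<le> onorm (\<lambda>x. T x - F x)"
  unfolding singular_value_def
  by (rule cInf_lower)
    (use assms in \<open>auto intro!: bdd_belowI[of _ 0] onorm_clinear_nonneg bounded_clinear_diff\<close>)

lemma rank_at_most_zero: "rank_at_most (\<lambda>_. 0) n"
  unfolding rank_at_most_def by (intro exI[of _ "{}"]) auto

lemma le_singular_value:
  assumes "\<And>F. bounded_clinear F \<Longrightarrow> rank_at_most F n \<Longrightarrow> c \<le> onorm (\<lambda>x. T x - F x)"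
  shows "c \<le> singular_value T n"
  unfolding singular_value_def
  by (rule cInf_greatest) (use assms rank_at_most_zero[of n] in \<open>auto intro: bounded_clinear_zero\<close>)

lemma singular_value_nonneg: "bounded_clinear T \<Longrightarrow> 0 \<le> singular_value T n"
  by (rule le_singular_value) (intro onorm_clinear_nonneg bounded_clinear_diff)

lemma singular_value_le_onorm: "bounded_clinear T \<Longrightarrow> singular_value T n \<le> onorm T"
  using singular_value_le[OF _ bounded_clinear_zero rank_at_most_zero, of T n] by simp

text \<open>Taking adjoints maps approximants of rank at most \<open>n\<close> to such approximants:
  if \<open>U\<close> is an orthonormal basis of a space containing the range of \<open>F\<close>,
  the range of \<open>cadjoint F\<close> is spanned by the images of \<open>U\<close>. The norm of
  the difference does not grow.\<close>

lemma singular_value_cadjoint_le: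
  assumes T: "bounded_clinear T"
  shows "singular_value (cadjoint T) n \<le> singular_value T n"
proof (rule le_singular_value)
  fix F :: "'a \<Rightarrow> 'a" assume F: "bounded_clinear F" "rank_at_most F n"
  then obtain B where B: "finite B" "card B \<le> n" "range F \<subseteq> complex_vector.span B"
    by (auto simp: rank_at_most_def)
  from gram_schmidt[OF B(1)] obtain U where U: "finite U" "card U \<le> card B"
    "orthonormal0 U (\<lambda>u. u)" "B \<subseteq> complex_vector.span U" by blast
  have FU: "F x \<in> complex_vector.span U" for x
    using B(3) complex_vector.span_mono[OF U(4)] by (auto simp: complex_vector.span_span)
  have F': "bounded_clinear (cadjoint F)" by (rule bounded_clinear_cadjoint[OF F(1)])
  have F'_eq: "cadjoint F y = (\<Sum>u\<in>U. cinner y u *\<^sub>C cadjoint F u)" for y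
  proof (rule cadjoint_eqI[OF F(1)])
    fix x
    have "cinner (F x) y = (\<Sum>u\<in>U. cinner (F x) u * cinner u y)"
      by (subst orthonormal0_expand[OF U(1,3) FU, symmetric]) (simp add: cinner_simps)
    also have "\<dots> = cinner x (\<Sum>u\<in>U. cinner y u *\<^sub>C cadjoint F u)"
      unfolding cinner_sum_right cinner_scaleC_right cinner_cadjoint[OF F(1), symmetric]
      by (intro sum.cong refl) (simp add: mult.commute cinner_commute[of _ y])
    finally show "cinner (F x) y = cinner x (\<Sum>u\<in>U. cinner y u *\<^sub>C cadjoint F u)" .
  qed
  have "range (cadjoint F) \<subseteq> complex_vector.span (cadjoint F ` U)"
    by (rule image_subsetI, subst F'_eq, intro complex_vector.span_sum complex_vector.span_scale
        complex_vector.span_base imageI)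
  moreover have "card (cadjoint F ` U) \<le> n"
    using card_image_le[OF U(1), of "cadjoint F"] U(2) B(2) by linarith
  ultimately have "rank_at_most (cadjoint F) n"
    using U(1) unfolding rank_at_most_def by blast
  then have "singular_value (cadjoint T) n \<le> onorm (\<lambda>x. cadjoint T x - cadjoint F x)"
    by (rule singular_value_le[OF bounded_clinear_cadjoint[OF T] F'])
  also have "(\<lambda>x. cadjoint T x - cadjoint F x) = cadjoint (\<lambda>x. T x - F x)"
    by (rule ext, rule cadjoint_eqI[symmetric])
      (auto simp: cinner_simps cinner_cadjoint[OF T] cinner_cadjoint[OF F(1)]
        intro: bounded_clinear_diff T F)
  also have "onorm \<dots> \<le> onorm (\<lambda>x. T x - F x)"
    by (intro onorm_cadjoint_le bounded_clinear_diff T F)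
  finally show "singular_value (cadjoint T) n \<le> onorm (\<lambda>x. T x - F x)" .
qed

section \<open>Almost singular vectors\<close>

text \<open>Gaussian elimination: an equation with a nonzero coefficient at \<open>j\<close> is used
  to eliminate the unknown \<open>j\<close> from the other equations, which leaves one equation and
  one unknown fewer.\<close>

lemma homogeneous_system:
  fixes a :: "'i \<Rightarrow> 'b \<Rightarrow> complex"
  assumes "finite B" "finite I" "card B < card I"
  shows "\<exists>c. (\<exists>i\<in>I. c i \<noteq> 0) \<and> (\<forall>b\<in>B. (\<Sum>i\<in>I. c i * a i b) = 0)"
  using assms
proof (induction B arbitrary: I a)
  case empty
  then obtain i where "i \<in> I" by fastforce
  then show ?case by (intro exI[of _ "\<lambda>_. 1"]) auto
next
  case (insert b B)
  show ?case
  proof (cases "\<forall>i\<in>I. a i b = 0")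
    case True
    have "card B < card I" using insert by simp
    from insert.IH[OF insert.prems(1) this, of a] True show ?thesis by auto
  next
    case False
    then obtain j where j: "j \<in> I" "a j b \<noteq> 0" by blast
    define I' where "I' = I - {j}"
    have I': "finite I'" "I = insert j I'" "j \<notin> I'" "card B < card I'"
      using insert j by (auto simp: I'_def card_Diff_singleton)
    from insert.IH[OF I'(1,4), of "\<lambda>i b'. a i b' - a i b / a j b * a j b'"]
    obtain c where c: "\<exists>i\<in>I'. c i \<noteq> 0"
      "\<And>b'. b' \<in> B \<Longrightarrow> (\<Sum>i\<in>I'. c i * (a i b' - a i b / a j b * a j b')) = 0" by blast
    \<comment> \<open>Back substitution: the value at \<open>j\<close> is chosen so that the
      eliminated equation \<open>b\<close> holds.\<close>
    define c' where "c' i = (if i = j then - (\<Sum>i\<in>I'. c i * a i b) / a j b else c i)" for i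
    have sum: "(\<Sum>i\<in>I. c' i * a i b') = - (\<Sum>i\<in>I'. c i * a i b) / a j b * a j b' + (\<Sum>i\<in>I'. c i * a i b')" for b'
    proof -
      have "(\<Sum>i\<in>I'. c' i * a i b') = (\<Sum>i\<in>I'. c i * a i b')"
        using I'(3) by (intro sum.cong) (auto simp: c'_def)
      then show ?thesis using I' by (simp add: c'_def)
    qed
    have "(\<Sum>i\<in>I. c' i * a i b') = 0" if "b' \<in> insert b B" for b'
    proof (cases "b' = b")
      case False
      then have "0 = (\<Sum>i\<in>I'. c i * (a i b' - a i b / a j b * a j b'))" using c(2) that by auto
      also have "\<dots> = (\<Sum>i\<in>I'. c i * a i b') - (\<Sum>i\<in>I'. c i * a i b) / a j b * a j b'"
        by (simp add: right_diff_distrib sum_subtractf sum_distrib_left sum_distrib_right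
            sum_divide_distrib mult_ac)
      finally show ?thesis unfolding sum by simp
    qed (use j in \<open>simp add: sum\<close>)
    moreover have "\<exists>i\<in>I. c' i \<noteq> 0" using c(1) I' by (auto simp: c'_def)
    ultimately show ?thesis by blast
  qed
qed

section \<open>Deflation and greedy systems\<close>

lemma orthonormal0_norm_le: "orthonormal0 I g \<Longrightarrow> i \<in> I \<Longrightarrow> norm (g i) \<le> 1"
  by (force simp: orthonormal0_def)

text \<open>For orthonormal \<open>h\<close> this is \<open>T\<close> followed by the projection
  onto the orthogonal complement of \<open>h 0\<close>, ..., \<open>h (k - 1)\<close>.\<close>

definition deflate :: "('h \<Rightarrow> 'h::complex_hilbert_space) \<Rightarrow> (nat \<Rightarrow> 'h) \<Rightarrow> nat \<Rightarrow> 'h \<Rightarrow> 'h" where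
  "deflate T h k x = T x - (\<Sum>l<k. cinner (T x) (h l) *\<^sub>C h l)"

lemma bounded_clinear_deflate:
  assumes T: "bounded_clinear T"
  shows "bounded_clinear (deflate T h k)"
proof -
  have "bounded_clinear (\<lambda>y. y - (\<Sum>l<k. cinner y (h l) *\<^sub>C h l))"
    by (intro bounded_clinear_diff bounded_clinear_id bounded_clinear_sum bounded_clinear_rank_one)
  from bounded_clinear_compose[OF this T] show ?thesis by (simp add: deflate_def[abs_def])
qed

text \<open>Whatever the vectors \<open>h l\<close> are, the part subtracted from \<open>T\<close>
  has rank at most \<open>k\<close>, so it competes in the infimum.\<close>

lemma singular_value_le_deflate:
  assumes T: "bounded_clinear T"
  shows "singular_value T k \<le> onorm (deflate T h k)"
proof -
  let ?F = "\<lambda>x. \<Sum>l<k. cinner (T x) (h l) *\<^sub>C h l"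
  have "bounded_clinear ?F"
    by (intro bounded_clinear_compose[OF _ T, where S = "\<lambda>y. \<Sum>l<k. cinner y (h l) *\<^sub>C h l"]
        bounded_clinear_sum bounded_clinear_rank_one)
  moreover have "rank_at_most ?F k"
    unfolding rank_at_most_def
  proof (intro exI[of _ "h ` {..<k}"] conjI)
    show "card (h ` {..<k}) \<le> k" using card_image_le[of "{..<k}" h] by simp
    show "range ?F \<subseteq> complex_vector.span (h ` {..<k})"
      by (intro image_subsetI complex_vector.span_sum complex_vector.span_scale
          complex_vector.span_base imageI)
  qed simp
  ultimately have "singular_value T k \<le> onorm (\<lambda>x. T x - ?F x)" by (rule singular_value_le[OF T])
  then show ?thesis by (simp add: deflate_def[abs_def])
qed

lemma orthonormal0_extend:
  assumes "orthonormal0 {..<n} g" "v = 0 \<or> norm v = 1" "\<And>k. k < n \<Longrightarrow> cinner v (g k) = 0"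
  shows "orthonormal0 {..<Suc n} (g(n := v))"
proof -
  have "cinner (g k) v = 0" if "k < n" for k
    using assms(3)[OF that] cinner_commute[of "g k" v] by simp
  then show ?thesis using assms by (auto simp: orthonormal0_def less_Suc_eq)
qed

text \<open>A substitute for the singular value decomposition that needs no compactness: \<open>g k\<close> almost
  maximises the deflated operator and \<open>h k\<close> is its normalised image. Hence \<open>T\<close> is triangular with
  respect to these families and \<open>T\<^sup>* h\<^sub>k\<close> is close to a multiple of \<open>g\<^sub>k\<close>.\<close>

definition greedy_system ::
    "('h \<Rightarrow> 'h::complex_hilbert_space) \<Rightarrow> real \<Rightarrow> nat \<Rightarrow> (nat \<Rightarrow> 'h) \<Rightarrow> (nat \<Rightarrow> 'h) \<Rightarrow> bool" where
  "greedy_system T \<epsilon> n g h \<longleftrightarrow> orthonormal0 {..<n} g \<and> orthonormal0 {..<n} h \<and>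
     (\<forall>k<n. deflate T h k (g k) = norm (deflate T h k (g k)) *\<^sub>R h k \<and>
            (1 - \<epsilon>) * onorm (deflate T h k) \<le> norm (deflate T h k (g k)))"

lemma greedy_system_apply:
  assumes "greedy_system T \<epsilon> n g h" "k < n"
  shows "T (g k) = norm (deflate T h k (g k)) *\<^sub>R h k + (\<Sum>l<k. cinner (T (g k)) (h l) *\<^sub>C h l)"
proof -
  have "deflate T h k (g k) = norm (deflate T h k (g k)) *\<^sub>R h k"
    using assms by (simp add: greedy_system_def)
  then show ?thesis unfolding deflate_def by (simp add: algebra_simps)
qed

lemma deflate_orthogonal:
  assumes "orthonormal0 {..<n} h" "k < n"
  shows "cinner (deflate T h n x) (h k) = 0"
  using orthonormal0_cinner_sum[of "{..<n}" h k "\<lambda>l. cinner (T x) (h l)"] assms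
  by (auto simp: deflate_def cinner_diff_left)

text \<open>Triangularity: \<open>T (g k)\<close> is a combination of \<open>h 0\<close>, ...,
  \<open>h k\<close> only, so every deflation of order larger than \<open>k\<close> kills
  \<open>g k\<close>. This allows the next almost maximiser to be taken orthogonal to all earlier
  ones.\<close>

lemma greedy_system_deflate_zero:
  assumes "greedy_system T \<epsilon> n g h" "k < n"
  shows "deflate T h n (g k) = 0"
proof -
  have oh: "orthonormal0 {..<n} h" using assms by (simp add: greedy_system_def)
  define c where "c l = (if l < k then cinner (T (g k)) (h l)
    else if l = k then of_real (norm (deflate T h k (g k))) else 0)" for l
  have n: "{..<n} = {..<k} \<union> {k} \<union> {k<..<n}" using assms(2) by auto
  have "(\<Sum>l<n. c l *\<^sub>C h l) = (\<Sum>l<k. c l *\<^sub>C h l) + c k *\<^sub>C h k + (\<Sum>l\<in>{k<..<n}. c l *\<^sub>C h l)"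
    unfolding n by (subst sum.union_disjoint, auto)+
  also have "(\<Sum>l\<in>{k<..<n}. c l *\<^sub>C h l) = 0"
    by (intro sum.neutral) (auto simp: c_def)
  also have "(\<Sum>l<k. c l *\<^sub>C h l) = (\<Sum>l<k. cinner (T (g k)) (h l) *\<^sub>C h l)"
    by (simp add: c_def)
  finally have T: "T (g k) = (\<Sum>l<n. c l *\<^sub>C h l)"
    by (subst greedy_system_apply[OF assms]) (simp add: c_def scaleR_scaleC add.commute)
  have "(\<Sum>l<n. cinner (T (g k)) (h l) *\<^sub>C h l) = (\<Sum>l<n. c l *\<^sub>C h l)"
  proof (rule sum.cong[OF refl])
    fix l assume "l \<in> {..<n}"
    then have "cinner (\<Sum>l<n. c l *\<^sub>C h l) (h l) = (if h l = 0 then 0 else c l)"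
      by (intro orthonormal0_cinner_sum oh) auto
    then show "cinner (T (g k)) (h l) *\<^sub>C h l = c l *\<^sub>C h l" using T by auto
  qed
  then show ?thesis using T by (simp add: deflate_def)
qed

lemma greedy_system_exists:
  fixes T :: "'h \<Rightarrow> 'h::complex_hilbert_space"
  assumes T: "bounded_clinear T" and \<epsilon>: "0 < \<epsilon>" "\<epsilon> < 1"
  shows "\<exists>g h. greedy_system T \<epsilon> n g h"
proof (induction n)
  case 0
  show ?case by (simp add: greedy_system_def orthonormal0_def)
next
  case (Suc n)
  then obtain g h where gh: "greedy_system T \<epsilon> n g h" by blast
  define R where "R = deflate T h n"
  have R: "bounded_clinear R" unfolding R_def by (rule bounded_clinear_deflate[OF T])
  have og: "orthonormal0 {..<n} g" and oh: "orthonormal0 {..<n} h"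
    using gh by (auto simp: greedy_system_def)
  have "\<exists>u v. (u = 0 \<or> norm u = 1) \<and> (v = 0 \<or> norm v = 1) \<and> (\<forall>k<n. cinner u (g k) = 0) \<and>
      (\<forall>k<n. cinner v (h k) = 0) \<and> R u = norm (R u) *\<^sub>R v \<and> (1 - \<epsilon>) * onorm R \<le> norm (R u)"
  proof (cases "onorm R = 0")
    case True
    \<comment> \<open>Once the deflated operator vanishes, the system is continued by zero
      vectors.\<close>
    then show ?thesis by (intro exI[of _ 0]) (simp add: bounded_clinear_simps[OF R])
  next
    case False
    then have pos: "onorm R > 0" using onorm_clinear_nonneg[OF R] by linarith
    have "\<exists>x. norm (R x) > (1 - \<epsilon>) * onorm R * norm x"
    proof (rule ccontr)
      assume "\<not> ?thesis"
      then have "onorm R \<le> (1 - \<epsilon>) * onorm R"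
        using \<epsilon> pos by (intro onorm_bound) (auto simp: not_less)
      then show False using mult_pos_pos[OF \<epsilon>(1) pos] by (simp add: algebra_simps)
    qed
    then obtain x where x: "norm (R x) > (1 - \<epsilon>) * onorm R * norm x" by blast
    \<comment> \<open>Removing the components along the earlier \<open>g k\<close>, which
      \<open>R\<close> kills, leaves \<open>R x\<close> unchanged and does not increase the norm, so
      \<open>y\<close> is at least as good as \<open>x\<close>.\<close>
    define y where "y = x - (\<Sum>k<n. cinner x (g k) *\<^sub>C g k)"
    have Ry: "R y = R x"
      using greedy_system_deflate_zero[OF gh]
      by (simp add: y_def bounded_clinear_simps[OF R]) (simp add: R_def)
    have "(norm y)\<^sup>2 \<le> (norm x)\<^sup>2"
      using orthonormal0_pythagoras[OF _ og, of x] by (simp add: y_def sum_nonneg)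
    then have ny: "norm y \<le> norm x" by (rule power2_le_imp_le) simp
    have "0 \<le> (1 - \<epsilon>) * onorm R * norm x" using \<epsilon> pos by simp
    then have Ry0: "norm (R y) > 0" using x unfolding Ry by linarith
    then have y0: "y \<noteq> 0" using bounded_clinear_simps(3)[OF R] by auto
    have yg: "cinner y (g k) = 0" if "k < n" for k
      using orthonormal0_cinner_sum[OF _ og, of k "\<lambda>k. cinner x (g k)"] that
      by (auto simp: y_def cinner_diff_left)
    define u where "u = (1 / norm y) *\<^sub>R y"
    have Ru: "R u = (1 / norm y) *\<^sub>R R y"
      using bounded_clinear_simps(6)[OF R] by (simp add: u_def scaleR_scaleC del: of_real_divide)
    then have Ru0: "norm (R u) > 0" using Ry0 y0 by simp
    define v where "v = (1 / norm (R u)) *\<^sub>R R u"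
    have "(1 - \<epsilon>) * onorm R * norm y \<le> norm (R y)"
    proof -
      have "(1 - \<epsilon>) * onorm R * norm y \<le> (1 - \<epsilon>) * onorm R * norm x"
        using \<epsilon> pos by (intro mult_left_mono ny) simp
      then show ?thesis using x unfolding Ry by linarith
    qed
    then have "(1 - \<epsilon>) * onorm R \<le> norm (R u)"
      using y0 by (simp add: Ru field_simps)
    moreover have "cinner v (h k) = 0" if "k < n" for k
      using deflate_orthogonal[OF oh that] by (simp add: v_def cinner_simps R_def)
    ultimately show ?thesis using y0 Ru0 yg
      by (intro exI[of _ u] exI[of _ v]) (simp add: v_def, simp add: u_def cinner_simps)
  qed
  then obtain u v where uv: "u = 0 \<or> norm u = 1" "v = 0 \<or> norm v = 1"
    "\<And>k. k < n \<Longrightarrow> cinner u (g k) = 0" "\<And>k. k < n \<Longrightarrow> cinner v (h k) = 0"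
    "R u = norm (R u) *\<^sub>R v" "(1 - \<epsilon>) * onorm R \<le> norm (R u)" by blast
  \<comment> \<open>A deflation of order \<open>k\<close> only sees \<open>h l\<close> with
    \<open>l < k\<close>; appending \<open>v\<close> at index \<open>n\<close> leaves the orders up
    to \<open>n\<close> alone.\<close>
  have def: "deflate T (h(n := v)) k = deflate T h k" if "k \<le> n" for k
  proof
    fix x
    have "(\<Sum>l<k. cinner (T x) ((h(n := v)) l) *\<^sub>C (h(n := v)) l) = (\<Sum>l<k. cinner (T x) (h l) *\<^sub>C h l)"
      using that by (intro sum.cong) auto
    then show "deflate T (h(n := v)) k x = deflate T h k x" by (simp only: deflate_def)
  qed
  have "greedy_system T \<epsilon> (Suc n) (g(n := u)) (h(n := v))"
    unfolding greedy_system_def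
  proof (intro conjI allI impI)
    fix k assume "k < Suc n"
    then consider "k < n" | "k = n" by linarith
    then show "deflate T (h(n := v)) k ((g(n := u)) k)
        = norm (deflate T (h(n := v)) k ((g(n := u)) k)) *\<^sub>R (h(n := v)) k"
      "(1 - \<epsilon>) * onorm (deflate T (h(n := v)) k) \<le> norm (deflate T (h(n := v)) k ((g(n := u)) k))"
      using gh uv(5,6) by (cases; simp add: def greedy_system_def R_def)+
  qed (use orthonormal0_extend[OF og uv(1,3)] orthonormal0_extend[OF oh uv(2,4)] in auto)
  then show ?case by blast
qed

lemma greedy_system_cinner:
  assumes gh: "greedy_system T \<epsilon> n g h" and k: "k < n"
  shows "cinner (T (g k)) (h k) = of_real (norm (deflate T h k (g k)))"
proof -
  have oh: "\<forall>i<n. \<forall>j<n. i \<noteq> j \<longrightarrow> cinner (h i) (h j) = 0" "h k = 0 \<or> norm (h k) = 1"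
    using gh k by (auto simp: greedy_system_def orthonormal0_def)
  have eq: "deflate T h k (g k) = norm (deflate T h k (g k)) *\<^sub>R h k"
    using gh k by (simp add: greedy_system_def)
  have "cinner (T (g k)) (h k) = of_real (norm (deflate T h k (g k))) * cinner (h k) (h k)"
    by (subst greedy_system_apply[OF gh k])
      (use oh k in \<open>simp add: cinner_simps scaleR_conv_of_real\<close>)
  then show ?thesis using oh(2) eq by (auto simp: cinner_self)
qed

text \<open>These are the families on which the final operator is tested: its diagonal entries there
  reach the singular values up to the factor \<open>1 - \<epsilon>\<close>.\<close>

lemma singular_value_lower_families:
  fixes T :: "'h \<Rightarrow> 'h::complex_hilbert_space"
  assumes T: "bounded_clinear T" and \<epsilon>: "0 < \<epsilon>" "\<epsilon> < 1"
  shows "\<exists>g h. bessel_family {..<n} g \<and> bessel_family {..<n} h \<and>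
    (\<forall>k<n. (1 - \<epsilon>) * singular_value T k \<le> cmod (cinner (T (g k)) (h k)))"
proof -
  obtain g h where gh: "greedy_system T \<epsilon> n g h" using greedy_system_exists[OF assms] by blast
  have "(1 - \<epsilon>) * singular_value T k \<le> cmod (cinner (T (g k)) (h k))" if "k < n" for k
  proof -
    have "(1 - \<epsilon>) * singular_value T k \<le> (1 - \<epsilon>) * onorm (deflate T h k)"
      using \<epsilon> by (intro mult_left_mono singular_value_le_deflate T) simp
    also have "\<dots> \<le> norm (deflate T h k (g k))" using gh that by (simp add: greedy_system_def)
    finally show ?thesis by (simp add: greedy_system_cinner[OF gh that])
  qed
  moreover have "bessel_family {..<n} g" "bessel_family {..<n} h"
    using gh by (auto simp: greedy_system_def intro: orthonormal0_bessel)
  ultimately show ?thesis by blast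
qed

section \<open>Upper estimates from a greedy system\<close>

lemma norm_deflate_antimono:
  assumes "orthonormal0 {..<n} h" "l \<le> k" "k \<le> n"
  shows "norm (deflate T h k x) \<le> norm (deflate T h l x)"
proof -
  have "(norm (deflate T h j x))\<^sup>2 = (norm (T x))\<^sup>2 - (\<Sum>i<j. (cmod (cinner (T x) (h i)))\<^sup>2)"
    if "j \<le> n" for j
    using orthonormal0_pythagoras[of "{..<j}" h "T x"] assms(1) that
    by (simp add: deflate_def orthonormal0_def)
  moreover have "(\<Sum>i<l. (cmod (cinner (T x) (h i)))\<^sup>2) \<le> (\<Sum>i<k. (cmod (cinner (T x) (h i)))\<^sup>2)"
    using assms(2) by (intro sum_mono2) auto
  ultimately have "(norm (deflate T h k x))\<^sup>2 \<le> (norm (deflate T h l x))\<^sup>2"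
    using assms by simp
  then show ?thesis by (rule power2_le_imp_le) simp
qed

lemma onorm_deflate_antimono:
  assumes "bounded_clinear T" "orthonormal0 {..<n} h" "l \<le> k" "k \<le> n"
  shows "onorm (deflate T h k) \<le> onorm (deflate T h l)"
proof (rule onorm_bound)
  show "norm (deflate T h k x) \<le> onorm (deflate T h l) * norm x" for x
    using norm_deflate_antimono[OF assms(2-4)] onorm_clinear[OF bounded_clinear_deflate[OF assms(1)]]
    by (rule order_trans)
qed (intro onorm_clinear_nonneg bounded_clinear_deflate assms)

lemma deflate_0 [simp]: "deflate T h 0 = T"
  by (simp add: deflate_def fun_eq_iff)

text \<open>With \<tau> the norm of the deflated operator, the adjoint vector has norm at most
  \<tau>, while its inner product with \<open>g k\<close> is at least
  \<open>(1 - \<epsilon>) * \<tau>\<close>. Expanding the square of the difference leaves at most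
  \<open>\<tau>\<^sup>2 - 2 * (1 - \<epsilon>) * \<tau>\<^sup>2 + \<tau>\<^sup>2\<close>, that is
  \<open>2 * \<epsilon> * \<tau>\<^sup>2\<close>.\<close>

lemma greedy_system_adjoint:
  assumes T: "bounded_clinear T" and gh: "greedy_system T \<epsilon> n g h" and k: "k < n" and "0 < \<epsilon>"
  shows "norm (cadjoint T (h k) - onorm (deflate T h k) *\<^sub>R g k) \<le> sqrt (2 * \<epsilon>) * onorm (deflate T h k)"
proof -
  define R where "R = deflate T h k"
  have R: "bounded_clinear R" unfolding R_def by (rule bounded_clinear_deflate[OF T])
  define \<tau> where "\<tau> = onorm R"
  have \<tau>: "0 \<le> \<tau>" unfolding \<tau>_def by (rule onorm_clinear_nonneg[OF R])
  have gk: "norm (g k) \<le> 1" and hk: "norm (h k) \<le> 1"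
    using gh k by (auto simp: greedy_system_def intro: orthonormal0_norm_le)
  have oh: "\<forall>i<n. \<forall>j<n. i \<noteq> j \<longrightarrow> cinner (h i) (h j) = 0"
    using gh by (auto simp: greedy_system_def orthonormal0_def)
  have "cadjoint T (h k) = cadjoint R (h k)"
  proof (rule cadjoint_eqI[OF T])
    fix x
    have "cinner (T x) (h k) = cinner (R x) (h k)"
      using oh k by (simp add: R_def deflate_def cinner_simps)
    then show "cinner (T x) (h k) = cinner x (cadjoint R (h k))" by (simp add: cinner_cadjoint[OF R])
  qed
  then have "norm (cadjoint T (h k)) \<le> \<tau> * norm (h k)"
    using norm_cadjoint_le[OF R onorm_clinear[OF R]] by (simp add: \<tau>_def)
  also have "\<dots> \<le> \<tau> * 1" using \<tau> hk by (intro mult_left_mono)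
  finally have u: "(norm (cadjoint T (h k)))\<^sup>2 \<le> \<tau>\<^sup>2" by (simp add: power_mono)
  have "Re (cinner (cadjoint T (h k)) (g k)) = Re (cinner (g k) (cadjoint T (h k)))"
    using cinner_commute[of "g k"] by simp
  also have "\<dots> = norm (R (g k))"
    by (simp add: cinner_cadjoint[OF T, symmetric] greedy_system_cinner[OF gh k] R_def)
  also have "\<dots> \<ge> (1 - \<epsilon>) * \<tau>" using gh k by (simp add: greedy_system_def R_def \<tau>_def)
  finally have "(1 - \<epsilon>) * \<tau> * \<tau> \<le> \<tau> * Re (cinner (cadjoint T (h k)) (g k))"
    using \<tau> by (simp add: mult.commute mult_left_mono)
  moreover have "(norm (\<tau> *\<^sub>R g k))\<^sup>2 \<le> \<tau>\<^sup>2"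
    using gk \<tau> by (intro power_mono) (auto simp: mult_left_le)
  ultimately have "(norm (cadjoint T (h k) - \<tau> *\<^sub>R g k))\<^sup>2 \<le> 2 * \<epsilon> * \<tau>\<^sup>2"
    using u by (simp only: power2_norm_diff cinner_scaleR_right)
      (simp add: algebra_simps power2_eq_square)
  also have "\<dots> = (sqrt (2 * \<epsilon>) * \<tau>)\<^sup>2" using \<open>0 < \<epsilon>\<close> by (simp add: power_mult_distrib)
  finally show ?thesis unfolding R_def[symmetric] \<tau>_def[symmetric]
    by (rule power2_le_imp_le) (use \<tau> \<open>0 < \<epsilon>\<close> in simp)
qed

lemma cinner_span_eq_0:
  assumes "y \<in> complex_vector.span B" "\<And>b. b \<in> B \<Longrightarrow> cinner b x = 0"
  shows "cinner y x = 0"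
  using assms(1)
  by (induction rule: complex_vector.span_induct_alt) (auto simp: cinner_simps assms(2))

text \<open>The converse of \<open>singular_value_le_deflate\<close> up to an error. An operator
  \<open>F\<close> of rank at most \<open>k\<close> cannot cover the span of the
  \<open>k + 1\<close> vectors \<open>h 0\<close>, ..., \<open>h k\<close>; on a vector
  \<open>x\<close> of this span orthogonal to the range of \<open>F\<close>, the adjoint of
  \<open>T\<close> equals that of \<open>T - F\<close>, and it nearly multiplies the coefficients by
  numbers that are at least \<tau> \<open>k\<close>. Each of the \<open>k + 1\<close> vectors
  contributes one adjoint error.\<close>

lemma onorm_deflate_le:
  assumes T: "bounded_clinear T" and gh: "greedy_system T \<epsilon> n g h" and k: "k < n"
    and \<epsilon>: "0 < \<epsilon>" "\<epsilon> < 1"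
  shows "onorm (deflate T h k) \<le> singular_value T k + Suc k * (sqrt (2 * \<epsilon>) * onorm T)"
proof -
  define \<tau> where "\<tau> l = onorm (deflate T h l)" for l
  define e where "e = sqrt (2 * \<epsilon>)"
  have e: "e > 0" using \<epsilon> by (simp add: e_def)
  have og: "orthonormal0 {..<n} g" and oh: "orthonormal0 {..<n} h"
    using gh by (auto simp: greedy_system_def)
  have t0: "0 \<le> onorm T" by (rule onorm_clinear_nonneg[OF T])
  show ?thesis
  \<comment> \<open>If \<tau> \<open>k\<close> is positive, so are all earlier norms, and none of
    the vectors up to index \<open>k\<close> is a padding zero.\<close>
  proof (cases "\<tau> k = 0")
    case True
    then show ?thesis using singular_value_nonneg[OF T, of k] t0 \<epsilon> by (simp add: \<tau>_def)
  next
    case False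
    then have \<tau>k: "\<tau> k > 0"
      using onorm_clinear_nonneg[OF bounded_clinear_deflate[OF T]] by (auto simp: \<tau>_def less_le)
    have \<tau>l: "\<tau> k \<le> \<tau> l" "\<tau> l \<le> onorm T" if "l \<le> k" for l
      using onorm_deflate_antimono[OF T oh, of l k] onorm_deflate_antimono[OF T oh, of 0 l] that k
      by (auto simp: \<tau>_def)
    have unit: "norm (h l) = 1" "norm (g l) = 1" if "l \<le> k" for l
    proof -
      have "0 < (1 - \<epsilon>) * \<tau> l" using \<tau>k \<tau>l(1)[OF that] \<epsilon> by simp
      also have "\<dots> \<le> norm (deflate T h l (g l))"
        using gh that k by (simp add: greedy_system_def \<tau>_def)
      finally have pos: "norm (deflate T h l (g l)) > 0" .
      have "deflate T h l (g l) = norm (deflate T h l (g l)) *\<^sub>R h l"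
        using gh that k by (simp add: greedy_system_def)
      then have "h l \<noteq> 0" using pos by auto
      moreover have "g l \<noteq> 0"
        using pos bounded_clinear_simps(3)[OF bounded_clinear_deflate[OF T]] by auto
      ultimately show "norm (h l) = 1" "norm (g l) = 1"
        using og oh that k by (auto simp: orthonormal0_def)
    qed
    have "onorm (deflate T h k) - Suc k * (e * onorm T) \<le> singular_value T k"
    proof (rule le_singular_value)
      fix F :: "'a \<Rightarrow> 'a" assume F: "bounded_clinear F" "rank_at_most F k"
      then obtain B where B: "finite B" "card B \<le> k" "range F \<subseteq> complex_vector.span B"
        by (auto simp: rank_at_most_def)
      \<comment> \<open>There are \<open>k + 1\<close> unknown coefficients and at most
        \<open>k\<close> orthogonality conditions.\<close>
      have "card B < card {..k}" using B(2) by simp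
      from homogeneous_system[OF B(1) _ this, of "\<lambda>l b. cinner (h l) b"]
      obtain c where c: "\<exists>l\<in>{..k}. c l \<noteq> 0" "\<And>b. b \<in> B \<Longrightarrow> (\<Sum>l\<le>k. c l * cinner (h l) b) = 0"
        by auto
      define x where "x = (\<Sum>l\<le>k. c l *\<^sub>C h l)"
      have sub: "orthonormal0 {..k} h" "orthonormal0 {..k} g"
        using og oh k by (auto simp: orthonormal0_def)
      have nx: "(norm x)\<^sup>2 = (\<Sum>l\<le>k. (cmod (c l))\<^sup>2)"
        unfolding x_def orthonormal0_norm_sum[OF finite_atMost sub(1)] by (simp add: unit)
      have "0 < (norm x)\<^sup>2" unfolding nx using c(1) by (auto intro!: sum_pos2)
      then have x0: "norm x > 0" by simp
      have cl: "cmod (c l) \<le> norm x" if "l \<le> k" for l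
        by (rule power2_le_imp_le) (use that in \<open>auto simp: nx intro: member_le_sum\<close>)
      have "cinner x b = 0" if "b \<in> B" for b using c(2)[OF that] by (simp add: x_def cinner_simps)
      then have "cinner b x = 0" if "b \<in> B" for b
        using that cinner_commute[of b x] by simp
      then have Fx: "cinner (F y) x = 0" for y
        by (rule cinner_span_eq_0[OF subsetD[OF B(3) rangeI]])
      define u where "u = cadjoint T x"
      have u: "u = (\<Sum>l\<le>k. c l *\<^sub>C cadjoint T (h l))"
        by (simp add: u_def x_def bounded_clinear_simps[OF bounded_clinear_cadjoint[OF T]])
      have D: "bounded_clinear (\<lambda>y. T y - F y)" by (intro bounded_clinear_diff T F)
      have "(norm u)\<^sup>2 = cmod (cinner (T u) x)"
        by (simp add: cinner_cadjoint[OF T] u_def[symmetric] cinner_self norm_power)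
      also have "\<dots> = cmod (cinner (T u - F u) x)" by (simp add: cinner_diff_left Fx)
      also have "\<dots> \<le> (onorm (\<lambda>y. T y - F y) * norm u) * norm x"
        by (rule order_trans[OF cmod_cinner_le]) (simp add: mult_right_mono onorm_clinear[OF D])
      finally have "(norm u)\<^sup>2 \<le> onorm (\<lambda>y. T y - F y) * norm u * norm x" .
      then have upper: "norm u \<le> onorm (\<lambda>y. T y - F y) * norm x"
        using onorm_clinear_nonneg[OF D] x0
        by (cases "u = 0") (auto simp: power2_eq_square mult_ac)
      \<comment> \<open>The vector that \<open>u\<close> would be if the adjoint of \<open>T\<close>
        mapped \<open>h l\<close> exactly to \<tau> \<open>l\<close> times
        \<open>g l\<close>.\<close>
      define v where "v = (\<Sum>l\<le>k. (c l * of_real (\<tau> l)) *\<^sub>C g l)"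
      have "(norm v)\<^sup>2 = (\<Sum>l\<le>k. (cmod (c l))\<^sup>2 * (\<tau> l)\<^sup>2)"
        unfolding v_def orthonormal0_norm_sum[OF finite_atMost sub(2)]
        by (simp add: unit norm_mult power_mult_distrib)
      also have "\<dots> \<ge> (\<Sum>l\<le>k. (cmod (c l))\<^sup>2 * (\<tau> k)\<^sup>2)"
        using \<tau>k \<tau>l(1) by (intro sum_mono mult_left_mono power_mono) auto
      finally have "(\<tau> k * norm x)\<^sup>2 \<le> (norm v)\<^sup>2"
        by (simp add: power_mult_distrib nx sum_distrib_left mult.commute)
      then have v: "\<tau> k * norm x \<le> norm v" by (rule power2_le_imp_le) simp
      have "u - v = (\<Sum>l\<le>k. c l *\<^sub>C (cadjoint T (h l) - \<tau> l *\<^sub>R g l))"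
        by (simp add: u v_def sum_subtractf[symmetric] complex_vector.scale_right_diff_distrib
            scaleR_scaleC scaleC_scaleC)
      then have "norm (u - v) \<le> (\<Sum>l\<le>k. cmod (c l) * norm (cadjoint T (h l) - \<tau> l *\<^sub>R g l))"
        unfolding norm_scaleC[symmetric] by (simp only: norm_sum)
      also have "\<dots> \<le> (\<Sum>l\<le>k. norm x * (e * onorm T))"
      proof (intro sum_mono mult_mono)
        fix l assume l: "l \<in> {..k}"
        have "norm (cadjoint T (h l) - \<tau> l *\<^sub>R g l) \<le> e * \<tau> l"
          using greedy_system_adjoint[OF T gh _ \<epsilon>(1), of l] l k by (simp add: \<tau>_def e_def)
        also have "\<dots> \<le> e * onorm T" using \<tau>l(2) l e by simp
        finally show "norm (cadjoint T (h l) - \<tau> l *\<^sub>R g l) \<le> e * onorm T" .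
      qed (use cl in auto)
      also have "\<dots> = Suc k * (e * onorm T) * norm x" by simp
      finally have "\<tau> k * norm x - Suc k * (e * onorm T) * norm x \<le> onorm (\<lambda>y. T y - F y) * norm x"
        using v upper norm_triangle_ineq2[of v u] norm_minus_commute[of u v] by linarith
      then have "(\<tau> k - Suc k * (e * onorm T)) * norm x \<le> onorm (\<lambda>y. T y - F y) * norm x"
        by (simp only: left_diff_distrib)
      then show "onorm (deflate T h k) - Suc k * (e * onorm T) \<le> onorm (\<lambda>y. T y - F y)"
        using x0 by (simp add: \<tau>_def del: of_nat_Suc)
    qed
    then show ?thesis unfolding e_def by linarith
  qed
qed

text \<open>A finite-rank majorant of the quadratic form \<open>(norm (T y))\<^sup>2\<close>: the
  coefficients of \<open>T y\<close> along the greedy \<open>h k\<close> are compared with those of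
  \<open>y\<close> along \<open>g k\<close> by the adjoint estimate, and the rest is the deflation
  of order \<open>n\<close>. The remainder term stays even for compact \<open>T\<close>, but it
  becomes small with the singular values.\<close>

lemma singular_value_upper_family:
  fixes T :: "'h \<Rightarrow> 'h::complex_hilbert_space"
  assumes T: "bounded_clinear T" and \<eta>: "0 < \<eta>"
  shows "\<exists>g. bessel_family {..<n} g \<and>
    (\<forall>y. (norm (T y))\<^sup>2 \<le> (\<Sum>k<n. (singular_value T k)\<^sup>2 * (cmod (cinner y (g k)))\<^sup>2)
      + ((singular_value T n)\<^sup>2 + \<eta>) * (norm y)\<^sup>2)"
proof -
  define t where "t = onorm T"
  have t0: "0 \<le> t" unfolding t_def by (rule onorm_clinear_nonneg[OF T])
  \<comment> \<open>\<open>X e\<close> bounds the growth of a squared singular value when the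
    deflated norm exceeds it by at most \<open>Suc n * (e * t)\<close>. In \<open>f e\<close> one
    \<open>X e\<close> comes from the Bessel sum and one from the remainder; the last summand
    collects the adjoint errors of the \<open>n\<close> coefficients.\<close>
  define X where "X e = 2 * t * (Suc n * (e * t)) + (Suc n * (e * t))\<^sup>2" for e :: real
  define f where "f e = 2 * X e + n * (t\<^sup>2 * (2 * e + e\<^sup>2))" for e :: real
  have "(f \<longlongrightarrow> 0) (at_right 0)"
    unfolding f_def X_def by (auto intro!: tendsto_eq_intros)
  then have "\<forall>\<^sub>F e in at_right 0. f e < \<eta>" using \<eta> by (rule order_tendstoD)
  moreover have "\<forall>\<^sub>F e::real in at_right 0. 0 < e \<and> e < 1"
    unfolding eventually_at_right_field by (intro exI[of _ 1]) auto
  ultimately have "\<forall>\<^sub>F e in at_right 0. f e < \<eta> \<and> 0 < e \<and> e < 1" by eventually_elim auto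
  then obtain e where e: "f e < \<eta>" "0 < e" "e < 1"
    using eventually_happens[of _ "at_right (0::real)"] by auto
  \<comment> \<open>Chosen so that the adjoint error factor \<open>sqrt (2 * \<epsilon>)\<close> is
    exactly \<open>e\<close>.\<close>
  define \<epsilon> where "\<epsilon> = e\<^sup>2 / 2"
  have "e\<^sup>2 < 1" using e by (simp add: power_less_one_iff)
  then have \<epsilon>: "0 < \<epsilon>" "\<epsilon> < 1" "sqrt (2 * \<epsilon>) = e" using e by (auto simp: \<epsilon>_def)
  obtain g h where gh: "greedy_system T \<epsilon> (Suc n) g h"
    using greedy_system_exists[OF T \<epsilon>(1,2)] by blast
  have og: "orthonormal0 {..<n} g" and oh: "orthonormal0 {..<n} h"
    using gh by (auto simp: greedy_system_def orthonormal0_def)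
  define s where "s k = singular_value T k" for k
  define \<tau> where "\<tau> k = onorm (deflate T h k)" for k
  have \<tau>0: "0 \<le> \<tau> k" for k
    unfolding \<tau>_def by (rule onorm_clinear_nonneg[OF bounded_clinear_deflate[OF T]])
  have \<tau>t: "\<tau> k \<le> t" if "k \<le> n" for k
    using onorm_deflate_antimono[OF T oh, of 0 k] that by (simp add: \<tau>_def t_def)
  have \<tau>s: "(\<tau> k)\<^sup>2 \<le> (s k)\<^sup>2 + X e" if "k \<le> n" for k
  proof -
    have s: "0 \<le> s k" "s k \<le> t"
      unfolding s_def t_def by (rule singular_value_nonneg[OF T], rule singular_value_le_onorm[OF T])
    have "\<tau> k \<le> s k + Suc k * (e * t)"
      using onorm_deflate_le[OF T gh _ \<epsilon>(1,2), of k] that by (simp add: \<tau>_def s_def \<epsilon>(3) t_def)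
    also have "\<dots> \<le> s k + Suc n * (e * t)"
      using that e(2) t0 by (intro add_left_mono mult_right_mono) auto
    finally have "(\<tau> k)\<^sup>2 \<le> (s k + Suc n * (e * t))\<^sup>2" using \<tau>0 by (intro power_mono)
    also have "\<dots> = (s k)\<^sup>2 + 2 * s k * (Suc n * (e * t)) + (Suc n * (e * t))\<^sup>2"
      by (simp only: power2_sum)
    also have "2 * s k * (Suc n * (e * t)) \<le> 2 * t * (Suc n * (e * t))"
      using s t0 e(2) by (intro mult_right_mono) auto
    finally show ?thesis by (simp add: X_def)
  qed
  have X0: "0 \<le> X e" using t0 e by (simp add: X_def)
  have "(norm (T y))\<^sup>2 \<le> (\<Sum>k<n. (s k)\<^sup>2 * (cmod (cinner y (g k)))\<^sup>2) + ((s n)\<^sup>2 + \<eta>) * (norm y)\<^sup>2" for y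
  proof -
    have summand: "(cmod (cinner (T y) (h k)))\<^sup>2
        \<le> (s k)\<^sup>2 * (cmod (cinner y (g k)))\<^sup>2 + X e * (cmod (cinner y (g k)))\<^sup>2
          + t\<^sup>2 * (2 * e + e\<^sup>2) * (norm y)\<^sup>2" if k: "k < n" for k
    proof -
      define a where "a = cmod (cinner y (g k))"
      have gk: "norm (g k) \<le> 1" using og k by (auto intro: orthonormal0_norm_le)
      have a: "0 \<le> a" "a \<le> norm y"
        unfolding a_def using cmod_cinner_le[of y "g k"] mult_left_le[OF gk, of "norm y"] by auto
      have "cinner (T y) (h k)
          = cinner y (\<tau> k *\<^sub>R g k) + cinner y (cadjoint T (h k) - \<tau> k *\<^sub>R g k)"
        by (simp add: cinner_cadjoint[OF T] cinner_diff_right)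
      then have "cmod (cinner (T y) (h k))
          \<le> cmod (cinner y (\<tau> k *\<^sub>R g k)) + cmod (cinner y (cadjoint T (h k) - \<tau> k *\<^sub>R g k))"
        by (simp add: norm_triangle_ineq)
      also have "\<dots> \<le> \<tau> k * a + norm y * (e * \<tau> k)"
      proof (rule add_mono)
        show "cmod (cinner y (\<tau> k *\<^sub>R g k)) \<le> \<tau> k * a"
          using \<tau>0[of k] by (simp add: cinner_simps a_def)
        show "cmod (cinner y (cadjoint T (h k) - \<tau> k *\<^sub>R g k)) \<le> norm y * (e * \<tau> k)"
          using greedy_system_adjoint[OF T gh _ \<epsilon>(1), of k] k
          by (intro order_trans[OF cmod_cinner_le] mult_left_mono) (simp_all add: \<epsilon>(3) \<tau>_def)
      qed
      finally have "(cmod (cinner (T y) (h k)))\<^sup>2 \<le> (\<tau> k * a + norm y * (e * \<tau> k))\<^sup>2"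
        by (intro power_mono) auto
      also have "\<dots> = (\<tau> k)\<^sup>2 * (a\<^sup>2 + (2 * e * (a * norm y) + e\<^sup>2 * (norm y)\<^sup>2))"
        by (simp add: power2_eq_square algebra_simps)
      also have "\<dots> \<le> (\<tau> k)\<^sup>2 * (a\<^sup>2 + (2 * e * (norm y)\<^sup>2 + e\<^sup>2 * (norm y)\<^sup>2))"
        using a e(2) unfolding power2_eq_square[of "norm y"]
        by (intro mult_left_mono add_left_mono add_right_mono mult_right_mono) auto
      also have "\<dots> = (\<tau> k)\<^sup>2 * a\<^sup>2 + (\<tau> k)\<^sup>2 * ((2 * e + e\<^sup>2) * (norm y)\<^sup>2)"
        by (simp add: algebra_simps)
      also have "\<dots> \<le> ((s k)\<^sup>2 + X e) * a\<^sup>2 + t\<^sup>2 * ((2 * e + e\<^sup>2) * (norm y)\<^sup>2)"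
        using k e \<tau>t[of k] \<tau>s[of k] \<tau>0[of k]
        by (intro add_mono mult_right_mono power_mono) auto
      finally show ?thesis by (simp add: a_def algebra_simps)
    qed
    have B: "(\<Sum>k<n. (cmod (cinner y (g k)))\<^sup>2) \<le> (norm y)\<^sup>2"
      using orthonormal0_bessel[OF _ og] by (simp add: bessel_family_def)
    have "(norm (deflate T h n y))\<^sup>2 \<le> (\<tau> n * norm y)\<^sup>2"
      unfolding \<tau>_def by (intro power_mono onorm_clinear bounded_clinear_deflate T) auto
    also have "\<dots> \<le> ((s n)\<^sup>2 + X e) * (norm y)\<^sup>2"
      using \<tau>s[of n] by (simp add: power_mult_distrib mult_right_mono)
    finally have last: "(norm (deflate T h n y))\<^sup>2 \<le> ((s n)\<^sup>2 + X e) * (norm y)\<^sup>2" .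
    have "(norm (T y))\<^sup>2 = (\<Sum>k<n. (cmod (cinner (T y) (h k)))\<^sup>2) + (norm (deflate T h n y))\<^sup>2"
      using orthonormal0_pythagoras[OF _ oh, of "T y"] by (simp add: deflate_def)
    also have "\<dots> \<le> (\<Sum>k<n. (s k)\<^sup>2 * (cmod (cinner y (g k)))\<^sup>2 + X e * (cmod (cinner y (g k)))\<^sup>2
          + t\<^sup>2 * (2 * e + e\<^sup>2) * (norm y)\<^sup>2) + ((s n)\<^sup>2 + X e) * (norm y)\<^sup>2"
      using summand last by (intro add_mono sum_mono) auto
    also have "\<dots> = (\<Sum>k<n. (s k)\<^sup>2 * (cmod (cinner y (g k)))\<^sup>2)
        + X e * (\<Sum>k<n. (cmod (cinner y (g k)))\<^sup>2)
        + n * (t\<^sup>2 * (2 * e + e\<^sup>2)) * (norm y)\<^sup>2 + ((s n)\<^sup>2 + X e) * (norm y)\<^sup>2"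
      by (simp add: sum.distrib sum_distrib_left)
    also have "\<dots> \<le> (\<Sum>k<n. (s k)\<^sup>2 * (cmod (cinner y (g k)))\<^sup>2) + X e * (norm y)\<^sup>2
        + n * (t\<^sup>2 * (2 * e + e\<^sup>2)) * (norm y)\<^sup>2 + ((s n)\<^sup>2 + X e) * (norm y)\<^sup>2"
      using mult_left_mono[OF B X0] by simp
    also have "\<dots> = (\<Sum>k<n. (s k)\<^sup>2 * (cmod (cinner y (g k)))\<^sup>2) + ((s n)\<^sup>2 + f e) * (norm y)\<^sup>2"
      by (simp add: f_def algebra_simps)
    also have "\<dots> \<le> (\<Sum>k<n. (s k)\<^sup>2 * (cmod (cinner y (g k)))\<^sup>2) + ((s n)\<^sup>2 + \<eta>) * (norm y)\<^sup>2"
      using e(1) by (intro add_left_mono mult_right_mono) auto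
    finally show ?thesis .
  qed
  then show ?thesis using orthonormal0_bessel[OF _ og] by (auto simp: s_def)
qed

section \<open>Schatten norm estimates\<close>

text \<open>Jensen's inequality after dividing the weights by their total \<open>W\<close>; the
  factor \<open>W powr s\<close> that comes back is at most \<open>W\<close> because
  \<open>W\<close> is at most 1.\<close>

lemma powr_sum_le_sum_powr:
  fixes w x :: "'i \<Rightarrow> real"
  assumes "finite I" and w: "\<And>i. i \<in> I \<Longrightarrow> 0 \<le> w i" "sum w I \<le> 1"
    and x: "\<And>i. i \<in> I \<Longrightarrow> 0 \<le> x i" and s: "1 \<le> s"
  shows "(\<Sum>i\<in>I. w i * x i) powr s \<le> (\<Sum>i\<in>I. w i * x i powr s)"
proof -
  \<comment> \<open>Indices with \<open>x i = 0\<close> contribute to neither side and are removed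
    before convexity is applied.\<close>
  define I' where "I' = {i\<in>I. 0 < x i}"
  have I': "finite I'" "I' \<subseteq> I" using assms(1) by (auto simp: I'_def)
  have eq: "(\<Sum>i\<in>I. w i * x i) = (\<Sum>i\<in>I'. w i * x i)"
    "(\<Sum>i\<in>I. w i * x i powr s) = (\<Sum>i\<in>I'. w i * x i powr s)"
    using assms(1) x by (auto simp: I'_def less_le intro!: sum.mono_neutral_right)
  define W where "W = sum w I'"
  have W: "0 \<le> W" "W \<le> 1"
    using w I' sum_mono2[OF assms(1) I'(2), of w] by (auto simp: W_def intro!: sum_nonneg)
  have nn: "0 \<le> (\<Sum>i\<in>I'. w i * x i powr s)" using w I' by (auto intro!: sum_nonneg)
  show ?thesis
  proof (cases "W = 0")
    case True
    then have "\<forall>i\<in>I'. w i = 0"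
      using w(1) I' by (subst (asm) W_def, subst (asm) sum_nonneg_eq_0_iff) auto
    then show ?thesis unfolding eq by simp
  next
    case False
    then have W0: "W > 0" using W by simp
    then have "I' \<noteq> {}" by (auto simp: W_def)
    then have "(\<Sum>i\<in>I'. (w i / W) *\<^sub>R x i) powr s \<le> (\<Sum>i\<in>I'. (w i / W) * x i powr s)"
      using I' w(1) W0
      by (intro convex_on_sum[OF _ _ powr_convex[OF s]])
        (auto simp: I'_def sum_divide_distrib[symmetric], auto simp: W_def I'_def)
    then have jensen: "((\<Sum>i\<in>I'. w i * x i) / W) powr s \<le> (\<Sum>i\<in>I'. w i * x i powr s) / W"
      by (simp add: sum_divide_distrib)
    have "(\<Sum>i\<in>I'. w i * x i) = W * ((\<Sum>i\<in>I'. w i * x i) / W)" using W0 by simp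
    then have "(\<Sum>i\<in>I'. w i * x i) powr s = (W * ((\<Sum>i\<in>I'. w i * x i) / W)) powr s" by simp
    also have "\<dots> = W powr s * ((\<Sum>i\<in>I'. w i * x i) / W) powr s"
      using W0 w x I' by (subst powr_mult) (auto intro!: divide_nonneg_nonneg sum_nonneg)
    also have "\<dots> \<le> W powr s * ((\<Sum>i\<in>I'. w i * x i powr s) / W)"
      by (intro mult_left_mono jensen) simp
    also have "\<dots> \<le> W powr 1 * ((\<Sum>i\<in>I'. w i * x i powr s) / W)"
      using W W0 s nn by (intro mult_right_mono powr_mono') auto
    also have "\<dots> = (\<Sum>i\<in>I'. w i * x i powr s)" using W0 by simp
    finally show ?thesis unfolding eq .
  qed
qed

text \<open>The row sums allow Jensen's inequality in every row with weights
  \<open>d n k / c\<close>; after interchanging the sums, the column sums bound what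
  remains.\<close>

lemma doubly_substochastic_powr:
  fixes d :: "nat \<Rightarrow> nat \<Rightarrow> real"
  assumes d: "\<And>n k. 0 \<le> d n k" and row: "\<And>n. n < N \<Longrightarrow> (\<Sum>k<K. d n k) \<le> c"
    and col: "\<And>k. k < K \<Longrightarrow> (\<Sum>n<N. d n k) \<le> c"
    and v: "\<And>k. 0 \<le> v k" and s: "1 \<le> s" and c: "0 \<le> c"
  shows "(\<Sum>n<N. (\<Sum>k<K. v k * d n k) powr s) \<le> c powr s * (\<Sum>k<K. v k powr s)"
proof (cases "c = 0")
  case True
  have "d n k = 0" if "n < N" "k < K" for n k
  proof -
    have "d n k \<le> (\<Sum>k<K. d n k)" using that d by (intro member_le_sum) auto
    then show ?thesis using row[OF that(1)] d[of n k] True by linarith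
  qed
  then have "(\<Sum>n<N. (\<Sum>k<K. v k * d n k) powr s) = 0" by (intro sum.neutral) (simp add: sum.neutral)
  then show ?thesis by (simp add: True)
next
  case False
  then have c0: "c > 0" using c by simp
  have "(\<Sum>n<N. (\<Sum>k<K. v k * d n k) powr s) \<le> (\<Sum>n<N. c powr s * (\<Sum>k<K. d n k / c * v k powr s))"
  proof (rule sum_mono)
    fix n assume n: "n \<in> {..<N}"
    have "(\<Sum>k<K. v k * d n k) = c * (\<Sum>k<K. d n k / c * v k)"
      using c0 by (simp add: sum_distrib_left mult.commute)
    then have "(\<Sum>k<K. v k * d n k) powr s = c powr s * (\<Sum>k<K. d n k / c * v k) powr s"
      using c0 d v by (simp add: powr_mult sum_nonneg)
    also have "\<dots> \<le> c powr s * (\<Sum>k<K. d n k / c * v k powr s)"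
      using c0 d v s row n
      by (intro mult_left_mono powr_sum_le_sum_powr) (auto simp: sum_divide_distrib[symmetric])
    finally show "(\<Sum>k<K. v k * d n k) powr s \<le> c powr s * (\<Sum>k<K. d n k / c * v k powr s)" .
  qed
  also have "\<dots> = c powr s * (\<Sum>k<K. (\<Sum>n<N. d n k) / c * v k powr s)"
    unfolding sum_distrib_left[symmetric]
    by (subst sum.swap) (simp add: sum_divide_distrib sum_distrib_right)
  also have "\<dots> \<le> c powr s * (\<Sum>k<K. 1 * v k powr s)"
    using c0 col by (intro mult_left_mono sum_mono mult_right_mono) auto
  finally show ?thesis by simp
qed

section \<open>Columns of operators and their Schatten sums\<close>

definition column_bound :: "(nat \<Rightarrow> 'h \<Rightarrow> 'h::complex_hilbert_space) \<Rightarrow> real \<Rightarrow> bool" where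
  "column_bound A C \<longleftrightarrow> 0 \<le> C \<and> (\<forall>J x. (\<Sum>j<J. (norm (A j x))\<^sup>2) \<le> C\<^sup>2 * (norm x)\<^sup>2)"

text \<open>\<open>D j\<close> is the adjoint of \<open>A j\<close>. The first condition bounds the
  column formed by the \<open>A j\<close>, the second is equivalent to a bound for the row formed by
  them. Coefficients in \<open>L\<^sup>\<infinity>(\<ell>\<^sup>2)\<close> satisfy both, since
  conjugation preserves the pointwise norm.\<close>

definition column_pair ::
    "(nat \<Rightarrow> 'h \<Rightarrow> 'h::complex_hilbert_space) \<Rightarrow> (nat \<Rightarrow> 'h \<Rightarrow> 'h) \<Rightarrow> real \<Rightarrow> bool" where
  "column_pair A D C \<longleftrightarrow> column_bound A C \<and> column_bound D C \<and>
     (\<forall>j x y. cinner (A j x) y = cinner x (D j y))"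

text \<open>The quantities called \<mu> and \<nu> in the overview, the latter with
  \<open>cadjoint (T 1)\<close> and the adjoint family.\<close>

definition column_norm ::
    "('h \<Rightarrow> 'h) \<Rightarrow> (nat \<Rightarrow> 'h \<Rightarrow> 'h::complex_hilbert_space) \<Rightarrow> 'h \<Rightarrow> real" where
  "column_norm T A g = sqrt (\<Sum>j. (norm (T (A j g)))\<^sup>2)"

lemma column_norm_partial:
  assumes T: "bounded_clinear T" and A: "column_bound A C"
  shows "(\<Sum>j<J. (norm (T (A j g)))\<^sup>2) \<le> (onorm T * C * norm g)\<^sup>2"
proof -
  have "(\<Sum>j<J. (norm (T (A j g)))\<^sup>2) \<le> (\<Sum>j<J. (onorm T)\<^sup>2 * (norm (A j g))\<^sup>2)"
    unfolding power_mult_distrib[symmetric] by (intro sum_mono power_mono onorm_clinear T) auto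
  also have "\<dots> \<le> (onorm T)\<^sup>2 * (C\<^sup>2 * (norm g)\<^sup>2)"
    unfolding sum_distrib_left[symmetric] using A
    by (intro mult_left_mono) (auto simp: column_bound_def)
  finally show ?thesis by (simp add: power_mult_distrib mult.assoc)
qed

lemma column_norm_summable:
  assumes T: "bounded_clinear T" and A: "column_bound A C"
  shows "summable (\<lambda>j. (norm (T (A j g)))\<^sup>2)"
  by (rule summableI_nonneg_bounded[OF _ column_norm_partial[OF assms]]) simp

lemma column_norm_nonneg:
  "bounded_clinear T \<Longrightarrow> column_bound A C \<Longrightarrow> 0 \<le> column_norm T A g"
  by (simp add: column_norm_def suminf_nonneg column_norm_summable)

lemma column_norm_le:
  assumes T: "bounded_clinear T" and A: "column_bound A C"
  shows "column_norm T A g \<le> onorm T * C * norm g"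
  unfolding column_norm_def
proof (rule real_le_lsqrt)
  show "(\<Sum>j. (norm (T (A j g)))\<^sup>2) \<le> (onorm T * C * norm g)\<^sup>2"
    by (rule suminf_le_const[OF column_norm_summable[OF assms] column_norm_partial[OF assms]])
qed (use onorm_clinear_nonneg[OF T] A in \<open>simp_all add: column_bound_def\<close>)

lemma powr_square_half: "0 \<le> (x::real) \<Longrightarrow> (x\<^sup>2) powr (p / 2) = x powr p"
  by (cases "x = 0") (simp_all add: powr_numeral[symmetric] powr_powr del: powr_numeral)

text \<open>The matrix \<open>(d n k)\<close> of squared coefficients is doubly substochastic up to the factor
  \<open>C\<^sup>2\<close>: its rows are controlled by \<open>A\<close> and its columns by the adjoint family \<open>D\<close>. This is where
  \<open>2 \<le> p\<close> is needed.\<close>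

lemma schatten_column_sum_partial:
  assumes T: "bounded_clinear T" and p: "2 \<le> p" and sm: "summable (\<lambda>k. singular_value T k powr p)"
    and AD: "column_pair A D C" and g: "bessel_family {..<N::nat} g"
  shows "(\<Sum>n<N. (\<Sum>j<J. (norm (T (A j (g n))))\<^sup>2) powr (p / 2))
    \<le> C powr p * (\<Sum>k. singular_value T k powr p)"
proof -
  define s where "s k = singular_value T k" for k
  have s0: "0 \<le> s k" for k unfolding s_def by (rule singular_value_nonneg[OF T])
  have C: "0 \<le> C" and A: "\<And>x. (\<Sum>j<J. (norm (A j x))\<^sup>2) \<le> C\<^sup>2 * (norm x)\<^sup>2"
    and D: "\<And>x. (\<Sum>j<J. (norm (D j x))\<^sup>2) \<le> C\<^sup>2 * (norm x)\<^sup>2"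
    and adj: "\<And>j x y. cinner (A j x) y = cinner x (D j y)"
    using AD by (auto simp: column_pair_def column_bound_def)
  define B where "B = C powr p * (\<Sum>k. s k powr p)"
  define \<mu> where "\<mu> n = (\<Sum>j<J. (norm (T (A j (g n))))\<^sup>2)" for n
  \<comment> \<open>The remainder of the upper family of length \<open>K\<close> with tolerance
    \<open>1 / Suc K\<close>, summed over the column; it tends to 0 as \<open>K\<close>
    grows.\<close>
  define E where "E K = ((s K)\<^sup>2 + 1 / Suc K) * C\<^sup>2" for K
  have E0: "0 \<le> E K" for K by (simp add: E_def)
  have ng: "norm (g n) \<le> 1" if "n < N" for n by (rule bessel_family_norm_le[OF g]) (simp_all add: that)
  \<comment> \<open>The positive part keeps the base of \<open>powr\<close> nonnegative when the
    remainder exceeds the sum.\<close>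
  have step: "(\<Sum>n<N. (max 0 (\<mu> n - E K)) powr (p / 2)) \<le> B" for K
  proof -
    obtain e where e: "bessel_family {..<K} e" and T_le: "\<And>y. (norm (T y))\<^sup>2
        \<le> (\<Sum>k<K. (s k)\<^sup>2 * (cmod (cinner y (e k)))\<^sup>2) + ((s K)\<^sup>2 + 1 / Suc K) * (norm y)\<^sup>2"
      using singular_value_upper_family[OF T, of "1 / Suc K" K] unfolding s_def by auto
    define d where "d n k = (\<Sum>j<J. (cmod (cinner (A j (g n)) (e k)))\<^sup>2)" for n k
    have AC: "(\<Sum>j<J. (norm (A j (g n)))\<^sup>2) \<le> C\<^sup>2" if "n < N" for n
    proof -
      have "C\<^sup>2 * (norm (g n))\<^sup>2 \<le> C\<^sup>2 * 1"
        using ng[OF that] by (intro mult_left_mono) (auto simp: power_le_one)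
      then show ?thesis using A[of "g n"] by linarith
    qed
    have row: "(\<Sum>k<K. d n k) \<le> C\<^sup>2" if "n < N" for n
    proof -
      have "(\<Sum>k<K. d n k) = (\<Sum>j<J. \<Sum>k<K. (cmod (cinner (A j (g n)) (e k)))\<^sup>2)"
        unfolding d_def by (rule sum.swap)
      also have "\<dots> \<le> (\<Sum>j<J. (norm (A j (g n)))\<^sup>2)"
        using e by (intro sum_mono) (auto simp: bessel_family_def)
      finally show ?thesis using AC[OF that] by linarith
    qed
    have col: "(\<Sum>n<N. d n k) \<le> C\<^sup>2" if "k < K" for k
    proof -
      have "(\<Sum>n<N. d n k) = (\<Sum>j<J. \<Sum>n<N. (cmod (cinner (A j (g n)) (e k)))\<^sup>2)"
        unfolding d_def by (rule sum.swap)
      \<comment> \<open>The operators are moved to the other side, so that Bessel's inequality can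
        be used for the family \<open>g\<close> and the bound for the adjoint column.\<close>
      also have "\<dots> = (\<Sum>j<J. \<Sum>n<N. (cmod (cinner (D j (e k)) (g n)))\<^sup>2)"
      proof (intro sum.cong refl)
        fix j n
        have "cmod (cinner (A j (g n)) (e k)) = cmod (cnj (cinner (D j (e k)) (g n)))"
          by (simp add: adj cinner_commute[symmetric])
        then show "(cmod (cinner (A j (g n)) (e k)))\<^sup>2 = (cmod (cinner (D j (e k)) (g n)))\<^sup>2"
          by simp
      qed
      also have "\<dots> \<le> (\<Sum>j<J. (norm (D j (e k)))\<^sup>2)"
        using g by (intro sum_mono) (auto simp: bessel_family_def)
      also have "\<dots> \<le> C\<^sup>2 * (norm (e k))\<^sup>2" by (rule D)
      also have "\<dots> \<le> C\<^sup>2 * 1"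
        using bessel_family_norm_le[OF e, of k] that by (intro mult_left_mono) (auto simp: power_le_one)
      finally show ?thesis by simp
    qed
    have "max 0 (\<mu> n - E K) powr (p / 2) \<le> (\<Sum>k<K. (s k)\<^sup>2 * d n k) powr (p / 2)" if "n < N" for n
    proof -
      have "\<mu> n \<le> (\<Sum>j<J. (\<Sum>k<K. (s k)\<^sup>2 * (cmod (cinner (A j (g n)) (e k)))\<^sup>2)
          + ((s K)\<^sup>2 + 1 / Suc K) * (norm (A j (g n)))\<^sup>2)"
        unfolding \<mu>_def by (intro sum_mono T_le)
      also have "\<dots> = (\<Sum>k<K. (s k)\<^sup>2 * d n k)
          + ((s K)\<^sup>2 + 1 / Suc K) * (\<Sum>j<J. (norm (A j (g n)))\<^sup>2)"
        by (simp only: sum.distrib sum.swap[of _ "{..<K}"] sum_distrib_left d_def)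
      also have "\<dots> \<le> (\<Sum>k<K. (s k)\<^sup>2 * d n k) + E K"
        unfolding E_def using AC[OF that] by (intro add_left_mono mult_left_mono) auto
      finally have "\<mu> n - E K \<le> (\<Sum>k<K. (s k)\<^sup>2 * d n k)" by simp
      moreover have "0 \<le> (\<Sum>k<K. (s k)\<^sup>2 * d n k)" by (simp add: d_def sum_nonneg)
      ultimately show ?thesis using p by (intro powr_mono2) auto
    qed
    then have "(\<Sum>n<N. (max 0 (\<mu> n - E K)) powr (p / 2)) \<le> (\<Sum>n<N. (\<Sum>k<K. (s k)\<^sup>2 * d n k) powr (p / 2))"
      by (intro sum_mono) simp
    also have "\<dots> \<le> (C\<^sup>2) powr (p / 2) * (\<Sum>k<K. ((s k)\<^sup>2) powr (p / 2))"
      using row col p by (intro doubly_substochastic_powr) (auto simp: d_def sum_nonneg)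
    also have "\<dots> = C powr p * (\<Sum>k<K. s k powr p)" using C s0 by (simp add: powr_square_half)
    also have "\<dots> \<le> B" unfolding B_def
      using sm by (intro mult_left_mono sum_le_suminf) (auto simp: s_def)
    finally show ?thesis .
  qed
  \<comment> \<open>Summability of the powers forces the singular values to 0, and with them the
    remainder; this replaces compactness.\<close>
  have "s \<longlonglongrightarrow> 0"
  proof -
    have "(\<lambda>k. (s k powr p) powr (1 / p)) \<longlonglongrightarrow> 0 powr (1 / p)"
      using summable_LIMSEQ_zero[OF sm] p by (intro tendsto_powr') (auto simp: s_def)
    then show ?thesis using p s0 by (simp add: powr_powr)
  qed
  then have "E \<longlonglongrightarrow> (0\<^sup>2 + 0) * C\<^sup>2"
    unfolding E_def by (intro tendsto_intros LIMSEQ_Suc[OF lim_1_over_n])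
  then have "(\<lambda>K. max 0 (\<mu> n - E K)) \<longlonglongrightarrow> max 0 (\<mu> n - 0)" for n
    by (intro tendsto_intros) simp
  moreover have "0 \<le> \<mu> n" for n by (simp add: \<mu>_def sum_nonneg)
  ultimately have "(\<lambda>K. max 0 (\<mu> n - E K)) \<longlonglongrightarrow> \<mu> n" for n
    by (metis diff_zero max.absorb2)
  then have "(\<lambda>K. \<Sum>n<N. (max 0 (\<mu> n - E K)) powr (p / 2)) \<longlonglongrightarrow> (\<Sum>n<N. \<mu> n powr (p / 2))"
    using p by (intro tendsto_sum tendsto_powr') auto
  then show ?thesis
    unfolding \<mu>_def[symmetric] s_def[symmetric] B_def[symmetric]
    by (rule LIMSEQ_le_const2) (use step in auto)
qed

lemma schatten_column_sum:
  assumes T: "bounded_clinear T" and p: "2 \<le> p" and sm: "summable (\<lambda>k. singular_value T k powr p)"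
    and AD: "column_pair A D C" and g: "bessel_family {..<N::nat} g"
  shows "(\<Sum>n<N. column_norm T A (g n) powr p)
    \<le> (C * (\<Sum>k. singular_value T k powr p) powr (1 / p)) powr p"
proof -
  have A: "column_bound A C" and C: "0 \<le> C" using AD by (auto simp: column_pair_def column_bound_def)
  have eq: "column_norm T A (g n) powr p = (\<Sum>j. (norm (T (A j (g n))))\<^sup>2) powr (p / 2)" for n
    using suminf_nonneg[OF column_norm_summable[OF T A]]
    by (simp add: column_norm_def powr_half_sqrt[symmetric] powr_powr)
  have "(\<lambda>J. \<Sum>n<N. (\<Sum>j<J. (norm (T (A j (g n))))\<^sup>2) powr (p / 2))
      \<longlonglongrightarrow> (\<Sum>n<N. (\<Sum>j. (norm (T (A j (g n))))\<^sup>2) powr (p / 2))"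
    using p by (intro tendsto_sum tendsto_powr' summable_LIMSEQ column_norm_summable[OF T A])
      (auto simp: sum_nonneg)
  then have "(\<Sum>n<N. (\<Sum>j. (norm (T (A j (g n))))\<^sup>2) powr (p / 2))
      \<le> C powr p * (\<Sum>k. singular_value T k powr p)"
    by (rule LIMSEQ_le_const2) (use schatten_column_sum_partial[OF assms] in auto)
  also have "\<dots> = (C * (\<Sum>k. singular_value T k powr p) powr (1 / p)) powr p"
    using p C suminf_nonneg[OF sm] by (simp add: powr_mult powr_powr)
  finally show ?thesis unfolding eq .
qed

text \<open>The lower families for \<open>S\<close> reach its singular values up to a factor that
  can be brought arbitrarily close to 1, so diagonal sums over pairs of Bessel families control the
  Schatten sum.\<close>

lemma schatten_from_families:
  fixes S :: "'h \<Rightarrow> 'h::complex_hilbert_space"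
  assumes S: "bounded_clinear S" and r: "0 < r" and B: "0 \<le> B"
    and le: "\<And>N g h. bessel_family {..<N} g \<Longrightarrow> bessel_family {..<N} h \<Longrightarrow>
      (\<Sum>n<N::nat. cmod (cinner (S (g n)) (h n)) powr r) \<le> B powr r"
  shows "summable (\<lambda>n. singular_value S n powr r)"
    and "(\<Sum>n. singular_value S n powr r) powr (1 / r) \<le> B"
proof -
  note s0 = singular_value_nonneg[OF S]
  have partial: "(\<Sum>n<N. singular_value S n powr r) \<le> B powr r" for N
  proof (rule field_le_mult_one_interval)
    fix z :: real assume z: "0 < z" "z < 1"
    \<comment> \<open>The solution of \<open>(1 - \<epsilon>) powr r = z\<close>, so that the loss
      in the singular values becomes the factor \<open>z\<close> in the sum.\<close>
    define \<epsilon> where "\<epsilon> = 1 - z powr (1 / r)"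
    have "z powr (1 / r) < 1 powr (1 / r)" using z r by (intro powr_less_mono2) auto
    then have \<epsilon>: "0 < \<epsilon>" "\<epsilon> < 1" using z by (auto simp: \<epsilon>_def)
    obtain g h where gh: "bessel_family {..<N} g" "bessel_family {..<N} h"
      "\<And>k. k < N \<Longrightarrow> (1 - \<epsilon>) * singular_value S k \<le> cmod (cinner (S (g k)) (h k))"
      using singular_value_lower_families[OF S \<epsilon>, of N] by blast
    have "z * (\<Sum>n<N. singular_value S n powr r) = (\<Sum>n<N. ((1 - \<epsilon>) * singular_value S n) powr r)"
      using z r s0 by (simp add: \<epsilon>_def powr_mult powr_powr sum_distrib_left)
    also have "\<dots> \<le> (\<Sum>n<N. cmod (cinner (S (g n)) (h n)) powr r)"
      using \<epsilon> s0 r gh(3) by (intro sum_mono powr_mono2) auto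
    also have "\<dots> \<le> B powr r" by (rule le[OF gh(1,2)])
    finally show "z * (\<Sum>n<N. singular_value S n powr r) \<le> B powr r" .
  qed
  show sm: "summable (\<lambda>n. singular_value S n powr r)"
    by (rule summableI_nonneg_bounded[OF _ partial]) simp
  have "(\<Sum>n. singular_value S n powr r) \<le> B powr r" by (rule suminf_le_const[OF sm partial])
  then have "(\<Sum>n. singular_value S n powr r) powr (1 / r) \<le> (B powr r) powr (1 / r)"
    using r suminf_nonneg[OF sm] by (intro powr_mono2) auto
  then show "(\<Sum>n. singular_value S n powr r) powr (1 / r) \<le> B" using r B by (simp add: powr_powr)
qed

text \<open>Since \<open>r / p + r / q = 1\<close>, Young's inequality applies to the powers
  normalised by \<open>X\<close> and \<open>Y\<close>; summation then gives Hoelder's inequality for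
  the exponent \<open>r\<close>.\<close>

lemma holder_powr_sum:
  fixes x y :: "nat \<Rightarrow> real"
  assumes p: "0 < p" and q: "0 < q" and r: "1 / r = 1 / p + 1 / q"
    and x: "\<And>n. 0 \<le> x n" and y: "\<And>n. 0 \<le> y n" and X: "0 \<le> X" and Y: "0 \<le> Y"
    and sx: "(\<Sum>n<N. x n powr p) \<le> X powr p" and sy: "(\<Sum>n<N. y n powr q) \<le> Y powr q"
  shows "(\<Sum>n<N. (x n * y n) powr r) \<le> (X * Y) powr r"
proof (cases "X = 0 \<or> Y = 0")
  case True
  \<comment> \<open>No normalisation is possible here, but a zero bound makes all terms of that
    family vanish.\<close>
  have "x n * y n = 0" if "n < N" for n
  proof -
    have "x n powr p \<le> X powr p"
      using sx that by (intro order_trans[OF member_le_sum[of n "{..<N}" "\<lambda>n. x n powr p"]]) auto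
    moreover have "y n powr q \<le> Y powr q"
      using sy that by (intro order_trans[OF member_le_sum[of n "{..<N}" "\<lambda>n. y n powr q"]]) auto
    ultimately show ?thesis using True powr_ge_zero[of "x n" p] powr_ge_zero[of "y n" q]
      by (auto simp: less_eq_real_def not_less)
  qed
  then have "(\<Sum>n<N. (x n * y n) powr r) = 0" by (intro sum.neutral) simp
  then show ?thesis by simp
next
  case False
  then have X0: "X > 0" and Y0: "Y > 0" using X Y by auto
  have "0 < 1 / r" using p q by (simp add: r add_pos_pos)
  then have r0: "r > 0" by simp
  have sum1: "r / p + r / q = 1" using r r0 by (simp add: field_simps)
  have young: "(x n * y n) powr r \<le> (X * Y) powr r * (r / p * (x n powr p / X powr p) + r / q * (y n powr q / Y powr q))" for n
  proof (cases "x n = 0 \<or> y n = 0")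
    case True
    then show ?thesis using p q r0 by (auto intro!: mult_nonneg_nonneg add_nonneg_nonneg)
  next
    case False
    then have xy: "x n > 0" "y n > 0" using x[of n] y[of n] by auto
    have "((x n powr p / X powr p) powr (r / p)) * ((y n powr q / Y powr q) powr (r / q))
        \<le> r / p * (x n powr p / X powr p) + r / q * (y n powr q / Y powr q)"
      using sum1 xy X0 Y0 p q r0 by (intro Youngs_inequality_0) auto
    also have "((x n powr p / X powr p) powr (r / p)) * ((y n powr q / Y powr q) powr (r / q))
        = (x n * y n) powr r / (X * Y) powr r"
      using xy X0 Y0 p q by (simp add: powr_divide powr_powr powr_mult)
    finally show ?thesis using X0 Y0 by (simp add: divide_le_eq mult.commute)
  qed
  have "(\<Sum>n<N. (x n * y n) powr r)
      \<le> (X * Y) powr r * (r / p * ((\<Sum>n<N. x n powr p) / X powr p) + r / q * ((\<Sum>n<N. y n powr q) / Y powr q))"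
    using sum_mono[of "{..<N}", OF young]
    by (simp only: sum_distrib_left[symmetric] sum.distrib sum_divide_distrib[symmetric])
  also have "\<dots> \<le> (X * Y) powr r * (r / p * 1 + r / q * 1)"
    using sx sy X0 Y0 p q r0 by (intro mult_left_mono add_mono) (auto simp: divide_le_eq)
  also have "\<dots> = (X * Y) powr r" using sum1 by simp
  finally show ?thesis .
qed

lemma ennreal_inverse_involutive: "inverse (inverse x) = (x::ennreal)"
proof (cases x)
  case (real a)
  then show ?thesis by (cases "a = 0") (simp_all add: inverse_ennreal less_le)
qed simp

text \<open>Diagonal values of \<open>S\<close> are bounded by products of two column norms whose
  \<open>p\<close>-th and \<open>q\<close>-th power sums are known. Finite exponents are combined by
  Hoelder's inequality; an infinite exponent turns the corresponding column norm into a
  constant.\<close>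

lemma schatten_class_of_column_bounds:
  fixes S T1 T2 :: "'h \<Rightarrow> 'h::complex_hilbert_space" and p q r :: ennreal
  assumes S: "bounded_clinear S" and p: "2 \<le> p" and q: "2 \<le> q" and r: "1 / r = 1 / p + 1 / q"
    and T1: "T1 \<in> schatten_class p" and T2: "T2 \<in> schatten_class q"
    and AD1: "column_pair A1 D1 C1" and AD2: "column_pair A2 D2 C2" and K: "0 \<le> K"
    and le: "\<And>g h. cmod (cinner (S g) h)
      \<le> K * (column_norm (cadjoint T1) A1 h * column_norm T2 A2 g)"
  shows "S \<in> schatten_class r \<and>
    schatten_norm r S \<le> K * (C1 * schatten_norm p T1 * (C2 * schatten_norm q T2))"
proof -
  have b: "bounded_clinear T1" "bounded_clinear T2" using T1 T2 by (auto simp: schatten_class_def)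
  have b': "bounded_clinear (cadjoint T1)" by (rule bounded_clinear_cadjoint[OF b(1)])
  have cb: "column_bound A1 C1" "column_bound A2 C2" and C: "0 \<le> C1" "0 \<le> C2"
    using AD1 AD2 by (auto simp: column_pair_def column_bound_def)
  have N0: "0 \<le> schatten_norm p T1" "0 \<le> schatten_norm q T2"
    using b by (auto simp: schatten_norm_def onorm_clinear_nonneg)
  note cn0 = column_norm_nonneg[OF b' cb(1)] column_norm_nonneg[OF b(2) cb(2)]
  have inf1: "column_norm (cadjoint T1) A1 h \<le> C1 * schatten_norm p T1 * norm h" if "p = \<infinity>" for h
    using column_norm_le[OF b' cb(1), of h] mult_right_mono[OF onorm_cadjoint_le[OF b(1)], of "C1 * norm h"] C
    by (simp add: that schatten_norm_def mult_ac)
  have inf2: "column_norm T2 A2 g \<le> C2 * schatten_norm q T2 * norm g" if "q = \<infinity>" for g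
    using column_norm_le[OF b(2) cb(2), of g] by (simp add: that schatten_norm_def mult_ac)
  have fin1: "(\<Sum>n<N. column_norm (cadjoint T1) A1 (h n) powr enn2real p)
      \<le> (C1 * schatten_norm p T1) powr enn2real p"
    if "p \<noteq> \<infinity>" "2 \<le> enn2real p" "bessel_family {..<N::nat} h" for N h
  proof -
    define P where "P = enn2real p"
    have sm: "summable (\<lambda>k. singular_value T1 k powr P)"
      using T1 that by (simp add: schatten_class_def P_def)
    have le1: "singular_value (cadjoint T1) k powr P \<le> singular_value T1 k powr P" for k
      using that(2) by (intro powr_mono2 singular_value_cadjoint_le b singular_value_nonneg b') (simp add: P_def)
    then have sm': "summable (\<lambda>k. singular_value (cadjoint T1) k powr P)"
      by (intro summable_comparison_test'[OF sm, of 0]) auto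
    have "(\<Sum>n<N. column_norm (cadjoint T1) A1 (h n) powr P)
        \<le> (C1 * (\<Sum>k. singular_value (cadjoint T1) k powr P) powr (1 / P)) powr P"
      using that by (intro schatten_column_sum[OF b' _ sm' AD1]) (auto simp: P_def)
    also have "\<dots> \<le> (C1 * (\<Sum>k. singular_value T1 k powr P) powr (1 / P)) powr P"
      using that(2) C suminf_nonneg[OF sm'] suminf_le[OF le1 sm' sm]
      by (intro powr_mono2 mult_left_mono) (simp_all add: P_def)
    finally show ?thesis using that(1) by (simp add: P_def schatten_norm_def)
  qed
  have fin2: "(\<Sum>n<N. column_norm T2 A2 (g n) powr enn2real q)
      \<le> (C2 * schatten_norm q T2) powr enn2real q"
    if "q \<noteq> \<infinity>" "2 \<le> enn2real q" "bessel_family {..<N::nat} g" for N g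
    using schatten_column_sum[OF b(2) that(2) _ AD2 that(3)] T2 that(1)
    by (simp add: schatten_class_def schatten_norm_def)
  have real: "s = ennreal (enn2real s)" "2 \<le> enn2real s" if "s \<noteq> \<infinity>" "2 \<le> s" for s
  proof -
    show *: "s = ennreal (enn2real s)" using that by (simp add: less_top)
    show "2 \<le> enn2real s" using that(2) by (subst (asm) *) simp
  qed
  define X Y where "X = C1 * schatten_norm p T1" and "Y = C2 * schatten_norm q T2"
  have XY: "0 \<le> X" "0 \<le> Y" using C N0 by (auto simp: X_def Y_def)
  define \<xi> \<upsilon> where "\<xi> = column_norm (cadjoint T1) A1" and "\<upsilon> = column_norm T2 A2"
  have \<xi>\<upsilon>: "0 \<le> \<xi> h" "0 \<le> \<upsilon> g" for h g by (simp_all add: \<xi>_def \<upsilon>_def cn0)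
  \<comment> \<open>Common end of the cases in which \<open>r\<close> is finite: only the power sum
    of the products of column norms remains to be estimated.\<close>
  have finish: ?thesis if rr: "r \<noteq> \<infinity>" "0 < R" "R = enn2real r"
    and sum: "\<And>N g h. bessel_family {..<N::nat} g \<Longrightarrow> bessel_family {..<N::nat} h \<Longrightarrow>
      (\<Sum>n<N. (\<xi> (h n) * \<upsilon> (g n)) powr R) \<le> (X * Y) powr R" for R
  proof -
    have *: "(\<Sum>n<N. cmod (cinner (S (g n)) (h n)) powr R) \<le> (K * (X * Y)) powr R"
      if gh: "bessel_family {..<N::nat} g" "bessel_family {..<N::nat} h" for N g h
    proof -
      have "(\<Sum>n<N. cmod (cinner (S (g n)) (h n)) powr R) \<le> (\<Sum>n<N. K powr R * (\<xi> (h n) * \<upsilon> (g n)) powr R)"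
        using K \<xi>\<upsilon> rr le by (intro sum_mono) (auto simp: powr_mult[symmetric] \<xi>_def \<upsilon>_def intro!: powr_mono2)
      also have "\<dots> \<le> K powr R * (X * Y) powr R"
        unfolding sum_distrib_left[symmetric] by (intro mult_left_mono sum[OF gh]) simp
      finally show ?thesis using K XY by (simp add: powr_mult)
    qed
    have B: "0 \<le> K * (X * Y)" using K XY by simp
    have "S \<in> schatten_class r"
      using S schatten_from_families(1)[OF S rr(2) B *] unfolding schatten_class_def rr(3) by blast
    moreover have "schatten_norm r S \<le> K * (X * Y)"
      using schatten_from_families(2)[OF S rr(2) B *]
      unfolding schatten_norm_def rr(3) if_not_P[OF rr(1)] .
    ultimately show ?thesis unfolding X_def Y_def ..
  qed
  have inf_inverse: "r = s" if "1 / r = 1 / s" for s :: ennreal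
  proof -
    have "inverse r = inverse s" using that unfolding divide_ennreal_def mult_1 .
    then show ?thesis by (metis ennreal_inverse_involutive)
  qed
  consider "p = \<infinity>" "q = \<infinity>" | "p \<noteq> \<infinity>" "q = \<infinity>" | "p = \<infinity>" "q \<noteq> \<infinity>" | "p \<noteq> \<infinity>" "q \<noteq> \<infinity>" by blast
  then show ?thesis
  proof cases
    case 1
    then have "r = \<infinity>" using r inf_inverse[of \<infinity>] by simp
    moreover have "onorm S \<le> K * (X * Y)"
    proof (rule onorm_bound)
      fix g
      \<comment> \<open>Here no singular values occur; the form bound is used with
        \<open>h = S g\<close> and one factor \<open>norm (S g)\<close> is cancelled.\<close>
      have "(norm (S g))\<^sup>2 = cmod (cinner (S g) (S g))" by (simp add: cinner_self norm_power)
      also have "\<dots> \<le> K * (\<xi> (S g) * \<upsilon> g)" using le by (simp add: \<xi>_def \<upsilon>_def)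
      also have "\<dots> \<le> K * ((X * norm (S g)) * (Y * norm g))"
        using inf1[OF 1(1), of "S g"] inf2[OF 1(2), of g] \<xi>\<upsilon> K XY
        by (intro mult_left_mono mult_mono) (auto simp: \<xi>_def \<upsilon>_def X_def Y_def)
      finally show "norm (S g) \<le> K * (X * Y) * norm g"
        using K XY by (cases "S g = 0") (auto simp: power2_eq_square mult_ac)
    qed (use K XY in simp)
    ultimately show ?thesis using S by (simp add: schatten_class_def schatten_norm_def X_def Y_def)
  next
    case 2
    then have rp: "r = p" using r by (intro inf_inverse) simp
    show ?thesis
    proof (rule finish)
      show "r \<noteq> \<infinity>" "0 < enn2real p" "enn2real p = enn2real r" using rp 2 real(2)[OF 2(1) p] by auto
      fix N and g h :: "nat \<Rightarrow> 'h" assume gh: "bessel_family {..<N::nat} g" "bessel_family {..<N::nat} h"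
      have "(\<Sum>n<N. (\<xi> (h n) * \<upsilon> (g n)) powr enn2real p) \<le> (\<Sum>n<N. \<xi> (h n) powr enn2real p * Y powr enn2real p)"
      proof (rule sum_mono)
        fix n assume n: "n \<in> {..<N}"
        \<comment> \<open>Members of a Bessel family have norm at most 1, so the factor with
          infinite exponent is bounded by \<open>Y\<close>.\<close>
        have "\<upsilon> (g n) \<le> Y * norm (g n)" using inf2[OF 2(2)] by (simp add: \<upsilon>_def Y_def)
        also have "\<dots> \<le> Y * 1" using bessel_family_norm_le[OF gh(1) n] XY by (intro mult_left_mono) auto
        finally have "\<upsilon> (g n) powr enn2real p \<le> Y powr enn2real p" using \<xi>\<upsilon> by (intro powr_mono2) auto
        then show "(\<xi> (h n) * \<upsilon> (g n)) powr enn2real p \<le> \<xi> (h n) powr enn2real p * Y powr enn2real p"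
          using \<xi>\<upsilon> by (simp add: powr_mult mult_left_mono)
      qed
      also have "\<dots> \<le> X powr enn2real p * Y powr enn2real p"
        unfolding sum_distrib_right[symmetric] using fin1[OF 2(1) real(2)[OF 2(1) p] gh(2)]
        by (intro mult_right_mono) (auto simp: \<xi>_def X_def)
      finally show "(\<Sum>n<N. (\<xi> (h n) * \<upsilon> (g n)) powr enn2real p) \<le> (X * Y) powr enn2real p"
        using XY by (simp add: powr_mult)
    qed
  next
    case 3
    then have rq: "r = q" using r by (intro inf_inverse) simp
    show ?thesis
    proof (rule finish)
      show "r \<noteq> \<infinity>" "0 < enn2real q" "enn2real q = enn2real r" using rq 3 real(2)[OF 3(2) q] by auto
      fix N and g h :: "nat \<Rightarrow> 'h" assume gh: "bessel_family {..<N::nat} g" "bessel_family {..<N::nat} h"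
      have "(\<Sum>n<N. (\<xi> (h n) * \<upsilon> (g n)) powr enn2real q) \<le> (\<Sum>n<N. X powr enn2real q * \<upsilon> (g n) powr enn2real q)"
      proof (rule sum_mono)
        fix n assume n: "n \<in> {..<N}"
        have "\<xi> (h n) \<le> X * norm (h n)" using inf1[OF 3(1)] by (simp add: \<xi>_def X_def)
        also have "\<dots> \<le> X * 1" using bessel_family_norm_le[OF gh(2) n] XY by (intro mult_left_mono) auto
        finally have "\<xi> (h n) powr enn2real q \<le> X powr enn2real q" using \<xi>\<upsilon> by (intro powr_mono2) auto
        then show "(\<xi> (h n) * \<upsilon> (g n)) powr enn2real q \<le> X powr enn2real q * \<upsilon> (g n) powr enn2real q"
          using \<xi>\<upsilon> by (simp add: powr_mult mult_right_mono)
      qed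
      also have "\<dots> \<le> X powr enn2real q * Y powr enn2real q"
        unfolding sum_distrib_left[symmetric] using fin2[OF 3(2) real(2)[OF 3(2) q] gh(1)]
        by (intro mult_left_mono) (auto simp: \<upsilon>_def Y_def)
      finally show "(\<Sum>n<N. (\<xi> (h n) * \<upsilon> (g n)) powr enn2real q) \<le> (X * Y) powr enn2real q"
        using XY by (simp add: powr_mult)
    qed
  next
    case 4
    define P Q where "P = enn2real p" and "Q = enn2real q"
    have P: "p = ennreal P" "2 \<le> P" using real[OF 4(1) p] by (auto simp: P_def)
    have Q: "q = ennreal Q" "2 \<le> Q" using real[OF 4(2) q] by (auto simp: Q_def)
    have inv: "1 / ennreal x = ennreal (1 / x)" if "0 < x" for x
      using divide_ennreal[of 1 x] that by simp
    define R where "R = 1 / (1 / P + 1 / Q)"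
    have R: "0 < R" "1 / R = 1 / P + 1 / Q" using P(2) Q(2) by (auto simp: R_def add_pos_pos)
    have "1 / r = 1 / ennreal R"
      using P Q R(1) unfolding r P(1) Q(1) by (simp add: inv R(2)[symmetric] ennreal_plus[symmetric] del: ennreal_plus)
    then have rR: "r = ennreal R" by (rule inf_inverse)
    show ?thesis
    proof (rule finish)
      show "r \<noteq> \<infinity>" "0 < R" "R = enn2real r" using R by (auto simp: rR)
      fix N and g h :: "nat \<Rightarrow> 'h" assume gh: "bessel_family {..<N::nat} g" "bessel_family {..<N::nat} h"
      show "(\<Sum>n<N. (\<xi> (h n) * \<upsilon> (g n)) powr R) \<le> (X * Y) powr R"
        using P(2) Q(2) R XY \<xi>\<upsilon> fin1[OF 4(1) _ gh(2)] fin2[OF 4(2) _ gh(1)]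
        by (intro holder_powr_sum[of P Q]) (auto simp: P_def Q_def \<xi>_def \<upsilon>_def X_def Y_def)
    qed
  qed
qed

section \<open>Chains of block operators on \<open>\<ell>\<^sup>2\<close>-sequences\<close>

definition l2s :: "(nat \<Rightarrow> 'a::real_normed_vector) \<Rightarrow> bool" where
  "l2s w \<longleftrightarrow> summable (\<lambda>k. (norm (w k))\<^sup>2)"

definition l2n :: "(nat \<Rightarrow> 'a::real_normed_vector) \<Rightarrow> real" where
  "l2n w = sqrt (\<Sum>k. (norm (w k))\<^sup>2)"

lemma L2_set_le_l2n: "l2s w \<Longrightarrow> L2_set (\<lambda>k. norm (w k)) {..<n} \<le> l2n w"
  unfolding l2s_def l2n_def L2_set_def by (intro real_sqrt_le_mono sum_le_suminf) auto

lemma l2sI: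
  assumes "\<And>n. L2_set (\<lambda>k. norm (w k)) {..<n} \<le> B"
  shows "l2s w" "l2n w \<le> B"
proof -
  have B: "0 \<le> B" using assms[of 0] by simp
  have le: "(\<Sum>k<n. (norm (w k))\<^sup>2) \<le> B\<^sup>2" for n
    using assms[of n] by (simp add: L2_set_def real_sqrt_le_iff' B sum_nonneg sqrt_le_D)
  show *: "l2s w" unfolding l2s_def by (rule summableI_nonneg_bounded[OF _ le]) simp
  show "l2n w \<le> B"
    unfolding l2n_def by (rule real_le_lsqrt) (use * le B in \<open>auto simp: l2s_def intro: suminf_le_const\<close>)
qed

lemma l2n_nonneg: "l2s w \<Longrightarrow> 0 \<le> l2n w"
  using L2_set_le_l2n[of w 0] by simp

lemma norm_le_l2n:
  assumes "l2s w"
  shows "norm (w k) \<le> l2n w"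
proof -
  have "norm (w k) \<le> L2_set (\<lambda>k. norm (w k)) {..<Suc k}" by (rule member_le_L2_set) auto
  then show ?thesis using L2_set_le_l2n[OF assms, of "Suc k"] by linarith
qed

lemma l2_add:
  assumes "l2s u" "l2s v"
  shows "l2s (\<lambda>k. u k + v k)" "l2n (\<lambda>k. u k + v k) \<le> l2n u + l2n v"
proof -
  have "L2_set (\<lambda>k. norm (u k + v k)) {..<n} \<le> l2n u + l2n v" for n
  proof -
    have "L2_set (\<lambda>k. norm (u k + v k)) {..<n} \<le> L2_set (\<lambda>k. norm (u k) + norm (v k)) {..<n}"
      by (intro L2_set_mono norm_triangle_ineq) simp
    also have "\<dots> \<le> L2_set (\<lambda>k. norm (u k)) {..<n} + L2_set (\<lambda>k. norm (v k)) {..<n}"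
      by (rule L2_set_triangle_ineq)
    finally show ?thesis using L2_set_le_l2n[OF assms(1), of n] L2_set_le_l2n[OF assms(2), of n] by linarith
  qed
  then show "l2s (\<lambda>k. u k + v k)" "l2n (\<lambda>k. u k + v k) \<le> l2n u + l2n v" by (rule l2sI)+
qed

lemma l2_diff:
  assumes "l2s u" "l2s v"
  shows "l2s (\<lambda>k. u k - v k)" "l2n (\<lambda>k. u k - v k) \<le> l2n u + l2n v"
  using l2_add[OF assms(1), of "\<lambda>k. - v k"] assms(2) by (simp_all add: l2s_def l2n_def)

text \<open>The index \<open>n\<close> itself is kept, in accordance with \<open>rectangle\<close>,
  where the summation limits are included.\<close>

definition l2trunc :: "nat \<Rightarrow> (nat \<Rightarrow> 'a::zero) \<Rightarrow> nat \<Rightarrow> 'a" where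
  "l2trunc n w k = (if k \<le> n then w k else 0)"

lemma l2_mono:
  assumes "l2s w" "\<And>k. norm (u k) \<le> norm (w k)"
  shows "l2s u" "l2n u \<le> l2n w"
proof -
  have "L2_set (\<lambda>k. norm (u k)) {..<n} \<le> l2n w" for n
    using L2_set_mono[of "{..<n}" "\<lambda>k. norm (u k)" "\<lambda>k. norm (w k)"] L2_set_le_l2n[OF assms(1), of n]
      assms(2) by simp
  then show "l2s u" "l2n u \<le> l2n w" by (rule l2sI)+
qed

lemma l2_trunc: "l2s w \<Longrightarrow> l2s (l2trunc n w)" "l2s w \<Longrightarrow> l2n (l2trunc n w) \<le> l2n w"
  by (rule l2_mono[of w]; simp add: l2trunc_def)+

lemma l2n_tail_tendsto:
  assumes "l2s w"
  shows "(\<lambda>n. l2n (\<lambda>k. w k - l2trunc n w k)) \<longlonglongrightarrow> 0"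
proof -
  have sm: "summable (\<lambda>k. (norm (w k))\<^sup>2)" using assms by (simp add: l2s_def)
  have "l2n (\<lambda>k. w k - l2trunc n w k) = sqrt (\<Sum>k. (norm (w (k + Suc n)))\<^sup>2)" for n
  proof -
    have l2: "l2s (\<lambda>k. w k - l2trunc n w k)" by (rule l2_diff[OF assms l2_trunc(1)[OF assms]])
    have "(\<Sum>k. (norm (w k - l2trunc n w k))\<^sup>2)
        = (\<Sum>k. (norm (w (k + Suc n) - l2trunc n w (k + Suc n)))\<^sup>2) + (\<Sum>k<Suc n. (norm (w k - l2trunc n w k))\<^sup>2)"
      using l2 by (intro suminf_split_initial_segment) (simp add: l2s_def)
    also have "(\<Sum>k<Suc n. (norm (w k - l2trunc n w k))\<^sup>2) = 0"
      by (intro sum.neutral) (simp add: l2trunc_def)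
    finally show ?thesis by (simp add: l2n_def l2trunc_def)
  qed
  moreover have "(\<lambda>n. sqrt (\<Sum>k. (norm (w (k + Suc n)))\<^sup>2)) \<longlonglongrightarrow> sqrt 0"
    by (intro tendsto_real_sqrt LIMSEQ_Suc[OF suminf_exist_split2[OF sm]])
  ultimately show ?thesis by simp
qed

text \<open>An infinite operator matrix of norm at most \<open>C\<close>, expressed by its finite
  sections. The entries are only required to be real-linear, so that the notion covers operators on
  the Hilbert space and multiplications by complex numbers alike.\<close>

definition block :: "(nat \<Rightarrow> nat \<Rightarrow> 'a::real_normed_vector \<Rightarrow> 'a) \<Rightarrow> real \<Rightarrow> bool" where
  "block X C \<longleftrightarrow> 0 \<le> C \<and> (\<forall>j k. bounded_linear (X j k)) \<and>
     (\<forall>J K w. L2_set (\<lambda>j. norm (\<Sum>k<K. X j k (w k))) {..<J} \<le> C * L2_set (\<lambda>k. norm (w k)) {..<K})"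

definition bapp :: "(nat \<Rightarrow> nat \<Rightarrow> 'a::real_normed_vector \<Rightarrow> 'a) \<Rightarrow> (nat \<Rightarrow> 'a) \<Rightarrow> nat \<Rightarrow> 'a" where
  "bapp X w j = (\<Sum>k. X j k (w k))"

lemma block_linear: "block X C \<Longrightarrow> bounded_linear (X j k)"
  by (simp add: block_def)

text \<open>A piece of the series from \<open>m\<close> on is a row entry of a finite section
  applied to \<open>w\<close> with its first \<open>m\<close> terms replaced by 0, so it is bounded
  by \<open>C\<close> times a tail of \<open>w\<close>.\<close>

lemma block_summable:
  fixes X :: "nat \<Rightarrow> nat \<Rightarrow> 'a::banach \<Rightarrow> 'a"
  assumes X: "block X C" and w: "l2s w"
  shows "summable (\<lambda>k. X j k (w k))"
  unfolding summable_Cauchy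
proof (intro allI impI)
  fix e :: real assume e: "0 < e"
  have C: "0 \<le> C" using X by (simp add: block_def)
  define \<delta> where "\<delta> = e / (C + 1)"
  have \<delta>: "\<delta> > 0" using e C by (simp add: \<delta>_def)
  obtain N where N: "\<And>m n. m \<ge> N \<Longrightarrow> norm (\<Sum>k=m..<n. (norm (w k))\<^sup>2) < \<delta>\<^sup>2"
    using w \<delta> unfolding l2s_def summable_Cauchy by (meson zero_less_power)
  have "norm (\<Sum>k=m..<n. X j k (w k)) < e" if "m \<ge> N" for m n
  proof -
    define v where "v k = (if m \<le> k then w k else 0)" for k
    have X0: "X j k 0 = 0" for k using linear_0[OF bounded_linear.linear[OF block_linear[OF X]]] .
    have "(\<Sum>k=m..<n. X j k (w k)) = (\<Sum>k<n. X j k (v k))"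
      by (rule sum.mono_neutral_cong_left) (auto simp: v_def X0)
    then have "norm (\<Sum>k=m..<n. X j k (w k)) \<le> L2_set (\<lambda>j. norm (\<Sum>k<n. X j k (v k))) {..<Suc j}"
      using member_le_L2_set[of "{..<Suc j}" j "\<lambda>j. norm (\<Sum>k<n. X j k (v k))"] by simp
    also have "\<dots> \<le> C * L2_set (\<lambda>k. norm (v k)) {..<n}" using X by (simp add: block_def)
    also have "\<dots> \<le> C * \<delta>"
    proof (intro mult_left_mono C)
      have "(\<Sum>k<n. (norm (v k))\<^sup>2) = (\<Sum>k=m..<n. (norm (w k))\<^sup>2)"
        by (rule sum.mono_neutral_cong_right) (auto simp: v_def)
      also have "\<dots> \<le> \<delta>\<^sup>2" using N[OF that, of n] by (simp add: sum_nonneg)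
      finally show "L2_set (\<lambda>k. norm (v k)) {..<n} \<le> \<delta>"
        unfolding L2_set_def using \<delta> by (intro real_le_lsqrt) auto
    qed
    also have "\<dots> < e" using e C by (simp add: \<delta>_def divide_simps)
    finally show ?thesis .
  qed
  then show "\<exists>N. \<forall>m\<ge>N. \<forall>n. norm (\<Sum>k=m..<n. X j k (w k)) < e" by blast
qed

lemma block_apply:
  fixes X :: "nat \<Rightarrow> nat \<Rightarrow> 'a::banach \<Rightarrow> 'a"
  assumes X: "block X C" and w: "l2s w"
  shows "l2s (bapp X w)" "l2n (bapp X w) \<le> C * l2n w"
proof -
  have "L2_set (\<lambda>j. norm (bapp X w j)) {..<J} \<le> C * l2n w" for J
  proof (rule LIMSEQ_le_const2)
    show "(\<lambda>K. L2_set (\<lambda>j. norm (\<Sum>k<K. X j k (w k))) {..<J}) \<longlonglongrightarrow> L2_set (\<lambda>j. norm (bapp X w j)) {..<J}"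
      unfolding L2_set_def bapp_def by (intro tendsto_intros summable_LIMSEQ block_summable[OF assms])
    have "L2_set (\<lambda>j. norm (\<Sum>k<K. X j k (w k))) {..<J} \<le> C * l2n w" for K
    proof -
      have "L2_set (\<lambda>j. norm (\<Sum>k<K. X j k (w k))) {..<J} \<le> C * L2_set (\<lambda>k. norm (w k)) {..<K}"
        using X by (simp add: block_def)
      also have "\<dots> \<le> C * l2n w" using X by (intro mult_left_mono L2_set_le_l2n w) (simp add: block_def)
      finally show ?thesis .
    qed
    then show "\<exists>N. \<forall>K\<ge>N. L2_set (\<lambda>j. norm (\<Sum>k<K. X j k (w k))) {..<J} \<le> C * l2n w" by blast
  qed
  then show "l2s (bapp X w)" "l2n (bapp X w) \<le> C * l2n w" by (rule l2sI)+
qed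

lemma bapp_diff:
  fixes X :: "nat \<Rightarrow> nat \<Rightarrow> 'a::banach \<Rightarrow> 'a"
  assumes X: "block X C" and "l2s u" "l2s v"
  shows "bapp X u j - bapp X v j = bapp X (\<lambda>k. u k - v k) j"
  unfolding bapp_def
  by (subst suminf_diff[OF block_summable[OF X assms(2)] block_summable[OF X assms(3)]])
    (simp add: linear_diff[OF bounded_linear.linear[OF block_linear[OF X]]])

lemma bapp_trunc:
  assumes "block X C"
  shows "bapp X (l2trunc n w) j = (\<Sum>k\<le>n. X j k (w k))"
  unfolding bapp_def
  by (subst suminf_finite[of "{..n}"])
    (auto simp: l2trunc_def linear_0[OF bounded_linear.linear[OF block_linear[OF assms]]])

text \<open>The index of the recursion counts the blocks \<open>X (m - 1), X (m - 2), \<dots>\<close> that have been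
  applied; \<open>tchain\<close> sums the \<open>i\<close>-th index only up to \<open>N i\<close>.\<close>

primrec chain :: "(nat \<Rightarrow> nat \<Rightarrow> nat \<Rightarrow> 'a \<Rightarrow> 'a::real_normed_vector) \<Rightarrow> nat \<Rightarrow> (nat \<Rightarrow> 'a) \<Rightarrow> nat \<Rightarrow> nat \<Rightarrow> 'a" where
  "chain X m w 0 = w"
| "chain X m w (Suc d) = bapp (X (m - Suc d)) (chain X m w d)"

primrec tchain :: "(nat \<Rightarrow> nat \<Rightarrow> nat \<Rightarrow> 'a \<Rightarrow> 'a::real_normed_vector) \<Rightarrow> nat \<Rightarrow> (nat \<Rightarrow> nat) \<Rightarrow> (nat \<Rightarrow> 'a) \<Rightarrow> nat \<Rightarrow> nat \<Rightarrow> 'a" where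
  "tchain X m N w 0 = w"
| "tchain X m N w (Suc d) = bapp (X (m - Suc d)) (l2trunc (N (m - Suc d)) (tchain X m N w d))"

lemma atLeastLessThan_diff_Suc: "Suc d \<le> m \<Longrightarrow> {m - Suc d..<m} = insert (m - Suc d) {m - d..<m}"
  by auto

lemma chain_bound:
  fixes X :: "nat \<Rightarrow> nat \<Rightarrow> nat \<Rightarrow> 'a::banach \<Rightarrow> 'a"
  assumes "\<And>i. i \<in> {m-d..<m} \<Longrightarrow> block (X i) (C i)" "d \<le> m" "l2s w"
  shows "l2s (chain X m w d)" "l2n (chain X m w d) \<le> (\<Prod>i\<in>{m-d..<m}. C i) * l2n w"
  using assms(1,2)
proof (induction d)
  case (Suc d)
  { case 1
    then have X: "block (X (m - Suc d)) (C (m - Suc d))" by auto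
    show ?case using 1 Suc block_apply[OF X] by (auto simp: atLeastLessThan_diff_Suc)
  next
    case 2
    then have X: "block (X (m - Suc d)) (C (m - Suc d))" by auto
    have IH: "l2s (chain X m w d)" "l2n (chain X m w d) \<le> (\<Prod>i\<in>{m-d..<m}. C i) * l2n w"
      using Suc 2 by (auto simp: atLeastLessThan_diff_Suc)
    have "l2n (chain X m w (Suc d)) \<le> C (m - Suc d) * l2n (chain X m w d)"
      using block_apply(2)[OF X IH(1)] by simp
    also have "\<dots> \<le> C (m - Suc d) * ((\<Prod>i\<in>{m-d..<m}. C i) * l2n w)"
      using X by (intro mult_left_mono IH) (simp add: block_def)
    finally show ?case using 2 by (simp add: atLeastLessThan_diff_Suc mult.assoc)
  }
qed (use assms(3) in auto)

lemma tchain_bound: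
  fixes X :: "nat \<Rightarrow> nat \<Rightarrow> nat \<Rightarrow> 'a::banach \<Rightarrow> 'a"
  assumes "\<And>i. i \<in> {m-d..<m} \<Longrightarrow> block (X i) (C i)" "d \<le> m" "l2s w"
  shows "l2s (tchain X m N w d)" "l2n (tchain X m N w d) \<le> (\<Prod>i\<in>{m-d..<m}. C i) * l2n w"
  using assms(1,2)
proof (induction d)
  case (Suc d)
  { case 1
    then have X: "block (X (m - Suc d)) (C (m - Suc d))" by auto
    have "l2s (tchain X m N w d)" using 1 Suc by (auto simp: atLeastLessThan_diff_Suc)
    then show ?case by (simp add: block_apply(1)[OF X] l2_trunc(1))
  next
    case 2
    then have X: "block (X (m - Suc d)) (C (m - Suc d))" by auto
    have IH: "l2s (tchain X m N w d)" "l2n (tchain X m N w d) \<le> (\<Prod>i\<in>{m-d..<m}. C i) * l2n w"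
      using Suc 2 by (auto simp: atLeastLessThan_diff_Suc)
    have "l2n (tchain X m N w (Suc d)) \<le> C (m - Suc d) * l2n (l2trunc (N (m - Suc d)) (tchain X m N w d))"
      using block_apply(2)[OF X l2_trunc(1)[OF IH(1)]] by simp
    also have "\<dots> \<le> C (m - Suc d) * ((\<Prod>i\<in>{m-d..<m}. C i) * l2n w)"
      using X by (intro mult_left_mono order_trans[OF l2_trunc(2) IH(2)] IH(1)) (simp add: block_def)
    finally show ?case using 2 by (simp add: atLeastLessThan_diff_Suc mult.assoc)
  }
qed (use assms(3) in auto)

text \<open>Each step truncates the vector once more. Truncation is a contraction, so the previous
  error does not grow, and the new error is a tail of the fixed sequence \<open>W\<close>. That tail
  depends on the single limit \<open>N i\<close>, which is why the limits may tend to infinity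
  independently.\<close>

lemma tchain_tendsto:
  fixes X :: "nat \<Rightarrow> nat \<Rightarrow> nat \<Rightarrow> 'a::banach \<Rightarrow> 'a"
  assumes "\<And>i. i \<in> {m-d..<m} \<Longrightarrow> block (X i) (C i)" "d \<le> m" "l2s w"
    and "\<And>i. i \<in> {m-d..<m} \<Longrightarrow> filterlim (\<lambda>N. N i) sequentially F"
  shows "((\<lambda>N. l2n (\<lambda>j. tchain X m N w d j - chain X m w d j)) \<longlongrightarrow> 0) F"
  using assms(1,2,4)
proof (induction d)
  case 0
  show ?case by (simp add: l2n_def)
next
  case (Suc d)
  define i where "i = m - Suc d"
  have X: "block (X i) (C i)" and lim: "filterlim (\<lambda>N. N i) sequentially F"
    using Suc.prems by (auto simp: i_def)
  have sub: "\<And>l. l \<in> {m-d..<m} \<Longrightarrow> block (X l) (C l)" "d \<le> m" using Suc.prems by auto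
  define W tW where "W = chain X m w d" and "tW N = tchain X m N w d" for N
  have W: "l2s W" unfolding W_def by (rule chain_bound(1)[OF sub assms(3)])
  have tW: "l2s (tW N)" for N unfolding tW_def by (rule tchain_bound(1)[OF sub assms(3)])
  have IH: "((\<lambda>N. l2n (\<lambda>j. tW N j - W j)) \<longlongrightarrow> 0) F"
    unfolding W_def tW_def using Suc.prems by (intro Suc.IH) auto
  have D: "l2s (\<lambda>j. tW N j - W j)" for N by (rule l2_diff[OF tW W])
  have D': "l2s (\<lambda>j. l2trunc (N i) (tW N) j - W j)" for N by (rule l2_diff[OF l2_trunc(1)[OF tW] W])
  have tail: "((\<lambda>N. l2n (\<lambda>k. W k - l2trunc (N i) W k)) \<longlongrightarrow> 0) F"
    by (rule filterlim_compose[OF l2n_tail_tendsto[OF W] lim])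
  have eq: "(\<lambda>j. tchain X m N w (Suc d) j - chain X m w (Suc d) j)
      = bapp (X i) (\<lambda>j. l2trunc (N i) (tW N) j - W j)" for N
    using bapp_diff[OF X l2_trunc(1)[OF tW] W] by (simp add: i_def W_def tW_def)
  have le: "l2n (bapp (X i) (\<lambda>j. l2trunc (N i) (tW N) j - W j))
      \<le> C i * (l2n (\<lambda>j. tW N j - W j) + l2n (\<lambda>k. W k - l2trunc (N i) W k))" for N
  proof -
    \<comment> \<open>The truncation is compared with \<open>W\<close> by truncating the old error
      and subtracting the tail of \<open>W\<close>.\<close>
    have "l2n (\<lambda>j. l2trunc (N i) (tW N) j - W j)
        = l2n (\<lambda>j. l2trunc (N i) (\<lambda>j. tW N j - W j) j - (W j - l2trunc (N i) W j))"
      by (rule arg_cong[where f = l2n]) (auto simp: l2trunc_def)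
    also have "\<dots> \<le> l2n (l2trunc (N i) (\<lambda>j. tW N j - W j)) + l2n (\<lambda>j. W j - l2trunc (N i) W j)"
      by (intro l2_diff(2) l2_trunc(1) D l2_diff(1) W)
    also have "\<dots> \<le> l2n (\<lambda>j. tW N j - W j) + l2n (\<lambda>j. W j - l2trunc (N i) W j)"
      by (intro add_right_mono l2_trunc(2) D)
    finally have "C i * l2n (\<lambda>j. l2trunc (N i) (tW N) j - W j)
        \<le> C i * (l2n (\<lambda>j. tW N j - W j) + l2n (\<lambda>j. W j - l2trunc (N i) W j))"
      using X by (intro mult_left_mono) (auto simp: block_def)
    then show ?thesis using block_apply(2)[OF X D'[of N]] by linarith
  qed
  have nn: "0 \<le> l2n (bapp (X i) (\<lambda>j. l2trunc (N i) (tW N) j - W j))" for N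
    by (rule l2n_nonneg[OF block_apply(1)[OF X D']])
  have lim0: "((\<lambda>N. C i * (l2n (\<lambda>j. tW N j - W j) + l2n (\<lambda>k. W k - l2trunc (N i) W k))) \<longlongrightarrow> 0) F"
    using tendsto_mult_left[OF tendsto_add[OF IH tail], of "C i"] by simp
  show ?case
    unfolding eq
  proof (rule tendsto_0_le[OF lim0, of _ 1], rule always_eventually, rule allI)
    fix N
    show "norm (l2n (bapp (X i) (\<lambda>j. l2trunc (N i) (tW N) j - W j)))
        \<le> norm (C i * (l2n (\<lambda>j. tW N j - W j) + l2n (\<lambda>k. W k - l2trunc (N i) W k))) * 1"
      unfolding real_norm_def mult_1_right abs_of_nonneg[OF nn]
      by (rule order_trans[OF le abs_ge_self])
  qed
qed

lemma sum_PiE_insert: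
  assumes "i \<notin> S"
  shows "(\<Sum>J\<in>PiE (insert i S) B. f J) = (\<Sum>k\<in>B i. \<Sum>J\<in>PiE S B. f (J(i := k)))"
proof -
  have "(\<Sum>J\<in>PiE (insert i S) B. f J) = (\<Sum>(k, J)\<in>B i \<times> PiE S B. f (J(i := k)))"
    unfolding PiE_insert_eq
    by (subst sum.reindex[OF inj_combinator[OF assms]]) (simp add: case_prod_unfold comp_def)
  then show ?thesis by (simp add: sum.cartesian_product)
qed

text \<open>The leftmost index is split off and the remaining sum is drawn into a linear map, so
  that nested sums arise. The map \<Phi> is arbitrary for the sake of the induction, where its role
  is taken over by \<open>X (Suc i) k\<close>.\<close>

lemma sum_rectangle_chain:
  fixes X :: "nat \<Rightarrow> nat \<Rightarrow> nat \<Rightarrow> 'a::real_normed_vector \<Rightarrow> 'a" and \<Phi> :: "nat \<Rightarrow> 'a \<Rightarrow> 'a"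
  assumes "m = i + Suc d" "\<And>l. l \<in> {Suc i..<m} \<Longrightarrow> block (X l) (C l)" "\<And>k. linear (\<Phi> k)"
  shows "(\<Sum>J\<in>(\<Pi>\<^sub>E l\<in>{i..m-1}. {..N l}).
      \<Phi> (J i) (foldr (\<circ>) (map (\<lambda>l. X l (J (l - 1)) (J l)) [Suc i..<m]) id (w (J (m - 1)))))
    = (\<Sum>k\<le>N i. \<Phi> k (tchain X m N w d k))"
  using assms
proof (induction d arbitrary: i \<Phi>)
  case 0
  then have "{i..m-1} = insert i {}" by auto
  then show ?case using 0 by (simp add: sum_PiE_insert del: insert_iff)
next
  case (Suc d)
  have ins: "{i..m-1} = insert i {Suc i..m-1}" and m: "[Suc i..<m] = Suc i # [Suc (Suc i)..<m]"
    using Suc.prems(1) by (auto simp: upt_rec)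
  have lin: "linear (X (Suc i) k k')" for k k'
    using Suc.prems(1) by (intro bounded_linear.linear[OF block_linear[OF Suc.prems(2)]]) auto
  let ?G = "\<lambda>J. foldr (\<circ>) (map (\<lambda>l. X l (J (l - 1)) (J l)) [Suc (Suc i)..<m]) id (w (J (m - 1)))"
  have "(\<Sum>J\<in>(\<Pi>\<^sub>E l\<in>{i..m-1}. {..N l}).
      \<Phi> (J i) (foldr (\<circ>) (map (\<lambda>l. X l (J (l - 1)) (J l)) [Suc i..<m]) id (w (J (m - 1)))))
    = (\<Sum>k\<le>N i. \<Sum>J\<in>(\<Pi>\<^sub>E l\<in>{Suc i..m-1}. {..N l}). \<Phi> k (X (Suc i) k (J (Suc i)) (?G J)))"
    unfolding ins
  proof (subst sum_PiE_insert, simp, intro sum.cong refl)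
    fix k J
    have "map (\<lambda>l. X l ((J(i := k)) (l - 1)) ((J(i := k)) l)) [Suc (Suc i)..<m]
        = map (\<lambda>l. X l (J (l - 1)) (J l)) [Suc (Suc i)..<m]"
      by (rule map_cong) auto
    then have "map (\<lambda>l. X l ((J(i := k)) (l - 1)) ((J(i := k)) l)) [Suc i..<m]
        = X (Suc i) k (J (Suc i)) # map (\<lambda>l. X l (J (l - 1)) (J l)) [Suc (Suc i)..<m]"
      unfolding m by simp
    moreover have "(J(i := k)) (m - 1) = J (m - 1)" using Suc.prems(1) by simp
    ultimately show "\<Phi> ((J(i := k)) i) (foldr (\<circ>) (map (\<lambda>l. X l ((J(i := k)) (l - 1)) ((J(i := k)) l)) [Suc i..<m]) id
          (w ((J(i := k)) (m - 1)))) = \<Phi> k (X (Suc i) k (J (Suc i)) (?G J))"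
      by (simp only: foldr_Cons o_apply fun_upd_same)
  qed
  also have "\<dots> = (\<Sum>k\<le>N i. \<Phi> k (\<Sum>J\<in>(\<Pi>\<^sub>E l\<in>{Suc i..m-1}. {..N l}). X (Suc i) k (J (Suc i)) (?G J)))"
    by (simp add: linear_sum[OF Suc.prems(3)])
  also have "\<dots> = (\<Sum>k\<le>N i. \<Phi> k (\<Sum>k'\<le>N (Suc i). X (Suc i) k k' (tchain X m N w d k')))"
  proof (intro sum.cong refl arg_cong[where f = "\<Phi> k" for k])
    fix k
    show "(\<Sum>J\<in>(\<Pi>\<^sub>E l\<in>{Suc i..m-1}. {..N l}). X (Suc i) k (J (Suc i)) (?G J))
        = (\<Sum>k'\<le>N (Suc i). X (Suc i) k k' (tchain X m N w d k'))"
      using Suc.prems lin by (intro Suc.IH) auto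
  qed
  also have "\<dots> = (\<Sum>k\<le>N i. \<Phi> k (tchain X m N w (Suc d) k))"
  proof -
    have "m - Suc d = Suc i" using Suc.prems(1) by simp
    moreover have "block (X (Suc i)) (C (Suc i))" using Suc.prems(1) by (intro Suc.prems(2)) auto
    ultimately show ?thesis by (simp add: bapp_trunc)
  qed
  finally show ?case .
qed

section \<open>Spectral measures and spectral integrals\<close>

lemma spectral_measure_projection:
  assumes "spectral_measure M E" "A \<in> sets M"
  shows "bounded_clinear (E A)" "E A (E A x) = E A x" "cinner (E A x) y = cinner x (E A y)"
proof -
  have P: "orthogonal_projection (E A)" using assms by (simp add: spectral_measure_def)
  then show "bounded_clinear (E A)" "cinner (E A x) y = cinner x (E A y)"
    by (simp_all add: orthogonal_projection_def)
  have "E A \<circ> E A = E A" using P by (simp add: orthogonal_projection_def)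
  from fun_cong[OF this, of x] show "E A (E A x) = E A x" by simp
qed

lemma spectral_measure_cinner:
  assumes "spectral_measure M E" "A \<in> sets M"
  shows "cinner (E A x) x = of_real ((norm (E A x))\<^sup>2)"
  using spectral_measure_projection[OF assms] by (metis cinner_self)

lemma spectral_measure_norm_le:
  assumes "spectral_measure M E" "A \<in> sets M"
  shows "norm (E A x) \<le> norm x"
proof (cases "E A x = 0")
  case False
  have "(norm (E A x))\<^sup>2 = cmod (cinner (E A x) x)"
    by (simp add: spectral_measure_cinner[OF assms] norm_power)
  also have "\<dots> \<le> norm (E A x) * norm x" by (rule cmod_cinner_le)
  finally show ?thesis using False by (simp add: power2_eq_square)
qed simp

lemma spectral_measure_empty:
  assumes "spectral_measure M E"
  shows "E {} h = 0"
proof -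
  have "(\<lambda>n::nat. E {} h) sums E (\<Union>n::nat. {}) h"
    using assms unfolding spectral_measure_def
    by (elim conjE allE[of _ "\<lambda>_. {}"]) (auto simp: disjoint_family_on_def)
  then show ?thesis using sums_summable summable_const_iff by blast
qed

lemma spectral_measure_Un:
  assumes E: "spectral_measure M E" and "A \<in> sets M" "B \<in> sets M" "A \<inter> B = {}"
  shows "E (A \<union> B) h = E A h + E B h"
proof -
  define F where "F n = (if n = 0 then A else if n = 1 then B else {})" for n :: nat
  have "range F \<subseteq> sets M" "disjoint_family F"
    using assms by (auto simp: F_def disjoint_family_on_def)
  then have "(\<lambda>n. E (F n) h) sums E (\<Union>n. F n) h"
    using E by (simp add: spectral_measure_def)
  moreover have "(\<Union>n. F n) = A \<union> B" by (auto simp: F_def split: if_splits intro: exI[of _ 0] exI[of _ 1])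
  moreover have "(\<lambda>n. E (F n) h) sums (\<Sum>n\<in>{0,1}. E (F n) h)"
    by (rule sums_finite) (auto simp: F_def spectral_measure_empty[OF E])
  moreover have "(\<Sum>n\<in>{0,1}. E (F n) h) = E A h + E B h" by (simp add: F_def)
  ultimately show ?thesis using sums_unique2 by metis
qed

text \<open>For \<open>z\<close> in the range of \<open>E B\<close>, additivity makes the squared
  norm of \<open>E (A \<union> B) z\<close> the sum of those of \<open>E A z\<close> and
  \<open>z\<close>; a projection does not increase the norm, so \<open>E A z\<close>
  vanishes.\<close>

lemma spectral_measure_orthogonal:
  assumes E: "spectral_measure M E" and A: "A \<in> sets M" and B: "B \<in> sets M" and "A \<inter> B = {}"
  shows "E A (E B x) = 0" "cinner (E A x) (E B y) = 0"
proof -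
  have *: "E A (E B x) = 0" for x
  proof -
    define z where "z = E B x"
    have z: "E B z = z" by (simp add: z_def spectral_measure_projection[OF E B])
    have AB: "A \<union> B \<in> sets M" using A B by simp
    have "E (A \<union> B) z = E A z + z" using spectral_measure_Un[OF assms, of z] z by simp
    then have "of_real ((norm (E (A \<union> B) z))\<^sup>2) = complex_of_real ((norm (E A z))\<^sup>2 + (norm z)\<^sup>2)"
      using spectral_measure_cinner[OF E AB, of z] spectral_measure_cinner[OF E A, of z] cinner_self[of z]
      by (simp add: cinner_add_left)
    then have "(norm (E (A \<union> B) z))\<^sup>2 = (norm (E A z))\<^sup>2 + (norm z)\<^sup>2" by (simp only: of_real_eq_iff)
    moreover have "(norm (E (A \<union> B) z))\<^sup>2 \<le> (norm z)\<^sup>2"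
      by (intro power_mono spectral_measure_norm_le[OF E AB]) simp
    ultimately have "(norm (E A z))\<^sup>2 \<le> 0" by linarith
    then show ?thesis by (simp add: z_def)
  qed
  show "E A (E B x) = 0" by (rule *)
  show "cinner (E A x) (E B y) = 0"
    using spectral_measure_projection(3)[OF E A, of x "E B y"] * by simp
qed

lemma spectral_measure_finite_Union:
  assumes E: "spectral_measure M E" and "finite P" "P \<subseteq> sets M" "disjoint P"
  shows "E (\<Union>P) h = (\<Sum>A\<in>P. E A h)"
  using assms(2-)
proof (induction P)
  case empty
  then show ?case by (simp add: spectral_measure_empty[OF E])
next
  case (insert A P)
  have "A \<inter> \<Union>P = {}" using insert by (auto simp: pairwise_def disjnt_def)
  moreover have "\<Union>P \<in> sets M" using insert by (intro sets.finite_Union) auto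
  ultimately show ?case using insert
    by (simp add: spectral_measure_Un[OF E] pairwise_insert)
qed

lemma power2_norm_sum_projections:
  assumes E: "spectral_measure M E" and "finite P" "P \<subseteq> sets M" "disjoint P"
  shows "(norm (\<Sum>A\<in>P. E A (f A)))\<^sup>2 = (\<Sum>A\<in>P. (norm (E A (f A)))\<^sup>2)"
proof (rule power2_norm_sum_orthogonal[OF assms(2)])
  fix A B assume "A \<in> P" "B \<in> P" "A \<noteq> B"
  then show "cinner (E A (f A)) (E B (f B)) = 0"
    using assms(3,4) by (intro spectral_measure_orthogonal[OF E]) (auto simp: pairwise_def disjnt_def)
qed

lemma scalar_measure_basics:
  fixes E :: "'x set \<Rightarrow> 'h \<Rightarrow> 'h::complex_hilbert_space"
  assumes E: "spectral_measure M E"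
  shows space_scalar_measure: "space (scalar_measure M E h) = space M"
    and sets_scalar_measure: "sets (scalar_measure M E h) = sets M"
    and emeasure_scalar_measure:
      "A \<in> sets M \<Longrightarrow> emeasure (scalar_measure M E h) A = ennreal ((norm (E A h))\<^sup>2)"
proof -
  define \<nu> where "\<nu> = (\<lambda>A. ennreal (Re (cinner (E A h) h)))"
  have eq: "\<nu> A = ennreal ((norm (E A h))\<^sup>2)" if "A \<in> sets M" for A
    by (simp add: \<nu>_def spectral_measure_cinner[OF E that])
  show "space (scalar_measure M E h) = space M" "sets (scalar_measure M E h) = sets M"
    by (simp_all add: scalar_measure_def space_measure_of_conv sets.space_closed)
  assume A: "A \<in> sets M"
  have "emeasure (scalar_measure M E h) A = \<nu> A"
  proof (rule emeasure_measure_of)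
    show "scalar_measure M E h = measure_of (space M) (sets M) \<nu>"
      by (simp add: scalar_measure_def \<nu>_def)
    show "positive (sets (scalar_measure M E h)) \<nu>"
      by (simp add: positive_def \<nu>_def spectral_measure_empty[OF E])
    show "countably_additive (sets (scalar_measure M E h)) \<nu>"
    proof (rule countably_additiveI)
      fix F :: "nat \<Rightarrow> 'x set"
      assume "range F \<subseteq> sets (scalar_measure M E h)" "disjoint_family F"
        "\<Union> (range F) \<in> sets (scalar_measure M E h)"
      then have F: "range F \<subseteq> sets M" "disjoint_family F"
        by (simp_all add: scalar_measure_def sets.space_closed)
      then have Fs: "(\<lambda>n. E (F n) h) sums E (\<Union>n. F n) h" using E by (simp add: spectral_measure_def)
      have "(\<lambda>n. Re (cinner (E (F n) h) h)) sums Re (cinner (E (\<Union>n. F n) h) h)"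
        by (intro bounded_linear.sums[OF bounded_linear_Re] bounded_linear.sums[OF bounded_linear_cinner_left Fs])
      moreover have "0 \<le> Re (cinner (E (F n) h) h)" for n
        using F(1) by (subst spectral_measure_cinner[OF E]) auto
      ultimately show "(\<Sum>n. \<nu> (F n)) = \<nu> (\<Union> (range F))"
        unfolding \<nu>_def by (intro suminf_ennreal_eq) auto
    qed
  qed (use A in \<open>auto simp: scalar_measure_def sets.space_closed dest: sets.sets_into_space\<close>)
  then show "emeasure (scalar_measure M E h) A = ennreal ((norm (E A h))\<^sup>2)" using eq[OF A] by simp
qed

lemma finite_measure_scalar_measure:
  assumes E: "spectral_measure M E"
  shows "finite_measure (scalar_measure M E h)"
  by (rule finite_measureI)
    (simp add: scalar_measure_basics[OF E])

lemma measure_scalar_measure: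
  assumes E: "spectral_measure M E" and A: "A \<in> sets M"
  shows "measure (scalar_measure M E h) A = (norm (E A h))\<^sup>2"
  by (simp add: measure_def emeasure_scalar_measure[OF assms])

lemma measurable_scalar_measure:
  "spectral_measure M E \<Longrightarrow> f \<in> borel_measurable M \<Longrightarrow> f \<in> borel_measurable (scalar_measure M E h)"
  by (subst measurable_cong_sets[OF sets_scalar_measure refl]) auto

section \<open>Sets of full spectral measure\<close>

definition carrier_set :: "'x measure \<Rightarrow> ('x set \<Rightarrow> 'h \<Rightarrow> 'h::complex_hilbert_space) \<Rightarrow> 'x set \<Rightarrow> bool" where
  "carrier_set M E G \<longleftrightarrow> G \<in> sets M \<and> (\<forall>h. E (space M - G) h = 0)"

lemma AE_spectral_iff_carrier: "AE_spectral M E P \<longleftrightarrow> (\<exists>G. carrier_set M E G \<and> (\<forall>x\<in>G. P x))"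
proof
  assume "AE_spectral M E P"
  then obtain N where N: "N \<in> sets M" "E N = (\<lambda>_. 0)" "\<forall>x\<in>space M - N. P x"
    by (auto simp: AE_spectral_def)
  then have "space M - (space M - N) = N" using sets.sets_into_space by blast
  then show "\<exists>G. carrier_set M E G \<and> (\<forall>x\<in>G. P x)"
    using N by (intro exI[of _ "space M - N"]) (auto simp: carrier_set_def)
next
  assume "\<exists>G. carrier_set M E G \<and> (\<forall>x\<in>G. P x)"
  then obtain G where G: "carrier_set M E G" "\<forall>x\<in>G. P x" by blast
  then have "space M - (space M - G) = G" using sets.sets_into_space by (auto simp: carrier_set_def)
  then show "AE_spectral M E P"
    using G unfolding AE_spectral_def carrier_set_def
    by (intro bexI[of _ "space M - G"]) auto
qed

lemma carrier_set_null:
  assumes E: "spectral_measure M E" and "carrier_set M E G"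
  shows "space M - G \<in> null_sets (scalar_measure M E h)"
  using assms(2) emeasure_scalar_measure[OF E, of "space M - G" h]
  by (auto simp: carrier_set_def null_sets_def sets_scalar_measure[OF E])

lemma carrier_set_AE:
  assumes E: "spectral_measure M E" and G: "carrier_set M E G"
  shows "AE x in scalar_measure M E h. x \<in> G"
  by (rule AE_I'[OF carrier_set_null[OF assms]]) (auto simp: space_scalar_measure[OF E])

text \<open>The scalar measures transfer the countable additivity of null sets: the measure of a set
  is the squared norm of its projection applied to \<open>h\<close>.\<close>

lemma carrier_set_INT:
  fixes G :: "nat \<Rightarrow> 'x set"
  assumes E: "spectral_measure M E" and G: "\<And>n. carrier_set M E (G n)"
  shows "carrier_set M E (\<Inter>n. G n)"
  unfolding carrier_set_def
proof (intro conjI allI)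
  show GM: "(\<Inter>n. G n) \<in> sets M" using G by (intro sets.countable_INT) (auto simp: carrier_set_def)
  fix h
  have "(\<Union>n. space M - G n) \<in> null_sets (scalar_measure M E h)"
    by (intro null_sets_UN carrier_set_null[OF E G])
  then have "space M - (\<Inter>n. G n) \<in> null_sets (scalar_measure M E h)" by simp
  then show "E (space M - (\<Inter>n. G n)) h = 0"
    using emeasure_scalar_measure[OF E, of "space M - (\<Inter>n. G n)" h] GM by (simp add: null_setsD1)
qed

section \<open>Spectral integrals as limits of step operators\<close>

lemma sum_indicator_partition:
  assumes "finite P" "disjoint P" "A \<in> P" "x \<in> A"
  shows "(\<Sum>B\<in>P. indicator B x *\<^sub>R c B) = (c A :: complex)"
proof -
  have "(\<Sum>B\<in>P. indicator B x *\<^sub>R c B) = (\<Sum>B\<in>P. if B = A then c A else 0)"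
    using assms by (intro sum.cong) (auto simp: indicator_def pairwise_def disjnt_def)
  then show ?thesis using assms by simp
qed

text \<open>The complex plane is cut into squares of side \<open>\<delta>/2\<close> and points of
  \<open>G\<close> are sorted by the squares in which the finitely many values lie. Boundedness
  leaves finitely many labels; real and imaginary parts each vary by at most half of \<delta> on a
  cell.\<close>

lemma oscillation_partition:
  fixes f :: "'i \<Rightarrow> 'x \<Rightarrow> complex"
  assumes I: "finite I" and f: "\<And>i. i \<in> I \<Longrightarrow> f i \<in> borel_measurable M" and G: "G \<in> sets M"
    and C: "\<And>i x. i \<in> I \<Longrightarrow> x \<in> G \<Longrightarrow> cmod (f i x) \<le> C i" and \<delta>: "0 < \<delta>"
  shows "\<exists>P. finite P \<and> P \<subseteq> sets M \<and> disjoint P \<and> \<Union>P = G \<and> {} \<notin> P \<and>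
    (\<forall>A\<in>P. \<forall>x\<in>A. \<forall>y\<in>A. \<forall>i\<in>I. cmod (f i x - f i y) \<le> \<delta>)"
proof -
  define q where "q x i = (\<lfloor>Re (f i x) / (\<delta>/2)\<rfloor>, \<lfloor>Im (f i x) / (\<delta>/2)\<rfloor>)" for x i
  define F where "F x = restrict (q x) I" for x
  define P where "P = (\<lambda>v. F -` {v} \<inter> G) ` F ` G"
  have fin: "finite (F ` G)"
  proof (rule finite_subset)
    define k where "k i = \<lceil>C i / (\<delta>/2)\<rceil> + 1" for i
    have range: "\<lfloor>r / (\<delta>/2)\<rfloor> \<in> {- k i..k i}" if "\<bar>r\<bar> \<le> C i" for r i
    proof -
      have fc: "\<lfloor>z\<rfloor> \<in> {- (\<lceil>c\<rceil> + 1)..\<lceil>c\<rceil> + 1}" if "\<bar>z\<bar> \<le> c" for z c :: real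
        using that unfolding atLeastAtMost_iff by linarith
      have "\<bar>r / (\<delta>/2)\<bar> = \<bar>r\<bar> / (\<delta>/2)" using \<delta> by (simp add: abs_divide)
      also have "\<dots> \<le> C i / (\<delta>/2)" using that \<delta> by (intro divide_right_mono) auto
      finally show ?thesis unfolding k_def by (rule fc)
    qed
    have "q x i \<in> {- k i..k i} \<times> {- k i..k i}" if "x \<in> G" "i \<in> I" for x i
      unfolding q_def using C[OF that(2,1)] abs_Re_le_cmod[of "f i x"] abs_Im_le_cmod[of "f i x"]
      by (intro SigmaI range) linarith+
    then show "F ` G \<subseteq> (\<Pi>\<^sub>E i\<in>I. {- k i..k i} \<times> {- k i..k i})" by (auto simp: F_def)
    show "finite (\<Pi>\<^sub>E i\<in>I. {- k i..k i} \<times> {- k i..k i})" using I by (intro finite_PiE) auto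
  qed
  have meas: "F -` {F x0} \<inter> G \<in> sets M" for x0
  proof -
    have "{x \<in> space M. \<forall>i\<in>I. real_of_int (fst (q x0 i)) \<le> Re (f i x) / (\<delta>/2) \<and>
        Re (f i x) / (\<delta>/2) < real_of_int (fst (q x0 i)) + 1 \<and>
        real_of_int (snd (q x0 i)) \<le> Im (f i x) / (\<delta>/2) \<and>
        Im (f i x) / (\<delta>/2) < real_of_int (snd (q x0 i)) + 1} \<in> sets M" (is "?S \<in> _")
    proof (rule sets.sets_Collect_finite_All[OF _ I])
      fix i assume "i \<in> I"
      have [measurable]: "f i \<in> borel_measurable M" by (rule f[OF \<open>i \<in> I\<close>])
      show "{x \<in> space M. real_of_int (fst (q x0 i)) \<le> Re (f i x) / (\<delta>/2) \<and>
        Re (f i x) / (\<delta>/2) < real_of_int (fst (q x0 i)) + 1 \<and>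
        real_of_int (snd (q x0 i)) \<le> Im (f i x) / (\<delta>/2) \<and>
        Im (f i x) / (\<delta>/2) < real_of_int (snd (q x0 i)) + 1} \<in> sets M"
        by measurable
    qed
    moreover have "F -` {F x0} \<inter> G = ?S \<inter> G"
    proof -
      have "F x = F x0 \<longleftrightarrow> (\<forall>i\<in>I. q x i = q x0 i)" for x
        by (auto simp: F_def fun_eq_iff restrict_def)
      then show ?thesis
        using sets.sets_into_space[OF G] by (auto simp: q_def prod_eq_iff floor_eq_iff)
    qed
    ultimately show ?thesis using G by auto
  qed
  have "cmod (f i x - f i y) \<le> \<delta>" if "F x = F y" "i \<in> I" for x y i
  proof -
    have "q x i = q y i" using that by (metis F_def restrict_apply')
    then have fl: "\<lfloor>Re (f i x) / (\<delta>/2)\<rfloor> = \<lfloor>Re (f i y) / (\<delta>/2)\<rfloor>" "\<lfloor>Im (f i x) / (\<delta>/2)\<rfloor> = \<lfloor>Im (f i y) / (\<delta>/2)\<rfloor>"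
      by (auto simp: q_def)
    have close: "\<bar>r - s\<bar> \<le> \<delta>/2" if "\<lfloor>r / (\<delta>/2)\<rfloor> = \<lfloor>s / (\<delta>/2)\<rfloor>" for r s :: real
    proof -
      have "\<bar>r / (\<delta>/2) - s / (\<delta>/2)\<bar> \<le> 1" using that by linarith
      then have "\<bar>r * 2 - s * 2\<bar> \<le> \<delta>"
        using \<delta> by (simp add: diff_divide_distrib[symmetric] abs_divide)
      then show ?thesis by linarith
    qed
    show ?thesis
      using close[OF fl(1)] close[OF fl(2)] cmod_le[of "f i x - f i y"] by simp
  qed
  then have "\<forall>A\<in>P. \<forall>x\<in>A. \<forall>y\<in>A. \<forall>i\<in>I. cmod (f i x - f i y) \<le> \<delta>" by (auto simp: P_def)
  moreover have "finite P" using fin by (simp add: P_def)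
  moreover have "P \<subseteq> sets M" using meas by (auto simp: P_def)
  moreover have "disjoint P" by (auto simp: P_def pairwise_def disjnt_def)
  moreover have "\<Union>P = G" "{} \<notin> P" by (auto simp: P_def)
  ultimately show ?thesis by blast
qed

definition step_operator :: "('x set \<Rightarrow> 'h \<Rightarrow> 'h::complex_hilbert_space) \<Rightarrow> 'x set set \<Rightarrow> ('x set \<Rightarrow> complex) \<Rightarrow> 'h \<Rightarrow> 'h" where
  "step_operator E P c x = (\<Sum>A\<in>P. c A *\<^sub>C E A x)"

lemma bounded_clinear_step_operator:
  assumes E: "spectral_measure M E" and P: "P \<subseteq> sets M"
  shows "bounded_clinear (step_operator E P c)"
  unfolding step_operator_def[abs_def]
  using P by (intro bounded_clinear_sum bounded_clinear_const_scaleC spectral_measure_projection[OF E]) auto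

lemma integrable_scalar_measure:
  fixes f :: "'x \<Rightarrow> complex"
  assumes E: "spectral_measure M E" and f: "f \<in> borel_measurable M"
    and G: "carrier_set M E G" and C: "\<And>x. x \<in> G \<Longrightarrow> cmod (f x) \<le> C"
  shows "integrable (scalar_measure M E h) f"
  by (rule finite_measure.integrable_const_bound[OF finite_measure_scalar_measure[OF E], of _ C])
    (use carrier_set_AE[OF E G, of h] C measurable_scalar_measure[OF E f] in auto)

text \<open>Both numbers are integrals against the scalar measure of \<open>h\<close>, of a step
  function and of \<open>f\<close>, which differ by at most \<delta> almost everywhere; the total
  mass is \<open>(norm h)\<^sup>2\<close>.\<close>

lemma step_operator_integral:
  fixes f :: "'x \<Rightarrow> complex"
  assumes E: "spectral_measure M E" and f: "f \<in> borel_measurable M"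
    and G: "carrier_set M E G" and C: "\<And>x. x \<in> G \<Longrightarrow> cmod (f x) \<le> C"
    and P: "finite P" "P \<subseteq> sets M" "disjoint P" "\<Union>P = G"
    and c: "\<And>A x. A \<in> P \<Longrightarrow> x \<in> A \<Longrightarrow> cmod (c A - f x) \<le> \<delta>" and \<delta>: "0 \<le> \<delta>"
  shows "cmod (cinner (step_operator E P c h) h - integral\<^sup>L (scalar_measure M E h) f) \<le> \<delta> * (norm h)\<^sup>2"
proof -
  let ?\<mu> = "scalar_measure M E h"
  interpret \<mu>: finite_measure ?\<mu> by (rule finite_measure_scalar_measure[OF E])
  define s where "s x = (\<Sum>A\<in>P. indicator A x *\<^sub>R c A)" for x
  have PM: "A \<in> sets ?\<mu>" if "A \<in> P" for A using P that by (auto simp: sets_scalar_measure[OF E])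
  have int: "has_bochner_integral ?\<mu> (\<lambda>x. indicator A x *\<^sub>R c A) (measure ?\<mu> A *\<^sub>R c A)" if "A \<in> P" for A
    by (rule has_bochner_integral_indicator[OF PM[OF that]]) (simp add: less_top[symmetric])
  have ints: "integrable ?\<mu> s" unfolding s_def by (intro Bochner_Integration.integrable_sum integrable.intros[OF int])
  have intf: "integrable ?\<mu> f" by (rule integrable_scalar_measure[OF E f G C])
  have "integral\<^sup>L ?\<mu> s = (\<Sum>A\<in>P. measure ?\<mu> A *\<^sub>R c A)"
    unfolding s_def by (intro has_bochner_integral_integral_eq has_bochner_integral_sum int)
  also have "\<dots> = cinner (step_operator E P c h) h"
    unfolding step_operator_def cinner_sum_left cinner_scaleC_left using P
    by (intro sum.cong refl) (auto simp: measure_scalar_measure[OF E] spectral_measure_cinner[OF E] subset_eq scaleR_conv_of_real mult.commute)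
  finally have "cinner (step_operator E P c h) h - integral\<^sup>L ?\<mu> f = (\<integral>x. s x - f x \<partial>?\<mu>)"
    using ints intf by simp
  also have "cmod \<dots> \<le> (\<integral>x. cmod (s x - f x) \<partial>?\<mu>)" by (rule integral_norm_bound)
  also have "\<dots> \<le> (\<integral>x. \<delta> \<partial>?\<mu>)"
  proof (rule integral_mono_AE)
    show "AE x in ?\<mu>. cmod (s x - f x) \<le> \<delta>"
      using carrier_set_AE[OF E G, of h]
    proof eventually_elim
      case (elim x)
      then obtain A where "A \<in> P" "x \<in> A" using P(4) by blast
      then show ?case using c sum_indicator_partition[OF P(1,3), of A x c] by (simp add: s_def)
    qed
  qed (use ints intf in auto)
  also have "\<dots> = \<delta> * (norm h)\<^sup>2"
    using E by (simp add: space_scalar_measure[OF E] measure_scalar_measure[OF E]) (simp add: spectral_measure_def)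
  finally show ?thesis .
qed

lemma tagged_partition:
  fixes f :: "'i \<Rightarrow> 'x \<Rightarrow> complex"
  assumes "finite I" "\<And>i. i \<in> I \<Longrightarrow> f i \<in> borel_measurable M" "G \<in> sets M"
    "\<And>i x. i \<in> I \<Longrightarrow> x \<in> G \<Longrightarrow> cmod (f i x) \<le> C i" "0 < \<delta>"
  obtains P t where "finite P" "P \<subseteq> sets M" "disjoint P" "\<Union>P = G" "\<And>A. A \<in> P \<Longrightarrow> t A \<in> A"
    "\<And>A x i. A \<in> P \<Longrightarrow> x \<in> A \<Longrightarrow> i \<in> I \<Longrightarrow> cmod (f i (t A) - f i x) \<le> \<delta>"
proof -
  have "\<exists>P. finite P \<and> P \<subseteq> sets M \<and> disjoint P \<and> \<Union>P = G \<and> {} \<notin> P \<and>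
    (\<forall>A\<in>P. \<forall>x\<in>A. \<forall>y\<in>A. \<forall>i\<in>I. cmod (f i x - f i y) \<le> \<delta>)"
    by (rule oscillation_partition) (fact assms)+
  then obtain P where P: "finite P" "P \<subseteq> sets M" "disjoint P" "\<Union>P = G" "{} \<notin> P"
    "\<forall>A\<in>P. \<forall>x\<in>A. \<forall>y\<in>A. \<forall>i\<in>I. cmod (f i x - f i y) \<le> \<delta>"
    by (elim exE conjE)
  have "\<forall>A\<in>P. \<exists>x. x \<in> A" using P(5) by (metis ex_in_conv)
  from bchoice[OF this] obtain t where t: "\<forall>A\<in>P. t A \<in> A" ..
  show ?thesis
  proof (rule that[OF P(1-4)])
    show "t A \<in> A" if "A \<in> P" for A by (rule bspec[OF t that])
    then show "cmod (f i (t A) - f i x) \<le> \<delta>" if "A \<in> P" "x \<in> A" "i \<in> I" for A x i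
      using P(6)[rule_format, OF that(1) _ that(2,3)] that(1) by simp
  qed
qed

lemma step_operators_tendsto:
  fixes f :: "'x \<Rightarrow> complex" and E :: "'x set \<Rightarrow> 'h \<Rightarrow> 'h::complex_hilbert_space"
  assumes B: "bounded_clinear B" and S: "\<And>n. bounded_clinear (S n)"
    and le: "\<And>n h. cmod (cinner (S n h) h - cinner (B h) h) \<le> 1 / Suc n * (norm h)\<^sup>2"
  shows "(\<lambda>n. S n x) \<longlonglongrightarrow> B x"
proof -
  have "norm (S n x - B x) \<le> 2 * (1 / Suc n) * norm x" for n
    by (rule norm_le_numerical_radius[of "\<lambda>x. S n x - B x"])
      (use le in \<open>auto intro: bounded_clinear_diff B S simp: cinner_diff_left\<close>)
  moreover have "(\<lambda>n. 2 * (1 / Suc n) * norm x) \<longlonglongrightarrow> 2 * 0 * norm x"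
    by (intro tendsto_intros LIMSEQ_Suc[OF lim_1_over_n])
  then have "(\<lambda>n. 2 * (1 / Suc n) * norm x) \<longlonglongrightarrow> 0" by simp
  ultimately have "(\<lambda>n. S n x - B x) \<longlonglongrightarrow> 0"
    by (rule Lim_null_comparison[OF always_eventually, OF allI])
  then show ?thesis by (simp add: LIM_zero_iff)
qed

text \<open>The quadratic forms of the step operators approximate the same integrals, hence each
  other; by polarization the operators are then uniformly Cauchy on bounded sets, and the pointwise
  limit has the prescribed form.\<close>

lemma spectral_integral_exists:
  fixes f :: "'x \<Rightarrow> complex" and E :: "'x set \<Rightarrow> 'h \<Rightarrow> 'h::complex_hilbert_space"
  assumes E: "spectral_measure M E" and f: "f \<in> borel_measurable M"
    and G: "carrier_set M E G" and C: "\<And>x. x \<in> G \<Longrightarrow> cmod (f x) \<le> C"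
  shows "\<exists>A. bounded_clinear A \<and> (\<forall>h. cinner (A h) h = integral\<^sup>L (scalar_measure M E h) f)"
proof -
  have "\<exists>S. bounded_clinear S \<and> (\<forall>h. cmod (cinner (S h) h - integral\<^sup>L (scalar_measure M E h) f)
      \<le> 1 / Suc n * (norm h)\<^sup>2)" for n
  proof -
    have GM: "G \<in> sets M" using G by (simp add: carrier_set_def)
    obtain P t where P: "finite P" "P \<subseteq> sets M" "disjoint P" "\<Union>P = G" "\<And>A. A \<in> P \<Longrightarrow> t A \<in> A"
      "\<And>A x i. A \<in> P \<Longrightarrow> x \<in> A \<Longrightarrow> i \<in> {()} \<Longrightarrow> cmod (f (t A) - f x) \<le> 1 / Suc n"
      using tagged_partition[of "{()}" "\<lambda>_. f" M G "\<lambda>_. C" "1 / Suc n"] f GM C by auto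
    show ?thesis
      by (intro exI[of _ "step_operator E P (\<lambda>A. f (t A))"] conjI allI
          bounded_clinear_step_operator[OF E P(2)] step_operator_integral[OF E f G C P(1-4)])
        (use P(6) in auto)
  qed
  then obtain S where S: "\<And>n. bounded_clinear (S n)" and
    le: "\<And>n h. cmod (cinner (S n h) h - integral\<^sup>L (scalar_measure M E h) f) \<le> 1 / Suc n * (norm h)\<^sup>2"
    by metis
  have diff: "norm (S n x - S k x) \<le> 2 * (1 / Suc n + 1 / Suc k) * norm x" for n k x
  proof (rule norm_le_numerical_radius[of "\<lambda>x. S n x - S k x"])
    fix h
    have "cmod (cinner (S n h - S k h) h)
        \<le> cmod (cinner (S n h) h - integral\<^sup>L (scalar_measure M E h) f)
          + cmod (cinner (S k h) h - integral\<^sup>L (scalar_measure M E h) f)"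
      unfolding cinner_diff_left by (rule order_trans[OF _ norm_triangle_ineq4]) simp
    then show "cmod (cinner (S n h - S k h) h) \<le> (1 / Suc n + 1 / Suc k) * (norm h)\<^sup>2"
      using le[of n h] le[of k h] by (simp only: distrib_right)
  qed (auto intro: bounded_clinear_diff S)
  have lim1: "(\<lambda>n. 1 / real (Suc n)) \<longlonglongrightarrow> 0" by (rule LIMSEQ_Suc[OF lim_1_over_n])
  have "Cauchy (\<lambda>n. S n x)" for x
  proof (rule CauchyI)
    fix e :: real assume "0 < e"
    have "(\<lambda>n. 4 * (1 / Suc n) * norm x) \<longlonglongrightarrow> 4 * 0 * norm x" by (intro tendsto_intros lim1)
    then have "eventually (\<lambda>n. 4 * (1 / Suc n) * norm x < e) sequentially"
      using \<open>0 < e\<close> by (intro order_tendstoD(2)) auto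
    then obtain K where K: "4 * (1 / Suc K) * norm x < e" by (auto simp: eventually_sequentially)
    have "norm (S n x - S k x) < e" if "n \<ge> K" "k \<ge> K" for n k
    proof -
      have "1 / real (Suc n) \<le> 1 / Suc K" "1 / real (Suc k) \<le> 1 / Suc K"
        using that by (auto simp: divide_simps)
      then have "2 * (1 / Suc n + 1 / Suc k) * norm x \<le> 4 * (1 / Suc K) * norm x"
        by (intro mult_right_mono) auto
      then show ?thesis using diff[of n x k] K by linarith
    qed
    then show "\<exists>M. \<forall>m\<ge>M. \<forall>n\<ge>M. norm (S m x - S n x) < e" by blast
  qed
  then have "\<exists>y. (\<lambda>n. S n x) \<longlonglongrightarrow> y" for x by (simp add: Cauchy_convergent_iff convergent_def)
  then obtain A where A: "\<And>x. (\<lambda>n. S n x) \<longlonglongrightarrow> A x" by metis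
  have "bounded_clinear A"
  proof (rule bounded_clinearI)
    show "A (x + y) = A x + A y" for x y
      by (rule LIMSEQ_unique[OF A]) (use tendsto_add[OF A A] in \<open>simp add: bounded_clinear_simps[OF S]\<close>)
    show "A (c *\<^sub>C x) = c *\<^sub>C A x" for c x
      by (rule LIMSEQ_unique[OF A])
        (use tendsto_scaleC[OF tendsto_const A] in \<open>simp add: bounded_clinear_simps[OF S]\<close>)
    \<comment> \<open>The constant 4 bounds \<open>2 * (1 / Suc n + 1 / Suc 0)\<close>, so the limit
      stays within distance \<open>4 * norm x\<close> of \<open>S 0 x\<close>.\<close>
    show "norm (A x) \<le> norm x * (onorm (S 0) + 4)" for x
    proof (rule LIMSEQ_le_const2[OF tendsto_norm[OF A]], intro exI allI impI)
      fix n
      have "norm (S n x) \<le> norm (S 0 x) + norm (S n x - S 0 x)" by (rule norm_triangle_sub)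
      also have "norm (S n x - S 0 x) \<le> 4 * norm x"
        by (rule order_trans[OF diff mult_right_mono]) (auto simp: divide_simps)
      finally show "norm (S n x) \<le> norm x * (onorm (S 0) + 4)"
        using onorm_clinear[OF S, of 0 x] by (simp add: algebra_simps)
    qed
  qed
  moreover have "cinner (A h) h = integral\<^sup>L (scalar_measure M E h) f" for h
  proof (rule LIMSEQ_unique)
    show "(\<lambda>n. cinner (S n h) h) \<longlonglongrightarrow> cinner (A h) h" by (intro tendsto_cinner A tendsto_const)
    have "(\<lambda>n. cinner (S n h) h - integral\<^sup>L (scalar_measure M E h) f) \<longlonglongrightarrow> 0"
      by (rule Lim_null_comparison[OF always_eventually, OF allI[OF le] tendsto_mult_left_zero[OF lim1]])
    then show "(\<lambda>n. cinner (S n h) h) \<longlonglongrightarrow> integral\<^sup>L (scalar_measure M E h) f"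
      by (simp add: LIM_zero_iff)
  qed
  ultimately show ?thesis by blast
qed

text \<open>Existence together with the determination of an operator by its quadratic form resolves
  the definite description in \<open>spectral_integral\<close>.\<close>

lemma spectral_integral_props:
  fixes f :: "'x \<Rightarrow> complex" and E :: "'x set \<Rightarrow> 'h \<Rightarrow> 'h::complex_hilbert_space"
  assumes "spectral_measure M E" "f \<in> borel_measurable M"
    "carrier_set M E G" "\<And>x. x \<in> G \<Longrightarrow> cmod (f x) \<le> C"
  shows bounded_clinear_spectral_integral: "bounded_clinear (spectral_integral M E f)"
    and cinner_spectral_integral:
      "cinner (spectral_integral M E f h) h = integral\<^sup>L (scalar_measure M E h) f"
proof -
  have "\<exists>!A. bounded_clinear A \<and> (\<forall>h. cinner (A h) h = integral\<^sup>L (scalar_measure M E h) f)"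
    using spectral_integral_exists[OF assms] by (auto intro: bounded_clinear_eqI)
  from theI'[OF this, folded spectral_integral_def]
  show "bounded_clinear (spectral_integral M E f)"
    "cinner (spectral_integral M E f h) h = integral\<^sup>L (scalar_measure M E h) f" by auto
qed

text \<open>The adjoint and the integral of the conjugate have the same quadratic form, hence
  coincide.\<close>

lemma spectral_integral_adjoint:
  fixes f :: "'x \<Rightarrow> complex" and E :: "'x set \<Rightarrow> 'h \<Rightarrow> 'h::complex_hilbert_space"
  assumes E: "spectral_measure M E" and f: "f \<in> borel_measurable M"
    and G: "carrier_set M E G" and C: "\<And>x. x \<in> G \<Longrightarrow> cmod (f x) \<le> C"
  shows "cinner (spectral_integral M E f x) y = cinner x (spectral_integral M E (\<lambda>x. cnj (f x)) y)"
proof -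
  have f': "(\<lambda>x. cnj (f x)) \<in> borel_measurable M"
    by (rule borel_measurable_continuous_onI[THEN measurable_compose[rotated], OF _ f]) (intro continuous_intros)
  have C': "cmod (cnj (f x)) \<le> C" if "x \<in> G" for x using C[OF that] by simp
  let ?A = "spectral_integral M E f"
  have A: "bounded_clinear ?A" by (rule spectral_integral_props[OF assms])
  have "cadjoint ?A = spectral_integral M E (\<lambda>x. cnj (f x))"
  proof (rule bounded_clinear_eqI)
    fix h
    have "cinner (cadjoint ?A h) h = cnj (cinner (?A h) h)"
      by (simp add: cinner_cadjoint[OF A] cinner_commute[symmetric])
    also have "\<dots> = integral\<^sup>L (scalar_measure M E h) (\<lambda>x. cnj (f x))"
      by (simp add: spectral_integral_props[OF assms])
    finally show "cinner (cadjoint ?A h) h = cinner (spectral_integral M E (\<lambda>x. cnj (f x)) h) h"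
      by (simp add: spectral_integral_props[OF E f' G C'])
  qed (rule bounded_clinear_cadjoint[OF A], rule spectral_integral_props(1)[OF E f' G C'])
  then show ?thesis using cinner_cadjoint[OF A, of x y] by simp
qed

section \<open>Block operators of spectral integrals\<close>

lemma block_power2:
  assumes "block X C"
  shows "(\<Sum>j<J. (norm (\<Sum>k<K. X j k (w k)))\<^sup>2) \<le> C\<^sup>2 * (\<Sum>k<K. (norm (w k))\<^sup>2)"
proof -
  have "L2_set (\<lambda>j. norm (\<Sum>k<K. X j k (w k))) {..<J} \<le> C * L2_set (\<lambda>k. norm (w k)) {..<K}"
    using assms by (simp add: block_def)
  then have "(L2_set (\<lambda>j. norm (\<Sum>k<K. X j k (w k))) {..<J})\<^sup>2 \<le> (C * L2_set (\<lambda>k. norm (w k)) {..<K})\<^sup>2"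
    by (rule power_mono) (simp add: L2_set_nonneg)
  then show ?thesis by (simp add: L2_set_def power_mult_distrib sum_nonneg)
qed

lemma blockI:
  assumes "0 \<le> C" "\<And>j k. bounded_linear (X j k)"
    "\<And>J K w. (\<Sum>j<J. (norm (\<Sum>k<K. X j k (w k)))\<^sup>2) \<le> C\<^sup>2 * (\<Sum>k<K. (norm (w k))\<^sup>2)"
  shows "block X C"
  unfolding block_def
proof (intro conjI allI assms(1,2))
  fix J K w
  have "sqrt (\<Sum>j<J. (norm (\<Sum>k<K. X j k (w k)))\<^sup>2) \<le> sqrt (C\<^sup>2 * (\<Sum>k<K. (norm (w k))\<^sup>2))"
    by (rule real_sqrt_le_mono[OF assms(3)])
  then show "L2_set (\<lambda>j. norm (\<Sum>k<K. X j k (w k))) {..<J} \<le> C * L2_set (\<lambda>k. norm (w k)) {..<K}"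
    using assms(1) by (simp add: L2_set_def real_sqrt_mult)
qed

lemma block_entry:
  assumes X: "block X C"
  shows "norm (X j k u) \<le> C * norm u"
proof -
  define w where "w i = (if i = k then u else 0)" for i
  have X0: "X j i 0 = 0" for i using linear_0[OF bounded_linear.linear[OF block_linear[OF X]]] .
  have 1: "(\<Sum>i<Suc k. X j i (w i)) = X j k u"
    by (subst sum.remove[of _ k]) (auto simp: w_def X0 intro!: sum.neutral)
  have 2: "(\<Sum>i<Suc k. (norm (w i))\<^sup>2) = (norm u)\<^sup>2"
    by (subst sum.remove[of _ k]) (auto simp: w_def intro!: sum.neutral)
  have "(norm (X j k u))\<^sup>2 \<le> (\<Sum>j<Suc j. (norm (\<Sum>i<Suc k. X j i (w i)))\<^sup>2)"
    unfolding 1[symmetric] by (rule member_le_sum[of j "{..<Suc j}" "\<lambda>j. (norm (\<Sum>i<Suc k. X j i (w i)))\<^sup>2"]) auto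
  also have "\<dots> \<le> C\<^sup>2 * (norm u)\<^sup>2" using block_power2[OF X, of w "Suc k" "Suc j"] by (simp only: 2)
  finally have "(norm (X j k u))\<^sup>2 \<le> (C * norm u)\<^sup>2" by (simp add: power_mult_distrib)
  then show ?thesis by (rule power2_le_imp_le) (use X in \<open>simp add: block_def\<close>)
qed

lemma block_compose:
  assumes X: "block X C" and T: "bounded_linear T"
  shows "block (\<lambda>j k. T \<circ> X j k) (onorm T * C)"
proof (rule blockI)
  show "0 \<le> onorm T * C" using X by (simp add: block_def onorm_pos_le T)
  show "bounded_linear (T \<circ> X j k)" for j k
    unfolding comp_def by (rule bounded_linear_compose[OF T block_linear[OF X]])
  fix J K w
  have "(\<Sum>j<J. (norm (\<Sum>k<K. (T \<circ> X j k) (w k)))\<^sup>2) \<le> (\<Sum>j<J. (onorm T)\<^sup>2 * (norm (\<Sum>k<K. X j k (w k)))\<^sup>2)"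
    unfolding power_mult_distrib[symmetric] o_apply linear_sum[OF bounded_linear.linear[OF T], symmetric]
    by (intro sum_mono power_mono onorm[OF T]) auto
  also have "\<dots> \<le> (onorm T)\<^sup>2 * (C\<^sup>2 * (\<Sum>k<K. (norm (w k))\<^sup>2))"
    unfolding sum_distrib_left[symmetric] by (intro mult_left_mono block_power2[OF X]) simp
  finally show "(\<Sum>j<J. (norm (\<Sum>k<K. (T \<circ> X j k) (w k)))\<^sup>2) \<le> (onorm T * C)\<^sup>2 * (\<Sum>k<K. (norm (w k))\<^sup>2)"
    by (simp add: power_mult_distrib mult.assoc)
qed

abbreviation scalar_block :: "(nat \<Rightarrow> nat \<Rightarrow> complex) \<Rightarrow> real \<Rightarrow> bool" where
  "scalar_block c C \<equiv> block (\<lambda>j k u. c j k * u) C"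

text \<open>Expand in an orthonormal basis of the span of the \<open>y k\<close>.\<close>

lemma scalar_block_vectors:
  fixes y :: "nat \<Rightarrow> 'h::complex_hilbert_space"
  assumes c: "scalar_block c C"
  shows "(\<Sum>j<J. (norm (\<Sum>k<K. c j k *\<^sub>C y k))\<^sup>2) \<le> C\<^sup>2 * (\<Sum>k<K. (norm (y k))\<^sup>2)"
proof -
  obtain U where U: "finite U" "orthonormal0 U (\<lambda>u. u)" "y ` {..<K} \<subseteq> complex_vector.span U"
    using gram_schmidt[of "y ` {..<K}"] by auto
  have parseval: "(norm v)\<^sup>2 = (\<Sum>u\<in>U. (cmod (cinner v u))\<^sup>2)" if "v \<in> complex_vector.span U" for v
    using orthonormal0_pythagoras[OF U(1,2), of v] orthonormal0_expand[OF U(1,2) that] by simp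
  have y: "y k \<in> complex_vector.span U" if "k < K" for k using U(3) that by auto
  have "(\<Sum>j<J. (norm (\<Sum>k<K. c j k *\<^sub>C y k))\<^sup>2)
      = (\<Sum>j<J. \<Sum>u\<in>U. (cmod (\<Sum>k<K. c j k * cinner (y k) u))\<^sup>2)"
    by (intro sum.cong refl, subst parseval)
      (auto intro!: complex_vector.span_sum complex_vector.span_scale y simp: cinner_sum_left cinner_scaleC_left)
  also have "\<dots> = (\<Sum>u\<in>U. \<Sum>j<J. (cmod (\<Sum>k<K. c j k * cinner (y k) u))\<^sup>2)" by (rule sum.swap)
  also have "\<dots> \<le> (\<Sum>u\<in>U. C\<^sup>2 * (\<Sum>k<K. (cmod (cinner (y k) u))\<^sup>2))"
    by (intro sum_mono block_power2[OF c])
  also have "\<dots> = C\<^sup>2 * (\<Sum>k<K. \<Sum>u\<in>U. (cmod (cinner (y k) u))\<^sup>2)"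
    unfolding sum_distrib_left[symmetric] by (subst sum.swap) simp
  also have "\<dots> = C\<^sup>2 * (\<Sum>k<K. (norm (y k))\<^sup>2)" using y by (simp add: parseval)
  finally show ?thesis .
qed

text \<open>The projections belonging to the cells split the squared norms on both sides into sums
  over cells, and on one cell only a fixed scalar matrix acts. The pieces are reassembled by the
  projection of the union, which is a contraction.\<close>

lemma block_step_operators:
  fixes E :: "'x set \<Rightarrow> 'h \<Rightarrow> 'h::complex_hilbert_space"
  assumes E: "spectral_measure M E" and P: "finite P" "P \<subseteq> sets M" "disjoint P"
    and c: "\<And>A. A \<in> P \<Longrightarrow> scalar_block (\<lambda>j k. c j k A) C"
  shows "(\<Sum>j<J. (norm (\<Sum>k<K. step_operator E P (c j k) (w k)))\<^sup>2) \<le> C\<^sup>2 * (\<Sum>k<K. (norm (w k))\<^sup>2)"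
proof -
  have lin: "bounded_clinear (E A)" if "A \<in> P" for A
    using spectral_measure_projection(1)[OF E] P(2) that by auto
  have "(\<Sum>k<K. step_operator E P (c j k) (w k)) = (\<Sum>A\<in>P. E A (\<Sum>k<K. c j k A *\<^sub>C w k))" for j
    unfolding step_operator_def
    by (subst sum.swap) (auto intro!: sum.cong simp: bounded_clinear_simps[OF lin])
  then have "(\<Sum>j<J. (norm (\<Sum>k<K. step_operator E P (c j k) (w k)))\<^sup>2)
      = (\<Sum>j<J. \<Sum>A\<in>P. (norm (E A (\<Sum>k<K. c j k A *\<^sub>C w k)))\<^sup>2)"
    by (simp add: power2_norm_sum_projections[OF E P])
  also have "\<dots> = (\<Sum>A\<in>P. \<Sum>j<J. (norm (\<Sum>k<K. c j k A *\<^sub>C E A (w k)))\<^sup>2)"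
    by (subst sum.swap) (auto intro!: sum.cong simp: bounded_clinear_simps[OF lin])
  also have "\<dots> \<le> (\<Sum>A\<in>P. C\<^sup>2 * (\<Sum>k<K. (norm (E A (w k)))\<^sup>2))"
    by (intro sum_mono scalar_block_vectors c)
  also have "\<dots> = C\<^sup>2 * (\<Sum>k<K. \<Sum>A\<in>P. (norm (E A (w k)))\<^sup>2)"
    unfolding sum_distrib_left[symmetric] by (subst sum.swap) simp
  also have "\<dots> = C\<^sup>2 * (\<Sum>k<K. (norm (E (\<Union>P) (w k)))\<^sup>2)"
    by (simp add: spectral_measure_finite_Union[OF E P] power2_norm_sum_projections[OF E P, of "\<lambda>_. w _"])
  also have "\<dots> \<le> C\<^sup>2 * (\<Sum>k<K. (norm (w k))\<^sup>2)"
    using P by (intro mult_left_mono sum_mono power_mono spectral_measure_norm_le[OF E] sets.finite_Union) auto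
  finally show ?thesis .
qed

text \<open>A finite section involves finitely many symbols, so a single partition approximates all
  its entries. The step values are taken at points of the cells, so the matrix on each cell is one
  of the given matrices and satisfies the bound with the same \<open>C\<close>; approximating
  entries separately would lose this.\<close>

lemma block_spectral_integral:
  fixes E :: "'x set \<Rightarrow> 'h \<Rightarrow> 'h::complex_hilbert_space"
  assumes E: "spectral_measure M E" and meas: "\<And>j k. \<alpha> j k \<in> borel_measurable M"
    and G: "carrier_set M E G" and b: "\<And>x. x \<in> G \<Longrightarrow> scalar_block (\<lambda>j k. \<alpha> j k x) C" and C: "0 \<le> C"
  shows "block (\<lambda>j k. spectral_integral M E (\<alpha> j k)) C"
proof (rule blockI[OF C])
  have le: "cmod (\<alpha> j k x) \<le> C" if "x \<in> G" for j k x
    using block_entry[OF b[OF that], of j k 1] by simp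
  have props: "bounded_clinear (spectral_integral M E (\<alpha> j k))"
    "cinner (spectral_integral M E (\<alpha> j k) h) h = integral\<^sup>L (scalar_measure M E h) (\<alpha> j k)" for j k h
    by (rule spectral_integral_props[OF E meas G le], assumption)+
  show "bounded_linear (spectral_integral M E (\<alpha> j k))" for j k
    by (rule bounded_clinear_linear[OF props(1)])
  fix J K :: nat and w :: "nat \<Rightarrow> 'h"
  have GM: "G \<in> sets M" using G by (simp add: carrier_set_def)
  \<comment> \<open>Collects what is needed of the approximation number \<open>n\<close>, so that
    the whole sequence of operator matrices is obtained by one choice.\<close>
  define Q where "Q n S \<longleftrightarrow> (\<forall>j k. bounded_clinear (S j k)) \<and>
      (\<forall>j<J. \<forall>k<K. \<forall>h. cmod (cinner (S j k h) h - cinner (spectral_integral M E (\<alpha> j k) h) h) \<le> 1 / Suc n * (norm h)\<^sup>2) \<and>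
      (\<Sum>j<J. (norm (\<Sum>k<K. S j k (w k)))\<^sup>2) \<le> C\<^sup>2 * (\<Sum>k<K. (norm (w k))\<^sup>2)" for n :: nat and S
  have "\<forall>n. \<exists>S. Q n S"
  proof
    fix n
    obtain P t where P: "finite P" "P \<subseteq> sets M" "disjoint P" "\<Union>P = G" and t: "\<And>A. A \<in> P \<Longrightarrow> t A \<in> A"
      and osc: "\<And>A x i. A \<in> P \<Longrightarrow> x \<in> A \<Longrightarrow> i \<in> {..<J} \<times> {..<K}
        \<Longrightarrow> cmod ((\<lambda>(j, k). \<alpha> j k) i (t A) - (\<lambda>(j, k). \<alpha> j k) i x) \<le> 1 / Suc n"
    proof (rule tagged_partition[where I = "{..<J} \<times> {..<K}" and f = "\<lambda>(j, k). \<alpha> j k" and M = M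
          and G = G and C = "\<lambda>_. C" and \<delta> = "1 / real (Suc n)"])
      show "cmod ((\<lambda>(j, k). \<alpha> j k) i x) \<le> C" if "x \<in> G" for i x
        using le[OF that] by (cases i) simp
      show "(\<lambda>(j, k). \<alpha> j k) i \<in> borel_measurable M" for i
        using meas by (cases i) simp
      show "finite ({..<J} \<times> {..<K})" "G \<in> sets M" "0 < 1 / real (Suc n)" using GM by simp_all
    qed (rule that)
    define S where "S j k = step_operator E P (\<lambda>A. \<alpha> j k (t A))" for j k
    have "bounded_clinear (S j k)" for j k
      unfolding S_def by (rule bounded_clinear_step_operator[OF E P(2)])
    moreover have "cmod (cinner (S j k h) h - cinner (spectral_integral M E (\<alpha> j k) h) h) \<le> 1 / Suc n * (norm h)\<^sup>2"
      if "j < J" "k < K" for j k h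
      unfolding S_def props(2)
      by (rule step_operator_integral[OF E meas G le P]) (use osc[of _ _ "(j, k)"] that in auto)
    moreover have "(\<Sum>j<J. (norm (\<Sum>k<K. S j k (w k)))\<^sup>2) \<le> C\<^sup>2 * (\<Sum>k<K. (norm (w k))\<^sup>2)"
      unfolding S_def by (rule block_step_operators[OF E P(1-3)]) (use t P(4) in \<open>auto intro!: b\<close>)
    ultimately have "Q n S" unfolding Q_def by blast
    then show "\<exists>S. Q n S" by (intro exI[of _ S])
  qed
  then obtain S where "\<forall>n. Q n (S n)" using choice by blast
  then have S: "\<And>n j k. bounded_clinear (S n j k)"
    "\<And>n j k h. j < J \<Longrightarrow> k < K \<Longrightarrow>
      cmod (cinner (S n j k h) h - cinner (spectral_integral M E (\<alpha> j k) h) h) \<le> 1 / Suc n * (norm h)\<^sup>2"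
    "\<And>n. (\<Sum>j<J. (norm (\<Sum>k<K. S n j k (w k)))\<^sup>2) \<le> C\<^sup>2 * (\<Sum>k<K. (norm (w k))\<^sup>2)"
    unfolding Q_def by blast+
  have lim: "(\<lambda>n. S n j k x) \<longlonglongrightarrow> spectral_integral M E (\<alpha> j k) x" if "j < J" "k < K" for j k x
    by (rule step_operators_tendsto[OF props(1) S(1) S(2)[OF that]])
  have "(\<lambda>n. \<Sum>j<J. (norm (\<Sum>k<K. S n j k (w k)))\<^sup>2)
      \<longlonglongrightarrow> (\<Sum>j<J. (norm (\<Sum>k<K. spectral_integral M E (\<alpha> j k) (w k)))\<^sup>2)"
    by (intro tendsto_sum tendsto_power tendsto_norm lim) auto
  then show "(\<Sum>j<J. (norm (\<Sum>k<K. spectral_integral M E (\<alpha> j k) (w k)))\<^sup>2) \<le> C\<^sup>2 * (\<Sum>k<K. (norm (w k))\<^sup>2)"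
    by (rule LIMSEQ_le_const2) (use S(3) in blast)
qed

section \<open>Coefficient matrices at a fixed point\<close>

lemma scalar_block_row:
  assumes u: "u \<in> ell2" "ell2_norm u \<le> C" and C: "0 \<le> C"
  shows "scalar_block (\<lambda>j k. if j = 0 then u k else 0) C"
proof (rule blockI[OF C bounded_linear_mult_right])
  fix J K :: nat and w :: "nat \<Rightarrow> complex"
  have "(\<Sum>k<K. (cmod (u k))\<^sup>2) \<le> (ell2_norm u)\<^sup>2"
    using u(1) suminf_nonneg[of "\<lambda>k. (cmod (u k))\<^sup>2"] by (auto simp: ell2_def ell2_norm_def intro: sum_le_suminf)
  also have "\<dots> \<le> C\<^sup>2" using u suminf_nonneg[of "\<lambda>k. (cmod (u k))\<^sup>2"] by (intro power_mono) (auto simp: ell2_def ell2_norm_def)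
  finally have uC: "(\<Sum>k<K. (cmod (u k))\<^sup>2) \<le> C\<^sup>2" .
  have "(cmod (\<Sum>k<K. u k * w k))\<^sup>2 \<le> (\<Sum>k<K. cmod (u k) * cmod (w k))\<^sup>2"
    by (intro power_mono order_trans[OF norm_sum]) (auto simp: norm_mult)
  also have "\<dots> \<le> (\<Sum>k<K. (cmod (u k))\<^sup>2) * (\<Sum>k<K. (cmod (w k))\<^sup>2)" by (rule Cauchy_Schwarz_ineq_sum)
  also have "\<dots> \<le> C\<^sup>2 * (\<Sum>k<K. (cmod (w k))\<^sup>2)" by (intro mult_right_mono uC sum_nonneg) simp
  finally have main: "(cmod (\<Sum>k<K. u k * w k))\<^sup>2 \<le> C\<^sup>2 * (\<Sum>k<K. (cmod (w k))\<^sup>2)" .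
  have "(\<Sum>j<J. (cmod (\<Sum>k<K. (if j = 0 then u k else 0) * w k))\<^sup>2)
      \<le> (\<Sum>j<Suc J. (cmod (\<Sum>k<K. (if j = 0 then u k else 0) * w k))\<^sup>2)" by simp
  also have "\<dots> = (cmod (\<Sum>k<K. u k * w k))\<^sup>2"
    by (subst sum.remove[of _ 0]) (auto intro!: sum.neutral)
  finally show "(\<Sum>j<J. (cmod (\<Sum>k<K. (if j = 0 then u k else 0) * w k))\<^sup>2) \<le> C\<^sup>2 * (\<Sum>k<K. (cmod (w k))\<^sup>2)"
    using main by linarith
qed

lemma scalar_block_column:
  assumes u: "u \<in> ell2" "ell2_norm u \<le> C" and C: "0 \<le> C"
  shows "scalar_block (\<lambda>j k. if k = 0 then u j else 0) C"
proof (rule blockI[OF C bounded_linear_mult_right])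
  fix J K :: nat and w :: "nat \<Rightarrow> complex"
  have "(\<Sum>k<J. (cmod (u k))\<^sup>2) \<le> (ell2_norm u)\<^sup>2"
    using u(1) suminf_nonneg[of "\<lambda>k. (cmod (u k))\<^sup>2"] by (auto simp: ell2_def ell2_norm_def intro: sum_le_suminf)
  also have "\<dots> \<le> C\<^sup>2" using u suminf_nonneg[of "\<lambda>k. (cmod (u k))\<^sup>2"] by (intro power_mono) (auto simp: ell2_def ell2_norm_def)
  finally have uC: "(\<Sum>j<J. (cmod (u j))\<^sup>2) \<le> C\<^sup>2" .
  show "(\<Sum>j<J. (cmod (\<Sum>k<K. (if k = 0 then u j else 0) * w k))\<^sup>2) \<le> C\<^sup>2 * (\<Sum>k<K. (cmod (w k))\<^sup>2)"
  proof (cases K)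
    case 0
    then show ?thesis by simp
  next
    case (Suc K')
    have "(\<Sum>k<K. (if k = 0 then u j else 0) * w k) = u j * w 0" for j
      unfolding Suc by (subst sum.remove[of _ 0]) (auto intro!: sum.neutral)
    then have "(\<Sum>j<J. (cmod (\<Sum>k<K. (if k = 0 then u j else 0) * w k))\<^sup>2) = (\<Sum>j<J. (cmod (u j))\<^sup>2) * (cmod (w 0))\<^sup>2"
      by (simp add: norm_mult power_mult_distrib sum_distrib_right)
    also have "\<dots> \<le> C\<^sup>2 * (cmod (w 0))\<^sup>2" by (intro mult_right_mono uC) simp
    also have "\<dots> \<le> C\<^sup>2 * (\<Sum>k<K. (cmod (w k))\<^sup>2)"
      unfolding Suc by (intro mult_left_mono member_le_sum) auto
    finally show ?thesis .
  qed
qed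

text \<open>A finite vector is extended by zeros to a sequence in \<open>ell2\<close>; cutting off
  the image does not increase its norm.\<close>

lemma scalar_block_matrix_bound:
  assumes a: "matrix_bound a C"
  shows "scalar_block a C"
proof (rule blockI)
  show C: "0 \<le> C" using a by (simp add: matrix_bound_def)
  fix J K :: nat and w :: "nat \<Rightarrow> complex"
  define u where "u k = (if k < K then w k else 0)" for k
  have "summable (\<lambda>k. (cmod (u k))\<^sup>2)"
    by (rule summable_finite[of "{..<K}"]) (auto simp: u_def)
  then have u: "u \<in> ell2" by (simp add: ell2_def)
  have nu: "(ell2_norm u)\<^sup>2 = (\<Sum>k<K. (cmod (w k))\<^sup>2)"
  proof -
    have "(\<Sum>k. (cmod (u k))\<^sup>2) = (\<Sum>k<K. (cmod (w k))\<^sup>2)"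
      by (subst suminf_finite[of "{..<K}"]) (auto simp: u_def)
    then show ?thesis by (simp add: ell2_norm_def sum_nonneg)
  qed
  have eq: "(\<Sum>k. a j k * u k) = (\<Sum>k<K. a j k * w k)" for j
    by (subst suminf_finite[of "{..<K}"]) (auto simp: u_def)
  have v: "(\<lambda>j. \<Sum>k<K. a j k * w k) \<in> ell2" "ell2_norm (\<lambda>j. \<Sum>k<K. a j k * w k) \<le> C * ell2_norm u"
    using a u unfolding matrix_bound_def eq[symmetric] by auto
  have sm: "summable (\<lambda>j. (cmod (\<Sum>k<K. a j k * w k))\<^sup>2)" using v(1) by (simp add: ell2_def)
  have "(\<Sum>j<J. (cmod (\<Sum>k<K. a j k * w k))\<^sup>2) \<le> (ell2_norm (\<lambda>j. \<Sum>k<K. a j k * w k))\<^sup>2"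
    using sm suminf_nonneg[OF sm] by (simp add: ell2_norm_def sum_le_suminf)
  also have "\<dots> \<le> (C * ell2_norm u)\<^sup>2"
    using v(2) suminf_nonneg[OF sm] by (intro power_mono) (auto simp: ell2_norm_def)
  finally show "(\<Sum>j<J. (cmod (\<Sum>k<K. a j k * w k))\<^sup>2) \<le> C\<^sup>2 * (\<Sum>k<K. (cmod (w k))\<^sup>2)"
    by (simp add: power_mult_distrib nu)
qed (rule bounded_linear_mult_right)

text \<open>\<open>matrix_norm\<close> is an infimum of admissible bounds, so the estimate is taken
  with bounds slightly above it and passed to the limit on each finite section.\<close>

lemma scalar_block_matrix_norm:
  assumes a: "a \<in> bounded_matrices" "matrix_norm a \<le> C" and C: "0 \<le> C"
  shows "scalar_block a C"
  unfolding block_def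
proof (intro conjI allI C bounded_linear_mult_right)
  fix J K :: nat and w :: "nat \<Rightarrow> complex"
  define L where "L = L2_set (\<lambda>k. cmod (w k)) {..<K}"
  show "L2_set (\<lambda>j. cmod (\<Sum>k<K. a j k * w k)) {..<J} \<le> C * L"
  proof (rule field_le_epsilon)
    fix e :: real assume e: "0 < e"
    \<comment> \<open>The added 1 makes \<open>d * L\<close> at most \<open>e\<close> also when
      \<open>L\<close> is 0.\<close>
    define d where "d = e / (L + 1)"
    have L: "0 \<le> L" by (simp add: L_def L2_set_nonneg)
    have d: "0 < d" using e L by (simp add: d_def)
    have ne: "{C. matrix_bound a C} \<noteq> {}" using a(1) by (auto simp: bounded_matrices_def)
    have "Inf {C. matrix_bound a C} < C + d" using a(2) d by (simp add: matrix_norm_def)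
    from cInf_lessD[OF ne this] obtain C' where C': "matrix_bound a C'" "C' < C + d" by auto
    have "L2_set (\<lambda>j. cmod (\<Sum>k<K. a j k * w k)) {..<J} \<le> C' * L"
      using scalar_block_matrix_bound[OF C'(1)] by (simp add: block_def L_def)
    also have "\<dots> \<le> (C + d) * L" using C'(2) L by (intro mult_right_mono) auto
    also have "\<dots> \<le> C * L + e"
    proof -
      have "d * L \<le> d * (L + 1)" using d by simp
      also have "\<dots> = e" using L by (simp add: d_def)
      finally show ?thesis by (simp add: algebra_simps)
    qed
    finally show "L2_set (\<lambda>j. cmod (\<Sum>k<K. a j k * w k)) {..<J} \<le> C * L + e" .
  qed
qed

text \<open>The infimum defining an essential supremum is attained: the bounds
  \<open>Inf S + 1 / Suc n\<close> hold on carrier sets whose countable intersection is again one.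
  Pointwise estimates can then use the norm itself as constant.\<close>

lemma AE_spectral_Inf_attained:
  fixes f :: "'x \<Rightarrow> real"
  assumes E: "spectral_measure M E" and ex: "\<exists>C. AE_spectral M E (\<lambda>x. Q x \<and> f x \<le> C)"
  defines "S \<equiv> {C. 0 \<le> C \<and> AE_spectral M E (\<lambda>x. Q x \<and> f x \<le> C)}"
  shows "0 \<le> Inf S" and "\<exists>G. carrier_set M E G \<and> (\<forall>x\<in>G. Q x \<and> f x \<le> Inf S)"
proof -
  obtain C where "AE_spectral M E (\<lambda>x. Q x \<and> f x \<le> C)" using ex by blast
  then have "AE_spectral M E (\<lambda>x. Q x \<and> f x \<le> max 0 C)"
    unfolding AE_spectral_iff_carrier by fastforce
  then have S: "S \<noteq> {}" unfolding S_def by (auto intro!: exI[of _ "max 0 C"])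
  show "0 \<le> Inf S" by (rule cInf_greatest[OF S]) (simp add: S_def)
  have "\<exists>G. carrier_set M E G \<and> (\<forall>x\<in>G. Q x \<and> f x \<le> Inf S + 1 / Suc n)" for n
  proof -
    obtain C where "C \<in> S" "C < Inf S + 1 / Suc n" using cInf_lessD[OF S, of "Inf S + 1 / Suc n"] by auto
    then show ?thesis unfolding S_def AE_spectral_iff_carrier by fastforce
  qed
  then obtain G where G: "\<And>n. carrier_set M E (G n)"
    "\<And>n x. x \<in> G n \<Longrightarrow> Q x \<and> f x \<le> Inf S + 1 / Suc n" by metis
  have "f x \<le> Inf S" if "x \<in> (\<Inter>n. G n)" for x
  proof -
    have "(\<lambda>n. Inf S + 1 / Suc n) \<longlonglongrightarrow> Inf S + 0" by (intro tendsto_intros LIMSEQ_Suc[OF lim_1_over_n])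
    then have "f x \<le> Inf S + 0"
      by (rule LIMSEQ_le_const) (use that G(2) in auto)
    then show ?thesis by simp
  qed
  moreover have "carrier_set M E (\<Inter>n. G n)" by (rule carrier_set_INT[OF E G(1)])
  ultimately show "\<exists>G. carrier_set M E G \<and> (\<forall>x\<in>G. Q x \<and> f x \<le> Inf S)"
    using G(2) by blast
qed

lemma Linf_ell2_carrier:
  assumes "spectral_measure M E" "\<alpha> \<in> Linf_ell2 M E"
  shows "0 \<le> Linf_ell2_norm M E \<alpha>"
    and "\<exists>G. carrier_set M E G \<and> (\<forall>x\<in>G. (\<lambda>j. \<alpha> j x) \<in> ell2 \<and> ell2_norm (\<lambda>j. \<alpha> j x) \<le> Linf_ell2_norm M E \<alpha>)"
  unfolding Linf_ell2_norm_def using assms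
  by (intro AE_spectral_Inf_attained; simp add: Linf_ell2_def)+

lemma Linf_matrix_carrier:
  assumes "spectral_measure M E" "\<alpha> \<in> Linf_matrix M E"
  shows "0 \<le> Linf_matrix_norm M E \<alpha>"
    and "\<exists>G. carrier_set M E G \<and> (\<forall>x\<in>G. scalar_block (\<lambda>j k. \<alpha> j k x) (Linf_matrix_norm M E \<alpha>))"
proof -
  have "0 \<le> Linf_matrix_norm M E \<alpha> \<and> (\<exists>G. carrier_set M E G \<and> (\<forall>x\<in>G. (\<lambda>j k. \<alpha> j k x) \<in> bounded_matrices \<and>
      matrix_norm (\<lambda>j k. \<alpha> j k x) \<le> Linf_matrix_norm M E \<alpha>))"
    unfolding Linf_matrix_norm_def using assms
    by (intro conjI AE_spectral_Inf_attained; simp add: Linf_matrix_def)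
  then show "0 \<le> Linf_matrix_norm M E \<alpha>"
    "\<exists>G. carrier_set M E G \<and> (\<forall>x\<in>G. scalar_block (\<lambda>j k. \<alpha> j k x) (Linf_matrix_norm M E \<alpha>))"
    using scalar_block_matrix_norm by blast+
qed

lemma column_bound_spectral:
  fixes E :: "'x set \<Rightarrow> 'h \<Rightarrow> 'h::complex_hilbert_space"
  assumes E: "spectral_measure M E" and meas: "\<And>j. \<alpha> j \<in> borel_measurable M"
    and G: "carrier_set M E G" "\<And>x. x \<in> G \<Longrightarrow> (\<lambda>j. \<alpha> j x) \<in> ell2 \<and> ell2_norm (\<lambda>j. \<alpha> j x) \<le> C" and C: "0 \<le> C"
  shows "column_bound (\<lambda>j. spectral_integral M E (\<alpha> j)) C"
proof -
  have "(\<lambda>x. if k = 0 then \<alpha> j x else 0) \<in> borel_measurable M" for j and k :: nat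
    using meas by (cases "k = 0") simp_all
  then have "block (\<lambda>j k. spectral_integral M E (\<lambda>x. if k = 0 then \<alpha> j x else 0)) C"
    using G(2) C by (intro block_spectral_integral[OF E _ G(1)] scalar_block_column) auto
  \<comment> \<open>With \<open>K = 1\<close> only the column with index 0 acts, and it acts on the
    single vector \<open>x\<close>.\<close>
  from block_power2[OF this, where K = 1 and w = "\<lambda>_. x" for x]
  show ?thesis using C by (simp add: column_bound_def)
qed

lemma Linf_ell2_operators:
  fixes E :: "'x set \<Rightarrow> 'h \<Rightarrow> 'h::complex_hilbert_space"
  assumes E: "spectral_measure M E" and \<alpha>: "\<alpha> \<in> Linf_ell2 M E"
  shows "bounded_clinear (spectral_integral M E (\<alpha> j))"
    and "block (\<lambda>j k. spectral_integral M E (\<lambda>x. if j = 0 then \<alpha> k x else 0)) (Linf_ell2_norm M E \<alpha>)"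
    and "column_pair (\<lambda>j. spectral_integral M E (\<alpha> j)) (\<lambda>j. spectral_integral M E (\<lambda>x. cnj (\<alpha> j x))) (Linf_ell2_norm M E \<alpha>)"
proof -
  define C where "C = Linf_ell2_norm M E \<alpha>"
  have C: "0 \<le> C" unfolding C_def by (rule Linf_ell2_carrier[OF assms])
  obtain G where G: "carrier_set M E G" "\<And>x. x \<in> G \<Longrightarrow> (\<lambda>j. \<alpha> j x) \<in> ell2 \<and> ell2_norm (\<lambda>j. \<alpha> j x) \<le> C"
    using Linf_ell2_carrier(2)[OF assms] by (auto simp: C_def)
  have meas: "\<alpha> j \<in> borel_measurable M" for j using \<alpha> by (simp add: Linf_ell2_def)
  have meas': "(\<lambda>x. cnj (\<alpha> j x)) \<in> borel_measurable M" for j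
    by (rule borel_measurable_continuous_onI[THEN measurable_compose[rotated], OF _ meas]) (intro continuous_intros)
  \<comment> \<open>Conjugation preserves the pointwise norm, so the adjoint operators satisfy the
    same column bound.\<close>
  have G': "(\<lambda>j. cnj (\<alpha> j x)) \<in> ell2 \<and> ell2_norm (\<lambda>j. cnj (\<alpha> j x)) \<le> C" if "x \<in> G" for x
    using G(2)[OF that] by (simp add: ell2_def ell2_norm_def)
  have le: "cmod (\<alpha> j x) \<le> C" if "x \<in> G" for j x
    using block_entry[OF scalar_block_row[OF _ _ C], of "\<lambda>j. \<alpha> j x" 0 j 1] G(2)[OF that] by simp
  show "bounded_clinear (spectral_integral M E (\<alpha> j))" by (rule spectral_integral_props(1)[OF E meas G(1) le])
  show "block (\<lambda>j k. spectral_integral M E (\<lambda>x. if j = 0 then \<alpha> k x else 0)) (Linf_ell2_norm M E \<alpha>)"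
  proof -
    have "(\<lambda>x. if j = 0 then \<alpha> k x else 0) \<in> borel_measurable M" for k and j :: nat
      using meas by (cases "j = 0") simp_all
    then show ?thesis unfolding C_def[symmetric] using G(2) C
      by (intro block_spectral_integral[OF E _ G(1)] scalar_block_row) auto
  qed
  show "column_pair (\<lambda>j. spectral_integral M E (\<alpha> j)) (\<lambda>j. spectral_integral M E (\<lambda>x. cnj (\<alpha> j x))) (Linf_ell2_norm M E \<alpha>)"
    unfolding column_pair_def C_def[symmetric]
    using column_bound_spectral[OF E meas G C] column_bound_spectral[OF E meas' G(1) G' C]
      spectral_integral_adjoint[OF E meas G(1) le] by blast
qed

lemma column_pair_sym: "column_pair A D C \<Longrightarrow> column_pair D A C"
  unfolding column_pair_def by (metis cinner_commute)

lemma Linf_matrix_operators: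
  fixes E :: "'x set \<Rightarrow> 'h \<Rightarrow> 'h::complex_hilbert_space"
  assumes E: "spectral_measure M E" and \<alpha>: "\<alpha> \<in> Linf_matrix M E"
  shows "bounded_clinear (spectral_integral M E (\<alpha> j k))"
    and "block (\<lambda>j k. spectral_integral M E (\<alpha> j k)) (Linf_matrix_norm M E \<alpha>)"
proof -
  obtain G where G: "carrier_set M E G" "\<And>x. x \<in> G \<Longrightarrow> scalar_block (\<lambda>j k. \<alpha> j k x) (Linf_matrix_norm M E \<alpha>)"
    using Linf_matrix_carrier(2)[OF assms] by auto
  have meas: "\<alpha> j k \<in> borel_measurable M" for j k using \<alpha> by (simp add: Linf_matrix_def)
  show "block (\<lambda>j k. spectral_integral M E (\<alpha> j k)) (Linf_matrix_norm M E \<alpha>)"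
    by (rule block_spectral_integral[OF E meas G Linf_matrix_carrier(1)[OF assms]])
  have "cmod (\<alpha> j k x) \<le> Linf_matrix_norm M E \<alpha>" if "x \<in> G" for x
    using block_entry[OF G(2)[OF that], of j k 1] by simp
  then show "bounded_clinear (spectral_integral M E (\<alpha> j k))"
    by (rule spectral_integral_props(1)[OF E meas G(1)])
qed

section \<open>Convergence of the operator series\<close>

lemma filterlim_rect_limit_component:
  "i \<in> {1..m-1} \<Longrightarrow> filterlim (\<lambda>N. N i) sequentially (rect_limit m)"
  unfolding filterlim_iff_le_filtercomap rect_limit_def by (rule INF_lower)

text \<open>Equal upper limits are one particular way of letting all of them tend to infinity; along
  it a limit over rectangles becomes a limit of a sequence, to which uniqueness of limits and
  dominated convergence apply.\<close>

lemma filterlim_rect_limit_diagonal: "filterlim (\<lambda>n _. n) (rect_limit m) sequentially"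
  unfolding rect_limit_def filterlim_INF filterlim_filtercomap_iff
  by (simp add: comp_def filterlim_ident)

text \<open>The part of a representation that does not mention \<open>\<Psi>\<close>: convergence of
  the operator series and its estimates depend on the coefficients alone.\<close>

definition haagerup_coeffs ::
    "nat \<Rightarrow> (nat \<Rightarrow> 'x measure) \<Rightarrow> (nat \<Rightarrow> 'x set \<Rightarrow> 'h \<Rightarrow> 'h::complex_hilbert_space)
      \<Rightarrow> (nat \<Rightarrow> 'x \<Rightarrow> complex) \<Rightarrow> (nat \<Rightarrow> nat \<Rightarrow> nat \<Rightarrow> 'x \<Rightarrow> complex) \<Rightarrow> (nat \<Rightarrow> 'x \<Rightarrow> complex) \<Rightarrow> bool" where
  "haagerup_coeffs m M E a b c \<longleftrightarrow> 3 \<le> m \<and> (\<forall>i\<in>{1..m}. spectral_measure (M i) (E i)) \<and>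
     a \<in> Linf_ell2 (M 1) (E 1) \<and> (\<forall>i\<in>{2..m-1}. b i \<in> Linf_matrix (M i) (E i)) \<and>
     c \<in> Linf_ell2 (M m) (E m)"

text \<open>The operators are grouped as \<open>A\<^sub>1 (T\<^sub>1 A\<^sub>2) (T\<^sub>2 A\<^sub>3) \<dots> (T\<^sub>m\<^sub>-\<^sub>2 A\<^sub>m\<^sub>-\<^sub>1) (T\<^sub>m\<^sub>-\<^sub>1 A\<^sub>m)\<close>; the row \<open>A\<^sub>1\<close> is
  padded to a matrix.\<close>

definition moi_block ::
    "(nat \<Rightarrow> 'x measure) \<Rightarrow> (nat \<Rightarrow> 'x set \<Rightarrow> 'h \<Rightarrow> 'h::complex_hilbert_space)
      \<Rightarrow> (nat \<Rightarrow> 'x \<Rightarrow> complex) \<Rightarrow> (nat \<Rightarrow> nat \<Rightarrow> nat \<Rightarrow> 'x \<Rightarrow> complex) \<Rightarrow> (nat \<Rightarrow> 'h \<Rightarrow> 'h)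
      \<Rightarrow> nat \<Rightarrow> nat \<Rightarrow> nat \<Rightarrow> 'h \<Rightarrow> 'h" where
  "moi_block M E a b T i j k =
     (if i = 1 then spectral_integral (M 1) (E 1) (\<lambda>x. if j = 0 then a k x else 0)
      else T (i - 1) \<circ> spectral_integral (M i) (E i) (b i j k))"

definition moi_base ::
    "nat \<Rightarrow> (nat \<Rightarrow> 'x measure) \<Rightarrow> (nat \<Rightarrow> 'x set \<Rightarrow> 'h \<Rightarrow> 'h::complex_hilbert_space)
      \<Rightarrow> (nat \<Rightarrow> 'x \<Rightarrow> complex) \<Rightarrow> (nat \<Rightarrow> 'h \<Rightarrow> 'h) \<Rightarrow> 'h \<Rightarrow> nat \<Rightarrow> 'h" where
  "moi_base m M E c T g j = T (m - 1) (spectral_integral (M m) (E m) (c j) g)"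

text \<open>The candidate for the sum of the series. The row of the first coefficients sits in row 0
  of the padded first block, so entry 0 of the result is read off.\<close>

definition moi_operator ::
    "nat \<Rightarrow> (nat \<Rightarrow> 'x measure) \<Rightarrow> (nat \<Rightarrow> 'x set \<Rightarrow> 'h \<Rightarrow> 'h::complex_hilbert_space)
      \<Rightarrow> (nat \<Rightarrow> 'x \<Rightarrow> complex) \<Rightarrow> (nat \<Rightarrow> nat \<Rightarrow> nat \<Rightarrow> 'x \<Rightarrow> complex) \<Rightarrow> (nat \<Rightarrow> 'x \<Rightarrow> complex)
      \<Rightarrow> (nat \<Rightarrow> 'h \<Rightarrow> 'h) \<Rightarrow> 'h \<Rightarrow> 'h" where
  "moi_operator m M E a b c T g = chain (moi_block M E a b T) m (moi_base m M E c T g) (m - 1) 0"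

definition moi_const ::
    "(nat \<Rightarrow> 'x measure) \<Rightarrow> (nat \<Rightarrow> 'x set \<Rightarrow> 'h \<Rightarrow> 'h::complex_hilbert_space)
      \<Rightarrow> (nat \<Rightarrow> 'x \<Rightarrow> complex) \<Rightarrow> (nat \<Rightarrow> nat \<Rightarrow> nat \<Rightarrow> 'x \<Rightarrow> complex) \<Rightarrow> (nat \<Rightarrow> 'h \<Rightarrow> 'h) \<Rightarrow> nat \<Rightarrow> real" where
  "moi_const M E a b T i = (if i = 1 then Linf_ell2_norm (M 1) (E 1) a
     else onorm (T (i - 1)) * Linf_matrix_norm (M i) (E i) (b i))"

lemma haagerup_coeffs_operators:
  assumes H: "haagerup_coeffs m M E a b c"
  shows "bounded_clinear (spectral_integral (M 1) (E 1) (a k))"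
    and "i \<in> {2..m-1} \<Longrightarrow> bounded_clinear (spectral_integral (M i) (E i) (b i j k))"
    and "bounded_clinear (spectral_integral (M m) (E m) (c k))"
proof -
  have m: "3 \<le> m" using H by (simp add: haagerup_coeffs_def)
  show "bounded_clinear (spectral_integral (M 1) (E 1) (a k))"
    by (rule Linf_ell2_operators(1)) (use H m in \<open>auto simp: haagerup_coeffs_def\<close>)
  show "bounded_clinear (spectral_integral (M m) (E m) (c k))"
    by (rule Linf_ell2_operators(1)) (use H m in \<open>auto simp: haagerup_coeffs_def\<close>)
  show "bounded_clinear (spectral_integral (M i) (E i) (b i j k))" if "i \<in> {2..m-1}"
    by (rule Linf_matrix_operators(1)) (use H m that in \<open>auto simp: haagerup_coeffs_def\<close>)
qed

lemma haagerup_coeffs_column_pairs: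
  assumes H: "haagerup_coeffs m M E a b c"
  shows "column_pair (\<lambda>j. spectral_integral (M 1) (E 1) (a j))
      (\<lambda>j. spectral_integral (M 1) (E 1) (\<lambda>x. cnj (a j x))) (Linf_ell2_norm (M 1) (E 1) a)"
    and "column_pair (\<lambda>j. spectral_integral (M m) (E m) (c j))
      (\<lambda>j. spectral_integral (M m) (E m) (\<lambda>x. cnj (c j x))) (Linf_ell2_norm (M m) (E m) c)"
  using H by (auto simp: haagerup_coeffs_def intro!: Linf_ell2_operators(3))

lemma block_moi_block:
  assumes H: "haagerup_coeffs m M E a b c" and T: "\<forall>i\<in>{1..m-1}. bounded_clinear (T i)"
    and i: "i \<in> {1..<m}"
  shows "block (moi_block M E a b T i) (moi_const M E a b T i)"
proof (cases "i = 1")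
  case True
  have "block (\<lambda>j k. spectral_integral (M 1) (E 1) (\<lambda>x. if j = 0 then a k x else 0)) (Linf_ell2_norm (M 1) (E 1) a)"
    using H by (intro Linf_ell2_operators(2)) (auto simp: haagerup_coeffs_def)
  then show ?thesis by (simp add: True moi_block_def[abs_def] moi_const_def)
next
  case False
  then have "block (\<lambda>j k. T (i - 1) \<circ> spectral_integral (M i) (E i) (b i j k)) (onorm (T (i - 1)) * Linf_matrix_norm (M i) (E i) (b i))"
    using H i by (intro block_compose Linf_matrix_operators(2) bounded_clinear_linear bspec[OF T])
      (auto simp: haagerup_coeffs_def)
  moreover have "moi_block M E a b T i = (\<lambda>j k. T (i - 1) \<circ> spectral_integral (M i) (E i) (b i j k))"
    using False by (simp add: moi_block_def fun_eq_iff)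
  ultimately show ?thesis using False by (simp add: moi_const_def)
qed

lemma l2s_moi_base:
  assumes H: "haagerup_coeffs m M E a b c" and T: "bounded_clinear (T (m - 1))"
  shows "l2s (moi_base m M E c T g)"
    and "l2n (moi_base m M E c T g) = column_norm (T (m - 1)) (\<lambda>j. spectral_integral (M m) (E m) (c j)) g"
    and "l2n (moi_base m M E c T g) \<le> onorm (T (m - 1)) * Linf_ell2_norm (M m) (E m) c * norm g"
proof -
  have A: "column_bound (\<lambda>j. spectral_integral (M m) (E m) (c j)) (Linf_ell2_norm (M m) (E m) c)"
    using haagerup_coeffs_column_pairs(2)[OF H] by (simp add: column_pair_def)
  show "l2s (moi_base m M E c T g)"
    unfolding l2s_def moi_base_def by (rule column_norm_summable[OF T A])
  show eq: "l2n (moi_base m M E c T g) = column_norm (T (m - 1)) (\<lambda>j. spectral_integral (M m) (E m) (c j)) g"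
    by (simp add: l2n_def column_norm_def moi_base_def)
  show "l2n (moi_base m M E c T g) \<le> onorm (T (m - 1)) * Linf_ell2_norm (M m) (E m) c * norm g"
    unfolding eq by (rule column_norm_le[OF T A])
qed

lemma foldr_comp_append: "foldr (\<circ>) (xs @ ys) id = foldr (\<circ>) xs id \<circ> foldr (\<circ>) ys id"
  by (induction xs) (auto simp: comp_assoc)

text \<open>Shifting the brackets attaches each \<open>T (i - 1)\<close> to the block on its right
  and leaves the last operator over, which becomes part of the initial sequence
  \<open>moi_base\<close>.\<close>

lemma foldr_comp_regroup:
  assumes "2 \<le> m"
  shows "T 1 \<circ> foldr (\<circ>) (map (\<lambda>i. A i \<circ> T i) [2..<m]) id
    = foldr (\<circ>) (map (\<lambda>i. T (i - 1) \<circ> A i) [2..<m]) id \<circ> T (m - 1)"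
  using assms
proof (induction m rule: dec_induct)
  case (step n)
  have "T 1 \<circ> foldr (\<circ>) (map (\<lambda>i. A i \<circ> T i) [2..<Suc n]) id
      = (T 1 \<circ> foldr (\<circ>) (map (\<lambda>i. A i \<circ> T i) [2..<n]) id) \<circ> (A n \<circ> T n)"
    using step(1) by (simp add: foldr_comp_append comp_assoc del: foldr_append)
  also have "\<dots> = foldr (\<circ>) (map (\<lambda>i. T (i - 1) \<circ> A i) [2..<Suc n]) id \<circ> T (Suc n - 1)"
    unfolding step.IH using step(1) by (simp add: foldr_comp_append comp_assoc del: foldr_append)
  finally show ?case .
qed simp

lemma bounded_clinear_foldr:
  "(\<And>f. f \<in> set fs \<Longrightarrow> bounded_clinear f) \<Longrightarrow> bounded_clinear (foldr (\<circ>) fs id)"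
  by (induction fs) (auto intro: bounded_clinear_comp)

lemma bounded_clinear_moi_term:
  assumes H: "haagerup_coeffs m M E a b c" and T: "\<forall>i\<in>{1..m-1}. bounded_clinear (T i)"
  shows "bounded_clinear (moi_term m M E a b c T J)"
proof -
  have m: "3 \<le> m" using H by (simp add: haagerup_coeffs_def)
  show ?thesis
    unfolding moi_term_def
    by (intro bounded_clinear_comp bounded_clinear_foldr haagerup_coeffs_operators(1,3)[OF H] bspec[OF T])
      (use m in \<open>auto intro!: bounded_clinear_comp haagerup_coeffs_operators(2)[OF H] bspec[OF T]\<close>)
qed

lemma moi_term_apply:
  assumes "3 \<le> m"
  shows "moi_term m M E a b c T J g = spectral_integral (M 1) (E 1) (a (J 1))
    (foldr (\<circ>) (map (\<lambda>i. moi_block M E a b T i (J (i - 1)) (J i)) [Suc 1..<m]) id (moi_base m M E c T g (J (m - 1))))"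
proof -
  have "map (\<lambda>i. moi_block M E a b T i (J (i - 1)) (J i)) [Suc 1..<m]
      = map (\<lambda>i. T (i - 1) \<circ> spectral_integral (M i) (E i) (b i (J (i - 1)) (J i))) [2..<m]"
    by (rule map_cong) (auto simp: moi_block_def numeral_2_eq_2)
  moreover have "moi_term m M E a b c T J = spectral_integral (M 1) (E 1) (a (J 1))
      \<circ> (T 1 \<circ> foldr (\<circ>) (map (\<lambda>i. spectral_integral (M i) (E i) (b i (J (i - 1)) (J i)) \<circ> T i) [2..<m]) id)
      \<circ> spectral_integral (M m) (E m) (c (J (m - 1)))"
    by (simp add: moi_term_def comp_assoc)
  ultimately show ?thesis
    using assms foldr_comp_regroup[of m T "\<lambda>i. spectral_integral (M i) (E i) (b i (J (i - 1)) (J i))"]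
    by (simp add: moi_base_def)
qed

text \<open>The second form, with the first row as a block, serves convergence; the first form keeps
  the sum over the first index visible, as required for the estimate by Cauchy-Schwarz.\<close>

lemma sum_moi_terms:
  assumes H: "haagerup_coeffs m M E a b c" and T: "\<forall>i\<in>{1..m-1}. bounded_clinear (T i)"
  shows "(\<Sum>J\<in>rectangle m N. moi_term m M E a b c T J g)
      = (\<Sum>k\<le>N 1. spectral_integral (M 1) (E 1) (a k) (tchain (moi_block M E a b T) m N (moi_base m M E c T g) (m - 2) k))"
    and "(\<Sum>J\<in>rectangle m N. moi_term m M E a b c T J g)
      = tchain (moi_block M E a b T) m N (moi_base m M E c T g) (m - 1) 0"
proof -
  have m: "3 \<le> m" using H by (simp add: haagerup_coeffs_def)
  show 1: "(\<Sum>J\<in>rectangle m N. moi_term m M E a b c T J g)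
      = (\<Sum>k\<le>N 1. spectral_integral (M 1) (E 1) (a k) (tchain (moi_block M E a b T) m N (moi_base m M E c T g) (m - 2) k))"
    unfolding rectangle_def moi_term_apply[OF m]
    by (rule sum_rectangle_chain[where C = "moi_const M E a b T"])
      (use m block_moi_block[OF H T] haagerup_coeffs_operators(1)[OF H] in
        \<open>auto intro: bounded_linear.linear[OF bounded_clinear_linear]\<close>)
  have "m - 1 = Suc (m - 2)" "m - Suc (m - 2) = 1" using m by auto
  moreover have "block (moi_block M E a b T 1) (moi_const M E a b T 1)"
    using m by (intro block_moi_block[OF H T]) auto
  ultimately show "(\<Sum>J\<in>rectangle m N. moi_term m M E a b c T J g)
      = tchain (moi_block M E a b T) m N (moi_base m M E c T g) (m - 1) 0"
    unfolding 1 by (simp add: bapp_trunc moi_block_def)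
qed

lemma sum_moi_terms_tendsto:
  assumes H: "haagerup_coeffs m M E a b c" and T: "\<forall>i\<in>{1..m-1}. bounded_clinear (T i)"
  shows "((\<lambda>N. \<Sum>J\<in>rectangle m N. moi_term m M E a b c T J g) \<longlongrightarrow> moi_operator m M E a b c T g) (rect_limit m)"
proof -
  have m: "3 \<le> m" using H by (simp add: haagerup_coeffs_def)
  let ?X = "moi_block M E a b T" and ?w = "moi_base m M E c T g"
  have base: "l2s ?w" using m by (intro l2s_moi_base(1)[OF H] bspec[OF T]) auto
  have X: "block (?X i) (moi_const M E a b T i)" if "i \<in> {m - (m - 1)..<m}" for i
    using that by (intro block_moi_block[OF H T]) auto
  have lim: "((\<lambda>N. l2n (\<lambda>j. tchain ?X m N ?w (m - 1) j - chain ?X m ?w (m - 1) j)) \<longlongrightarrow> 0) (rect_limit m)"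
    using m by (intro tchain_tendsto[OF X _ base] filterlim_rect_limit_component) auto
  have le: "norm (tchain ?X m N ?w (m - 1) 0 - chain ?X m ?w (m - 1) 0)
      \<le> l2n (\<lambda>j. tchain ?X m N ?w (m - 1) j - chain ?X m ?w (m - 1) j)" for N
    by (rule norm_le_l2n[OF l2_diff(1)[OF tchain_bound(1)[OF X _ base] chain_bound(1)[OF X _ base]]]) auto
  have "((\<lambda>N. tchain ?X m N ?w (m - 1) 0 - chain ?X m ?w (m - 1) 0) \<longlongrightarrow> 0) (rect_limit m)"
    by (rule Lim_null_comparison[OF always_eventually[OF allI[OF le]] lim])
  then show ?thesis unfolding sum_moi_terms(2)[OF H T] moi_operator_def by (rule LIM_zero_cancel)
qed

lemmas sum_moi_terms_diagonal =
  filterlim_compose[OF sum_moi_terms_tendsto filterlim_rect_limit_diagonal]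

lemma bounded_clinear_moi_operator:
  assumes H: "haagerup_coeffs m M E a b c" and T: "\<forall>i\<in>{1..m-1}. bounded_clinear (T i)"
  shows "bounded_clinear (moi_operator m M E a b c T)"
proof -
  have m: "3 \<le> m" using H by (simp add: haagerup_coeffs_def)
  define S where "S n g = (\<Sum>J\<in>rectangle m (\<lambda>_. n). moi_term m M E a b c T J g)" for n g
  have S: "bounded_clinear (S n)" for n
    unfolding S_def[abs_def] by (intro bounded_clinear_sum bounded_clinear_moi_term[OF H T])
  have lim: "(\<lambda>n. S n g) \<longlonglongrightarrow> moi_operator m M E a b c T g" for g
    unfolding S_def by (rule sum_moi_terms_diagonal[OF H T])
  define K where "K = (\<Prod>i\<in>{m-(m-1)..<m}. moi_const M E a b T i)"
  have X: "block (moi_block M E a b T i) (moi_const M E a b T i)" if "i \<in> {m - (m - 1)..<m}" for i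
    using that by (intro block_moi_block[OF H T]) auto
  have K: "0 \<le> K" unfolding K_def using X by (intro prod_nonneg) (auto simp: block_def)
  show ?thesis
  proof (rule bounded_clinearI)
    show "moi_operator m M E a b c T (x + y) = moi_operator m M E a b c T x + moi_operator m M E a b c T y" for x y
      by (rule LIMSEQ_unique[OF lim]) (use tendsto_add[OF lim lim] in \<open>simp add: bounded_clinear_simps[OF S]\<close>)
    show "moi_operator m M E a b c T (s *\<^sub>C x) = s *\<^sub>C moi_operator m M E a b c T x" for s x
      by (rule LIMSEQ_unique[OF lim]) (use tendsto_scaleC[OF tendsto_const lim] in \<open>simp add: bounded_clinear_simps[OF S]\<close>)
    fix x
    have Tm: "bounded_clinear (T (m - 1))" using m by (intro bspec[OF T]) auto
    note base = l2s_moi_base[where T = T, OF H Tm]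
    have "norm (moi_operator m M E a b c T x) \<le> K * l2n (moi_base m M E c T x)"
      unfolding moi_operator_def K_def
      by (rule order_trans[OF norm_le_l2n[OF chain_bound(1)[OF X _ base(1)]] chain_bound(2)[OF X _ base(1)]]) auto
    also have "\<dots> \<le> K * (onorm (T (m - 1)) * Linf_ell2_norm (M m) (E m) c * norm x)"
      by (intro mult_left_mono base(3) K)
    finally show "norm (moi_operator m M E a b c T x)
        \<le> norm x * (K * (onorm (T (m - 1)) * Linf_ell2_norm (M m) (E m) c))"
      by (simp add: mult_ac)
  qed
qed

text \<open>The rectangular sums converge even strongly, which gives weak convergence; conversely a
  weak limit over rectangles is also one along the diagonal and hence unique.\<close>

lemma moi_series_sum_iff:
  assumes H: "haagerup_coeffs m M E a b c" and T: "\<forall>i\<in>{1..m-1}. bounded_clinear (T i)"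
  shows "moi_series_sum m M E a b c T S \<longleftrightarrow> S = moi_operator m M E a b c T"
proof
  assume S: "moi_series_sum m M E a b c T S"
  show "S = moi_operator m M E a b c T"
  proof (rule ext, rule cinner_eqI)
    fix g h
    have "((\<lambda>N. cinner (\<Sum>J\<in>rectangle m N. moi_term m M E a b c T J g) h) \<longlongrightarrow> cinner (S g) h) (rect_limit m)"
      using S by (simp add: moi_series_sum_def)
    from filterlim_compose[OF this filterlim_rect_limit_diagonal]
      tendsto_cinner[OF sum_moi_terms_diagonal[OF H T] tendsto_const]
    show "cinner (S g) h = cinner (moi_operator m M E a b c T g) h" by (rule LIMSEQ_unique)
  qed
next
  assume "S = moi_operator m M E a b c T"
  then show "moi_series_sum m M E a b c T S"
    unfolding moi_series_sum_def
    using bounded_clinear_moi_operator[OF H T] tendsto_cinner[OF sum_moi_terms_tendsto[OF H T] tendsto_const] by blast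
qed

text \<open>The first coefficient operator and \<open>T 1\<close> are moved to the side of
  \<open>h\<close>, and Cauchy-Schwarz is applied to the sum over the first index. One factor is
  then the column norm of \<open>h\<close>; the other is the norm of a chain applied to the initial
  sequence, whose norm is the column norm of \<open>g\<close>. Thus \<open>T 1\<close> and
  \<open>T (m - 1)\<close> are not estimated by their operator norms.\<close>

lemma moi_operator_bound:
  assumes H: "haagerup_coeffs m M E a b c" and T: "\<forall>i\<in>{1..m-1}. bounded_clinear (T i)"
  shows "cmod (cinner (moi_operator m M E a b c T g) h)
    \<le> (\<Prod>i\<in>{2..m-1}. Linf_matrix_norm (M i) (E i) (b i)) * (\<Prod>i\<in>{2..m-2}. onorm (T i))
      * (column_norm (cadjoint (T 1)) (\<lambda>j. spectral_integral (M 1) (E 1) (\<lambda>x. cnj (a j x))) h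
         * column_norm (T (m - 1)) (\<lambda>j. spectral_integral (M m) (E m) (c j)) g)"
proof -
  have m: "3 \<le> m" using H by (simp add: haagerup_coeffs_def)
  let ?X = "moi_block M E a b T" and ?w = "moi_base m M E c T g"
  define A D where "A k = spectral_integral (M 1) (E 1) (a k)"
    and "D k = spectral_integral (M 1) (E 1) (\<lambda>x. cnj (a k x))" for k
  define B where "B j k = spectral_integral (M 2) (E 2) (b 2 j k)" for j k
  define \<beta> where "\<beta> i = Linf_matrix_norm (M i) (E i) (b i)" for i
  have T1: "bounded_clinear (T 1)" and Tm: "bounded_clinear (T (m - 1))" using m by (auto intro!: bspec[OF T])
  have T1': "bounded_clinear (cadjoint (T 1))" by (rule bounded_clinear_cadjoint[OF T1])
  have AD: "column_bound D (Linf_ell2_norm (M 1) (E 1) a)" "cinner (A k x) y = cinner x (D k y)" for k x y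
    using haagerup_coeffs_column_pairs(1)[OF H]
    unfolding column_pair_def A_def[abs_def] D_def[abs_def] by blast+
  have B: "block B (\<beta> 2)" and Bl: "bounded_clinear (B j k)" for j k
    using H m unfolding B_def \<beta>_def
    by (auto simp: haagerup_coeffs_def intro!: Linf_matrix_operators)
  have base: "l2s ?w" by (rule l2s_moi_base(1)[where T = T, OF H Tm])
  \<comment> \<open>Only the blocks from 3 on are used as they stand. Block 2 contains
    \<open>T 1\<close>, which has to be kept apart, so \<open>B\<close> without \<open>T 1\<close>
    replaces it.\<close>
  have X: "block (?X i) (moi_const M E a b T i)" if "i \<in> {m - (m - 3)..<m}" for i
    using that m by (intro block_moi_block[OF H T]) auto
  define K where "K = (\<Prod>i\<in>{2..m-1}. \<beta> i) * (\<Prod>i\<in>{2..m-2}. onorm (T i))"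
  have K: "\<beta> 2 * (\<Prod>i\<in>{m-(m-3)..<m}. moi_const M E a b T i) = K"
  proof -
    have "(\<Prod>i\<in>{m-(m-3)..<m}. moi_const M E a b T i) = (\<Prod>i\<in>{3..m-1}. onorm (T (i - 1)) * \<beta> i)"
      using m by (intro prod.cong) (auto simp: moi_const_def \<beta>_def)
    also have "\<dots> = (\<Prod>i\<in>{3..m-1}. onorm (T (i - 1))) * (\<Prod>i\<in>{3..m-1}. \<beta> i)"
      by (rule prod.distrib)
    also have "(\<Prod>i\<in>{3..m-1}. onorm (T (i - 1))) = (\<Prod>i\<in>{2..m-2}. onorm (T i))"
    proof -
      have "Suc (m - 2) = m - 1" using m by simp
      then have eq: "{3..m-1} = Suc ` {2..m-2}" by (simp add: image_Suc_atLeastAtMost)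
      show ?thesis unfolding eq by (subst prod.reindex) simp_all
    qed
    finally have "\<beta> 2 * (\<Prod>i\<in>{m-(m-3)..<m}. moi_const M E a b T i)
        = (\<beta> 2 * (\<Prod>i\<in>{3..m-1}. \<beta> i)) * (\<Prod>i\<in>{2..m-2}. onorm (T i))" by simp
    moreover have "{2..m-1} = insert 2 {3..m-1}" using m by auto
    ultimately show ?thesis by (simp add: K_def)
  qed
  define bound where "bound = K * (column_norm (cadjoint (T 1)) D h * l2n ?w)"
  have "cmod (cinner (\<Sum>J\<in>rectangle m (\<lambda>_. n). moi_term m M E a b c T J g) h) \<le> bound" for n
  proof -
    \<comment> \<open>The sequence that has passed through the blocks from 3 on; \<open>V\<close>
      below is its image under block 2 without the factor \<open>T 1\<close>.\<close>
    define W where "W = tchain ?X m (\<lambda>_. n) ?w (m - 3)"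
    have W: "l2s W" "l2n W \<le> (\<Prod>i\<in>{m-(m-3)..<m}. moi_const M E a b T i) * l2n ?w"
      unfolding W_def by (rule tchain_bound[OF X _ base]; simp)+
    define V where "V = bapp B (l2trunc n W)"
    have V: "l2s V" "l2n V \<le> K * l2n ?w"
    proof -
      show "l2s V" unfolding V_def by (rule block_apply(1)[OF B l2_trunc(1)[OF W(1)]])
      have "l2n V \<le> \<beta> 2 * l2n (l2trunc n W)" unfolding V_def by (rule block_apply(2)[OF B l2_trunc(1)[OF W(1)]])
      also have "\<dots> \<le> \<beta> 2 * ((\<Prod>i\<in>{m-(m-3)..<m}. moi_const M E a b T i) * l2n ?w)"
        using B W by (intro mult_left_mono order_trans[OF l2_trunc(2)[OF W(1)]]) (auto simp: block_def)
      finally show "l2n V \<le> K * l2n ?w" by (simp add: K[symmetric] mult.assoc)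
    qed
    have "tchain ?X m (\<lambda>_. n) ?w (m - 2) k = T 1 (V k)" for k
    proof -
      have "m - 2 = Suc (m - 3)" "m - Suc (m - 3) = 2" using m by auto
      moreover have "block (?X 2) (moi_const M E a b T 2)" using m by (intro block_moi_block[OF H T]) auto
      ultimately have "tchain ?X m (\<lambda>_. n) ?w (m - 2) k = (\<Sum>k'\<le>n. ?X 2 k k' (W k'))"
        by (simp add: bapp_trunc W_def)
      also have "\<dots> = T 1 (V k)"
        unfolding V_def bapp_trunc[OF B] bounded_clinear_simps(5)[OF T1]
        by (simp add: moi_block_def B_def)
      finally show ?thesis .
    qed
    note W_eq = this
    have "cinner (\<Sum>J\<in>rectangle m (\<lambda>_. n). moi_term m M E a b c T J g) h
        = (\<Sum>k\<le>n. cinner (V k) (cadjoint (T 1) (D k h)))"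
      unfolding sum_moi_terms(1)[OF H T] A_def[symmetric] cinner_sum_left AD(2) W_eq cinner_cadjoint[OF T1] ..
    also have "cmod \<dots> \<le> (\<Sum>k<Suc n. \<bar>norm (V k)\<bar> * \<bar>norm (cadjoint (T 1) (D k h))\<bar>)"
      unfolding lessThan_Suc_atMost by (intro order_trans[OF norm_sum] sum_mono) (simp add: cmod_cinner_le)
    also have "\<dots> \<le> L2_set (\<lambda>k. norm (V k)) {..<Suc n} * L2_set (\<lambda>k. norm (cadjoint (T 1) (D k h))) {..<Suc n}"
      by (rule L2_set_mult_ineq)
    also have "\<dots> \<le> (K * l2n ?w) * column_norm (cadjoint (T 1)) D h"
    proof (intro mult_mono)
      show "L2_set (\<lambda>k. norm (V k)) {..<Suc n} \<le> K * l2n ?w"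
        by (rule order_trans[OF L2_set_le_l2n[OF V(1)] V(2)])
      show "L2_set (\<lambda>k. norm (cadjoint (T 1) (D k h))) {..<Suc n} \<le> column_norm (cadjoint (T 1)) D h"
        unfolding L2_set_def column_norm_def
        by (intro real_sqrt_le_mono sum_le_suminf column_norm_summable[OF T1' AD(1)]) auto
      show "0 \<le> K * l2n ?w" using l2n_nonneg[OF V(1)] V(2) by linarith
    qed (rule L2_set_nonneg)
    finally show ?thesis by (simp add: bound_def mult_ac)
  qed
  then have "cmod (cinner (moi_operator m M E a b c T g) h) \<le> bound"
    by (intro LIMSEQ_le_const2[OF tendsto_norm[OF tendsto_cinner[OF sum_moi_terms_diagonal[OF H T] tendsto_const]]]) auto
  then show ?thesis
    unfolding bound_def K_def \<beta>_def D_def l2s_moi_base(2)[where T = T, OF H Tm] .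
qed

section \<open>Independence of the representation\<close>

lemma chain_split: "chain X m w (d + e) = chain X (m - d) (chain X m w d) e"
  by (induction e) (simp_all add: diff_diff_add)

lemma chain_cong:
  assumes "\<And>i. i \<in> {m-d..<m} \<Longrightarrow> X i = X' i" "d \<le> m"
  shows "chain X m w d = chain X' m w d"
  using assms
proof (induction d)
  case (Suc d)
  have "X (m - Suc d) = X' (m - Suc d)" using Suc.prems by (intro Suc.prems(1)) auto
  moreover have "chain X m w d = chain X' m w d" using Suc.prems by (intro Suc.IH Suc.prems(1)) auto
  ultimately show ?case by simp
qed simp

lemma bapp_add:
  fixes X :: "nat \<Rightarrow> nat \<Rightarrow> 'a::banach \<Rightarrow> 'a"
  assumes X: "block X C" and "l2s u" "l2s v"
  shows "bapp X (\<lambda>k. u k + v k) j = bapp X u j + bapp X v j"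
  unfolding bapp_def
  by (subst suminf_add[OF block_summable[OF X assms(2)] block_summable[OF X assms(3)]])
    (simp add: linear_add[OF bounded_linear.linear[OF block_linear[OF X]]])

lemma chain_add:
  fixes X :: "nat \<Rightarrow> nat \<Rightarrow> nat \<Rightarrow> 'a::banach \<Rightarrow> 'a"
  assumes "\<And>i. i \<in> {m-d..<m} \<Longrightarrow> block (X i) (C i)" "d \<le> m" "l2s u" "l2s v"
  shows "chain X m (\<lambda>k. u k + v k) d = (\<lambda>k. chain X m u d k + chain X m v d k)"
  using assms(1,2)
proof (induction d)
  case (Suc d)
  have X: "block (X (m - Suc d)) (C (m - Suc d))" using Suc.prems by (intro Suc.prems(1)) auto
  have sub: "\<And>i. i \<in> {m-d..<m} \<Longrightarrow> block (X i) (C i)" "d \<le> m"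
    using Suc.prems by (auto intro: Suc.prems(1))
  have "l2s (chain X m u d)" "l2s (chain X m v d)"
    by (rule chain_bound(1)[OF sub], assumption, rule assms)+
  moreover have "chain X m (\<lambda>k. u k + v k) d = (\<lambda>k. chain X m u d k + chain X m v d k)"
    by (rule Suc.IH[OF sub])
  ultimately show ?case by (simp add: bapp_add[OF X])
qed simp

text \<open>Vector-valued despite its name: it stands for everything to the left of one factor
  \<open>T n\<close>, applied to the sequence that this factor produces.\<close>

definition l2_functional :: "((nat \<Rightarrow> 'h) \<Rightarrow> 'h::real_normed_vector) \<Rightarrow> bool" where
  "l2_functional L \<longleftrightarrow> (\<forall>u v. l2s u \<longrightarrow> l2s v \<longrightarrow> L (\<lambda>k. u k + v k) = L u + L v) \<and>
     (\<exists>K\<ge>0. \<forall>u. l2s u \<longrightarrow> norm (L u) \<le> K * l2n u)"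

lemma l2_functional_chain:
  fixes X :: "nat \<Rightarrow> nat \<Rightarrow> nat \<Rightarrow> 'a::banach \<Rightarrow> 'a"
  assumes X: "\<And>i. i \<in> {m-d..<m} \<Longrightarrow> block (X i) (C i)" and d: "d \<le> m"
  shows "l2_functional (\<lambda>u. chain X m u d k)"
  unfolding l2_functional_def
proof (intro conjI exI[of _ "\<Prod>i\<in>{m-d..<m}. C i"] allI impI)
  fix u v :: "nat \<Rightarrow> 'a" assume u: "l2s u" and v: "l2s v"
  show "chain X m (\<lambda>k. u k + v k) d k = chain X m u d k + chain X m v d k"
    using chain_add[where C = C, OF X d u v] by simp
next
  show "0 \<le> (\<Prod>i\<in>{m-d..<m}. C i)" using X by (intro prod_nonneg) (simp add: block_def)
  fix u :: "nat \<Rightarrow> 'a" assume u: "l2s u"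
  have "norm (chain X m u d k) \<le> l2n (chain X m u d)"
    by (rule norm_le_l2n[OF chain_bound(1)[where C = C, OF X d u]])
  also have "\<dots> \<le> (\<Prod>i\<in>{m-d..<m}. C i) * l2n u" by (rule chain_bound(2)[where C = C, OF X d u])
  finally show "norm (chain X m u d k) \<le> (\<Prod>i\<in>{m-d..<m}. C i) * l2n u" .
qed

lemma l2s_image:
  assumes "l2s w" "\<And>k. norm (u k) \<le> c * norm (w k)" "0 \<le> c"
  shows "l2s u" "l2n u \<le> c * l2n w"
proof -
  have L2: "L2_set (\<lambda>k. norm (u k)) {..<n} \<le> c * l2n w" for n
  proof -
    have "L2_set (\<lambda>k. norm (u k)) {..<n} \<le> L2_set (\<lambda>k. c * norm (w k)) {..<n}"
      by (intro L2_set_mono assms(2)) simp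
    also have "\<dots> = c * L2_set (\<lambda>k. norm (w k)) {..<n}"
      using assms(3) by (simp add: L2_set_right_distrib)
    also have "\<dots> \<le> c * l2n w" by (intro mult_left_mono L2_set_le_l2n assms)
    finally show ?thesis .
  qed
  show "l2s u" "l2n u \<le> c * l2n w" by (rule l2sI[OF L2])+
qed

lemma l2_functional_sum:
  fixes L :: "(nat \<Rightarrow> 'h) \<Rightarrow> 'h::real_normed_vector"
  assumes L: "l2_functional L" and "finite F" "\<And>s. s \<in> F \<Longrightarrow> l2s (u s)"
  shows "l2s (\<lambda>k. \<Sum>s\<in>F. u s k) \<and> L (\<lambda>k. \<Sum>s\<in>F. u s k) = (\<Sum>s\<in>F. L (u s))"
  using assms(2,3)
proof (induction F)
  case empty
  have z: "l2s (\<lambda>_. 0 :: 'h)" "l2n (\<lambda>_. 0 :: 'h) = 0" by (simp_all add: l2s_def l2n_def)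
  obtain K where "\<And>u. l2s u \<Longrightarrow> norm (L u) \<le> K * l2n u" using L by (auto simp: l2_functional_def)
  from this[OF z(1)] z show ?case by simp
next
  case (insert s F)
  then have "l2s (u s)" "l2s (\<lambda>k. \<Sum>s\<in>F. u s k)" by auto
  moreover have "L (\<lambda>k. u s k + (\<Sum>s\<in>F. u s k)) = L (u s) + L (\<lambda>k. \<Sum>s\<in>F. u s k)"
    using L calculation by (simp add: l2_functional_def)
  ultimately show ?case using insert l2_add(1)[of "u s" "\<lambda>k. \<Sum>s\<in>F. u s k"] by simp
qed

text \<open>The sum is the value of \<open>L\<close> after replacing \<open>t\<close> by
  \<open>t\<close> composed with the orthogonal projection onto the span of \<open>U n\<close>. That
  projection fixes \<open>Y 0\<close>, ..., \<open>Y n\<close> and is a contraction on the remaining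
  terms, so the error is bounded by \<open>onorm t\<close> times a tail of \<open>Y\<close>.\<close>

lemma l2_functional_projection_tendsto:
  fixes L :: "(nat \<Rightarrow> 'h) \<Rightarrow> 'h::complex_hilbert_space"
  assumes L: "l2_functional L" and Y: "l2s Y" and t: "bounded_clinear t"
    and U: "\<And>n. finite (U n)" "\<And>n. orthonormal0 (U n) (\<lambda>u. u)"
      "\<And>n k. k \<le> n \<Longrightarrow> Y k \<in> complex_vector.span (U n)"
  shows "(\<lambda>n. \<Sum>u\<in>U n. L (\<lambda>k. cinner (Y k) u *\<^sub>C t u)) \<longlonglongrightarrow> L (\<lambda>k. t (Y k))"
proof -
  obtain K where K: "0 \<le> K" "\<And>u. l2s u \<Longrightarrow> norm (L u) \<le> K * l2n u"
    using L by (auto simp: l2_functional_def)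
  define P where "P n y = (\<Sum>u\<in>U n. cinner y u *\<^sub>C u)" for n y
  define Q where "Q n k = t (Y k) - (\<Sum>u\<in>U n. cinner (Y k) u *\<^sub>C t u)" for n k
  have Q: "Q n k = t (Y k - P n (Y k))" for n k
    by (simp add: Q_def P_def bounded_clinear_simps[OF t])
  have t0: "0 \<le> onorm t" by (rule onorm_clinear_nonneg[OF t])
  have summand: "l2s (\<lambda>k. cinner (Y k) u *\<^sub>C t u)" for u
  proof (rule l2s_image(1)[OF Y])
    fix k
    have "cmod (cinner (Y k) u) * norm (t u) \<le> (norm (Y k) * norm u) * norm (t u)"
      by (intro mult_right_mono cmod_cinner_le) simp
    then show "norm (cinner (Y k) u *\<^sub>C t u) \<le> (norm u * norm (t u)) * norm (Y k)"
      by (simp add: norm_scaleC mult_ac)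
  qed simp
  have Qle: "norm (Q n k) \<le> onorm t * norm (Y k - l2trunc n Y k)" for n k
  proof (cases "k \<le> n")
    case True
    then have "P n (Y k) = Y k" unfolding P_def by (intro orthonormal0_expand U)
    then show ?thesis using t0 by (simp add: Q bounded_clinear_simps[OF t])
  next
    case False
    have "(norm (Y k - P n (Y k)))\<^sup>2 \<le> (norm (Y k))\<^sup>2"
      using orthonormal0_pythagoras[OF U(1,2), of "Y k" n] by (simp add: P_def sum_nonneg)
    then have "norm (Y k - P n (Y k)) \<le> norm (Y k)" by (rule power2_le_imp_le) simp
    then have "onorm t * norm (Y k - P n (Y k)) \<le> onorm t * norm (Y k)" using t0 by (rule mult_left_mono)
    then show ?thesis using onorm_clinear[OF t, of "Y k - P n (Y k)"] False by (simp add: Q l2trunc_def)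
  qed
  note tail = l2_diff(1)[OF Y l2_trunc(1)[OF Y]]
  note Ql2 = l2s_image[OF tail Qle t0]
  have split: "L (\<lambda>k. t (Y k)) = L (Q n) + (\<Sum>u\<in>U n. L (\<lambda>k. cinner (Y k) u *\<^sub>C t u))" for n
  proof -
    have S: "l2s (\<lambda>k. \<Sum>u\<in>U n. cinner (Y k) u *\<^sub>C t u)"
      "L (\<lambda>k. \<Sum>u\<in>U n. cinner (Y k) u *\<^sub>C t u) = (\<Sum>u\<in>U n. L (\<lambda>k. cinner (Y k) u *\<^sub>C t u))"
      using l2_functional_sum[OF L U(1), of n "\<lambda>u k. cinner (Y k) u *\<^sub>C t u"] summand by auto
    have "L (\<lambda>k. Q n k + (\<Sum>u\<in>U n. cinner (Y k) u *\<^sub>C t u)) = L (Q n) + L (\<lambda>k. \<Sum>u\<in>U n. cinner (Y k) u *\<^sub>C t u)"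
      using L Ql2(1)[of n] S(1) unfolding l2_functional_def by blast
    then show ?thesis by (simp add: S(2)) (simp add: Q_def)
  qed
  have le: "norm (L (Q n)) \<le> K * (onorm t * l2n (\<lambda>k. Y k - l2trunc n Y k))" for n
    by (rule order_trans[OF K(2)[OF Ql2(1)] mult_left_mono[OF Ql2(2) K(1)]])
  have "(\<lambda>n. K * (onorm t * l2n (\<lambda>k. Y k - l2trunc n Y k))) \<longlonglongrightarrow> K * (onorm t * 0)"
    by (intro tendsto_mult tendsto_const l2n_tail_tendsto Y)
  then have lim: "(\<lambda>n. K * (onorm t * l2n (\<lambda>k. Y k - l2trunc n Y k))) \<longlonglongrightarrow> 0" by simp
  have "(\<lambda>n. L (Q n)) \<longlonglongrightarrow> 0"
    by (rule Lim_null_comparison[OF always_eventually[OF allI[OF le]] lim])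
  then have "(\<lambda>n. L (\<lambda>k. t (Y k)) - L (Q n)) \<longlonglongrightarrow> L (\<lambda>k. t (Y k)) - 0"
    by (intro tendsto_diff tendsto_const)
  moreover have "L (\<lambda>k. t (Y k)) - L (Q n) = (\<Sum>u\<in>U n. L (\<lambda>k. cinner (Y k) u *\<^sub>C t u))" for n
    using split[of n] by simp
  ultimately show ?thesis by simp
qed

text \<open>A bounded operator can be tested on countably many vectors by finite sums of operators of
  rank one, even though it need not be compact.\<close>

lemma l2_functional_eqI:
  fixes L L' :: "(nat \<Rightarrow> 'h) \<Rightarrow> 'h::complex_hilbert_space"
  assumes L: "l2_functional L" "l2_functional L'" and Y: "l2s Y" "l2s Y'" and t: "bounded_clinear t"
    and eq: "\<And>u v. L (\<lambda>k. cinner (Y k) u *\<^sub>C v) = L' (\<lambda>k. cinner (Y' k) u *\<^sub>C v)"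
  shows "L (\<lambda>k. t (Y k)) = L' (\<lambda>k. t (Y' k))"
proof -
  have "\<forall>n. \<exists>U. finite U \<and> orthonormal0 U (\<lambda>u. u) \<and> Y ` {..n} \<union> Y' ` {..n} \<subseteq> complex_vector.span U"
  proof
    fix n :: nat
    have "finite (Y ` {..n} \<union> Y' ` {..n})" by simp
    from gram_schmidt[OF this] show "\<exists>U. finite U \<and> orthonormal0 U (\<lambda>u. u) \<and> Y ` {..n} \<union> Y' ` {..n} \<subseteq> complex_vector.span U"
      by blast
  qed
  from choice[OF this] obtain U where U: "\<And>n. finite (U n)" "\<And>n. orthonormal0 (U n) (\<lambda>u. u)"
    "\<And>n. Y ` {..n} \<union> Y' ` {..n} \<subseteq> complex_vector.span (U n)" by blast
  have span: "Y k \<in> complex_vector.span (U n)" "Y' k \<in> complex_vector.span (U n)" if "k \<le> n" for k n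
    using U(3)[of n] that by auto
  have "(\<lambda>n. \<Sum>u\<in>U n. L (\<lambda>k. cinner (Y k) u *\<^sub>C t u)) \<longlonglongrightarrow> L (\<lambda>k. t (Y k))"
    by (rule l2_functional_projection_tendsto[OF L(1) Y(1) t U(1,2) span(1)])
  moreover have "(\<lambda>n. \<Sum>u\<in>U n. L' (\<lambda>k. cinner (Y' k) u *\<^sub>C t u)) \<longlonglongrightarrow> L' (\<lambda>k. t (Y' k))"
    by (rule l2_functional_projection_tendsto[OF L(2) Y(2) t U(1,2) span(2)])
  ultimately show ?thesis unfolding eq by (rule LIMSEQ_unique)
qed

lemma bapp_compose:
  fixes X :: "nat \<Rightarrow> nat \<Rightarrow> 'a::banach \<Rightarrow> 'a"
  assumes X: "block X C" and w: "l2s w" and T: "bounded_linear T"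
  shows "bapp (\<lambda>j k. T \<circ> X j k) w j = T (bapp X w j)"
  unfolding bapp_def using bounded_linear.suminf[OF T block_summable[OF X w]] by simp

text \<open>With all other factors fixed, the value at \<open>g\<close> depends on the factor at
  position \<open>n\<close> only through its images of a fixed sequence \<open>Y\<close>. The
  disjunction in the conclusion is an implication from \<open>bounded_clinear U\<close>.\<close>

lemma moi_operator_slot:
  fixes E :: "nat \<Rightarrow> 'x set \<Rightarrow> 'h \<Rightarrow> 'h::complex_hilbert_space"
  assumes H: "haagerup_coeffs m M E a b c" and T: "\<forall>i\<in>{1..m-1}. bounded_clinear (T i)" and n: "n \<in> {1..m-1}"
  shows "\<exists>L Y. l2_functional L \<and> l2s Y \<and>
    (\<forall>U. moi_operator m M E a b c (T(n := U)) g = L (\<lambda>k. U (Y k)) \<or> \<not> bounded_clinear U)"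
proof -
  have m: "3 \<le> m" using H by (simp add: haagerup_coeffs_def)
  let ?X = "moi_block M E a b T"
  have block: "block (?X i) (moi_const M E a b T i)" if "i \<in> {1..<m}" for i
    by (rule block_moi_block[OF H T that])
  define L where "L u = chain ?X (n + 1) u n 0" for u
  have L: "l2_functional L"
    unfolding L_def by (rule l2_functional_chain[where C = "moi_const M E a b T"]) (use block n in auto)
  define B where "B j k = spectral_integral (M (n + 1)) (E (n + 1)) (b (n + 1) j k)" for j k
  define W where "W = chain ?X m (moi_base m M E c T g) (m - (n + 2))"
  \<comment> \<open>The last factor acts on the initial column directly; any other one acts after
    the blocks from \<open>n + 2\<close> on and the bare matrix of the coefficients at
    \<open>n + 1\<close>.\<close>
  define Y where "Y = (if n = m - 1 then (\<lambda>j. spectral_integral (M m) (E m) (c j) g) else bapp B W)"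
  have W: "l2s W" and B: "block B (Linf_matrix_norm (M (n + 1)) (E (n + 1)) (b (n + 1)))" if "n \<noteq> m - 1"
  proof -
    have Tm: "bounded_clinear (T (m - 1))" using m by (intro bspec[OF T]) auto
    show "l2s W" unfolding W_def
      by (rule chain_bound(1)[where C = "moi_const M E a b T"])
        (use block n that l2s_moi_base(1)[where T = T, OF H Tm] in auto)
    show "block B (Linf_matrix_norm (M (n + 1)) (E (n + 1)) (b (n + 1)))"
      unfolding B_def by (rule Linf_matrix_operators(2)) (use H n that in \<open>auto simp: haagerup_coeffs_def\<close>)
  qed
  have Y: "l2s Y"
  proof (cases "n = m - 1")
    case True
    have "column_bound (\<lambda>j. spectral_integral (M m) (E m) (c j)) (Linf_ell2_norm (M m) (E m) c)"
      using haagerup_coeffs_column_pairs(2)[OF H] by (simp add: column_pair_def)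
    from column_norm_summable[OF bounded_clinear_id(2) this] show ?thesis
      by (simp add: True Y_def l2s_def)
  next
    case False
    then show ?thesis using block_apply(1)[OF B W] by (simp add: Y_def)
  qed
  have "moi_operator m M E a b c (T(n := U)) g = L (\<lambda>k. U (Y k))" if U: "bounded_clinear U" for U
  proof -
    let ?X' = "moi_block M E a b (T(n := U))" and ?w' = "moi_base m M E c (T(n := U)) g"
    have top: "chain ?X' m ?w' (m - 1 - n) = (\<lambda>k. U (Y k))"
    proof (cases "n = m - 1")
      case True
      then show ?thesis by (simp add: Y_def moi_base_def[abs_def])
    next
      case False
      then have d: "m - 1 - n = Suc (m - (n + 2))" "m - Suc (m - (n + 2)) = n + 1" using n by auto
      have w': "?w' = moi_base m M E c T g" using False by (simp add: moi_base_def[abs_def])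
      have "chain ?X' m ?w' (m - (n + 2)) = W"
        unfolding W_def w' using n by (intro chain_cong) (auto simp: moi_block_def fun_eq_iff)
      moreover have "?X' (n + 1) = (\<lambda>j k. U \<circ> B j k)"
        using n by (auto simp: moi_block_def fun_eq_iff B_def)
      ultimately have "chain ?X' m ?w' (m - 1 - n) = bapp (\<lambda>j k. U \<circ> B j k) W"
        unfolding d(1) chain.simps d(2) by simp
      then show ?thesis using False bapp_compose[OF B W bounded_clinear_linear[OF U]]
        by (simp add: Y_def fun_eq_iff)
    qed
    have idx: "(m - 1 - n) + n = m - 1" "m - (m - 1 - n) = n + 1" using n by auto
    have "moi_operator m M E a b c (T(n := U)) g = chain ?X' (n + 1) (\<lambda>k. U (Y k)) n 0"
      using chain_split[of ?X' m ?w' "m - 1 - n" n] unfolding moi_operator_def idx top by simp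
    also have "chain ?X' (n + 1) (\<lambda>k. U (Y k)) n = chain ?X (n + 1) (\<lambda>k. U (Y k)) n"
      by (rule chain_cong) (auto simp: moi_block_def fun_eq_iff)
    finally show ?thesis unfolding L_def .
  qed
  then show ?thesis using L Y by blast
qed

definition rank_one :: "('h \<Rightarrow> 'h::complex_hilbert_space) \<Rightarrow> bool" where
  "rank_one R \<longleftrightarrow> (\<exists>u v. R = (\<lambda>x. cinner x u *\<^sub>C v))"

text \<open>Induction on the number \<open>k\<close> of leading positions with arbitrary bounded
  factors, those after \<open>k\<close> being of rank one. Freeing one more position is possible
  because both sides depend on it through an \<open>l2_functional\<close>, and such values are
  determined by rank-one factors.\<close>

lemma moi_operator_eq_of_rank_one:
  fixes E :: "nat \<Rightarrow> 'x set \<Rightarrow> 'h \<Rightarrow> 'h::complex_hilbert_space"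
  assumes H: "haagerup_coeffs m M E a b c" "haagerup_coeffs m M E a' b' c'"
    and eq: "\<And>R. (\<forall>i\<in>{1..m-1}. rank_one (R i)) \<Longrightarrow> moi_operator m M E a b c R = moi_operator m M E a' b' c' R"
    and T: "\<forall>i\<in>{1..m-1}. bounded_clinear (T i)"
  shows "moi_operator m M E a b c T = moi_operator m M E a' b' c' T"
proof -
  have "moi_operator m M E a b c T = moi_operator m M E a' b' c' T"
    if "k \<le> m - 1" "\<forall>i\<in>{1..m-1}. bounded_clinear (T i)" "\<forall>i\<in>{1..m-1}. k < i \<longrightarrow> rank_one (T i)" for k T
    using that
  proof (induction k arbitrary: T)
    case 0
    then show ?case by (intro eq) auto
  next
    case (Suc k)
    have n: "Suc k \<in> {1..m-1}" using Suc.prems by auto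
    show ?case
    proof
      fix g
      obtain L Y where L: "l2_functional L" "l2s Y"
        "\<And>U. bounded_clinear U \<Longrightarrow> moi_operator m M E a b c (T(Suc k := U)) g = L (\<lambda>k. U (Y k))"
        using moi_operator_slot[OF H(1) Suc.prems(2) n, of g] by blast
      obtain L' Y' where L': "l2_functional L'" "l2s Y'"
        "\<And>U. bounded_clinear U \<Longrightarrow> moi_operator m M E a' b' c' (T(Suc k := U)) g = L' (\<lambda>k. U (Y' k))"
        using moi_operator_slot[OF H(2) Suc.prems(2) n, of g] by blast
      have Tn: "bounded_clinear (T (Suc k))" by (rule bspec[OF Suc.prems(2) n])
      \<comment> \<open>The copy \<open>k'\<close> keeps the position of the factor apart from the
        summation index bound in the sequences.\<close>
      have "L (\<lambda>k. T (Suc k') (Y k)) = L' (\<lambda>k. T (Suc k') (Y' k))" if "k' = k" for k'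
      proof (rule l2_functional_eqI[OF L(1) L'(1) L(2) L'(2)])
        show "bounded_clinear (T (Suc k'))" using Tn that by simp
        fix u v :: 'h
        let ?R = "\<lambda>x. cinner x u *\<^sub>C v"
        have "moi_operator m M E a b c (T(Suc k := ?R)) = moi_operator m M E a' b' c' (T(Suc k := ?R))"
        proof (rule Suc.IH)
          show "\<forall>i\<in>{1..m-1}. k < i \<longrightarrow> rank_one ((T(Suc k := ?R)) i)"
          proof (intro ballI impI)
            fix i assume "i \<in> {1..m-1}" "k < i"
            then show "rank_one ((T(Suc k := ?R)) i)"
              using Suc.prems(3) by (cases "i = Suc k") (auto simp: rank_one_def)
          qed
        qed (use Suc.prems bounded_clinear_rank_one in auto)
        then show "L (\<lambda>k. cinner (Y k) u *\<^sub>C v) = L' (\<lambda>k. cinner (Y' k) u *\<^sub>C v)"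
          using L(3)[OF bounded_clinear_rank_one, of u v] L'(3)[OF bounded_clinear_rank_one, of u v] by simp
      qed
      then show "moi_operator m M E a b c T g = moi_operator m M E a' b' c' T g"
        using L(3)[OF Tn] L'(3)[OF Tn] by simp
    qed
  qed
  from this[of "m - 1" T] show ?thesis using T by auto
qed

section \<open>Rank-one factors and reduction to scalar integrals\<close>

definition haagerup_factor ::
    "nat \<Rightarrow> (nat \<Rightarrow> 'x \<Rightarrow> complex) \<Rightarrow> (nat \<Rightarrow> nat \<Rightarrow> nat \<Rightarrow> 'x \<Rightarrow> complex) \<Rightarrow> (nat \<Rightarrow> 'x \<Rightarrow> complex)
      \<Rightarrow> (nat \<Rightarrow> nat) \<Rightarrow> nat \<Rightarrow> 'x \<Rightarrow> complex" where
  "haagerup_factor m a b c J i =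
     (if i = 1 then a (J 1) else if i = m then c (J (m - 1)) else b i (J (i - 1)) (J i))"

lemma atLeastAtMost_split_ends:
  "3 \<le> m \<Longrightarrow> {1..m} = insert 1 (insert m {2..m-1})" for m :: nat
  by auto

lemma prod_haagerup_factor:
  assumes "3 \<le> m"
  shows "(\<Prod>i\<in>{1..m}. haagerup_factor m a b c J i (x i))
    = a (J 1) (x 1) * (\<Prod>i\<in>{2..m-1}. b i (J (i-1)) (J i) (x i)) * c (J (m-1)) (x m)"
proof -
  have "(\<Prod>i\<in>{2..m-1}. haagerup_factor m a b c J i (x i)) = (\<Prod>i\<in>{2..m-1}. b i (J (i-1)) (J i) (x i))"
    using assms by (intro prod.cong) (auto simp: haagerup_factor_def)
  then show ?thesis
    unfolding atLeastAtMost_split_ends[OF assms] using assms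
    by (subst prod.insert, simp, simp, subst prod.insert) (auto simp: haagerup_factor_def)
qed

text \<open>A rank-one operator cuts the chain: what stands to its right enters only through the
  inner product with \<open>u i\<close>, so the whole expression becomes a product of matrix
  elements of the \<open>B i\<close>.\<close>

lemma cinner_rank_one_chain:
  assumes "2 \<le> n"
    and "\<forall>i\<in>{1..<n}. bounded_clinear (B i) \<and> T i = (\<lambda>x. cinner x (u i) *\<^sub>C v i)"
  shows "cinner (B 1 (T 1 (foldr (\<circ>) (map (\<lambda>i. B i \<circ> T i) [2..<n]) id x))) h
    = cinner x (u (n - 1)) * (\<Prod>i\<in>{1..<n}. cinner (B i (v i)) (if i = 1 then h else u (i - 1)))"
  using assms
proof (induction n arbitrary: x rule: dec_induct)
  case base
  have "bounded_clinear (B 1)" "T 1 = (\<lambda>x. cinner x (u 1) *\<^sub>C v 1)" using base by auto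
  moreover have "{1..<2::nat} = {1}" by auto
  ultimately show ?case by (simp add: bounded_clinear_simps cinner_scaleC_left)
next
  case (step n)
  have n: "bounded_clinear (B n)" "T n = (\<lambda>x. cinner x (u n) *\<^sub>C v n)" using step by auto
  have "cinner (B 1 (T 1 (foldr (\<circ>) (map (\<lambda>i. B i \<circ> T i) [2..<Suc n]) id x))) h
      = cinner (B 1 (T 1 (foldr (\<circ>) (map (\<lambda>i. B i \<circ> T i) [2..<n]) id (B n (T n x))))) h"
    using step(1) by (simp add: foldr_comp_append del: foldr_append)
  also have "\<dots> = cinner (B n (T n x)) (u (n - 1)) * (\<Prod>i\<in>{1..<n}. cinner (B i (v i)) (if i = 1 then h else u (i - 1)))"
    using step.prems by (intro step.IH) auto
  also have "cinner (B n (T n x)) (u (n - 1)) = cinner x (u n) * cinner (B n (v n)) (if n = 1 then h else u (n - 1))"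
    using step(1) by (simp add: n(2) bounded_clinear_simps[OF n(1)] cinner_scaleC_left)
  finally show ?case using step(1) by (simp add: atLeastLessThanSuc mult_ac)
qed

lemma haagerup_factor_operators:
  assumes H: "haagerup_coeffs m M E a b c" and i: "i \<in> {1..m}"
  shows "bounded_clinear (spectral_integral (M i) (E i) (haagerup_factor m a b c J i))"
  using haagerup_coeffs_operators[OF H] i by (auto simp: haagerup_factor_def)

text \<open>At the two ends the vectors of the form take over: \<open>g\<close> plays the role of
  \<open>v m\<close>, and \<open>h\<close> that of \<open>u 0\<close>.\<close>

lemma cinner_moi_term_rank_one:
  assumes H: "haagerup_coeffs m M E a b c"
    and T: "\<forall>i\<in>{1..m-1}. T i = (\<lambda>x. cinner x (u i) *\<^sub>C v i)"
  shows "cinner (moi_term m M E a b c T J g) h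
    = (\<Prod>i\<in>{1..m}. cinner (spectral_integral (M i) (E i) (haagerup_factor m a b c J i) (if i = m then g else v i))
        (if i = 1 then h else u (i - 1)))"
proof -
  have m: "3 \<le> m" using H by (simp add: haagerup_coeffs_def)
  define B where "B i = spectral_integral (M i) (E i) (haagerup_factor m a b c J i)" for i
  have map: "map (\<lambda>i. spectral_integral (M i) (E i) (b i (J (i - 1)) (J i)) \<circ> T i) [2..<m] = map (\<lambda>i. B i \<circ> T i) [2..<m]"
    by (rule map_cong) (auto simp: B_def haagerup_factor_def)
  have ends: "spectral_integral (M 1) (E 1) (a (J 1)) = B 1" "spectral_integral (M m) (E m) (c (J (m - 1))) = B m"
    using m by (auto simp: B_def haagerup_factor_def)
  have "cinner (moi_term m M E a b c T J g) h
      = cinner (B 1 (T 1 (foldr (\<circ>) (map (\<lambda>i. B i \<circ> T i) [2..<m]) id (B m g)))) h"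
    unfolding moi_term_def map ends by simp
  also have "\<dots> = cinner (B m g) (u (m - 1)) * (\<Prod>i\<in>{1..<m}. cinner (B i (v i)) (if i = 1 then h else u (i - 1)))"
    using m T haagerup_factor_operators[OF H] by (intro cinner_rank_one_chain) (auto simp: B_def)
  also have "\<dots> = (\<Prod>i\<in>{1..m}. cinner (B i (if i = m then g else v i)) (if i = 1 then h else u (i - 1)))"
  proof -
    have "{1..m} = insert m {1..<m}" using m by auto
    moreover have "(\<Prod>i\<in>{1..<m}. cinner (B i (if i = m then g else v i)) (if i = 1 then h else u (i - 1)))
        = (\<Prod>i\<in>{1..<m}. cinner (B i (v i)) (if i = 1 then h else u (i - 1)))"
      by (rule prod.cong) auto
    ultimately show ?thesis using m by simp
  qed
  finally show ?thesis by (simp add: B_def)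
qed

definition haagerup_const ::
    "nat \<Rightarrow> (nat \<Rightarrow> 'x measure) \<Rightarrow> (nat \<Rightarrow> 'x set \<Rightarrow> 'h \<Rightarrow> 'h::complex_hilbert_space)
      \<Rightarrow> (nat \<Rightarrow> 'x \<Rightarrow> complex) \<Rightarrow> (nat \<Rightarrow> nat \<Rightarrow> nat \<Rightarrow> 'x \<Rightarrow> complex) \<Rightarrow> (nat \<Rightarrow> 'x \<Rightarrow> complex) \<Rightarrow> nat \<Rightarrow> real" where
  "haagerup_const m M E a b c i = (if i = 1 then Linf_ell2_norm (M 1) (E 1) a
     else if i = m then Linf_ell2_norm (M m) (E m) c else Linf_matrix_norm (M i) (E i) (b i))"

lemma foldr_comp_mult:
  "foldr (\<circ>) (map (\<lambda>l. (*) (f l)) xs) id y = prod_list (map f xs) * (y :: complex)"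
  by (induction xs) auto

text \<open>Pointwise, the partial sums are those of a chain of scalar matrices.\<close>

lemma haagerup_partial_sums_bounded:
  assumes H: "haagerup_coeffs m M E a b c"
  shows "\<exists>G K. (\<forall>i\<in>{1..m}. carrier_set (M i) (E i) (G i) \<and> (\<forall>J. \<forall>x\<in>G i. cmod (haagerup_factor m a b c J i x) \<le> haagerup_const m M E a b c i)) \<and>
    (\<forall>x N. (\<forall>i\<in>{1..m}. x i \<in> G i) \<longrightarrow>
      cmod (\<Sum>J\<in>rectangle m N. \<Prod>i\<in>{1..m}. haagerup_factor m a b c J i (x i)) \<le> K)"
proof -
  have m: "3 \<le> m" using H by (simp add: haagerup_coeffs_def)
  have E: "spectral_measure (M i) (E i)" if "i \<in> {1..m}" for i using H that by (simp add: haagerup_coeffs_def)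
  have a: "a \<in> Linf_ell2 (M 1) (E 1)" and c: "c \<in> Linf_ell2 (M m) (E m)"
    and b: "\<And>i. i \<in> {2..m-1} \<Longrightarrow> b i \<in> Linf_matrix (M i) (E i)"
    using H by (auto simp: haagerup_coeffs_def)
  define C where "C = haagerup_const m M E a b c"
  \<comment> \<open>The first and the last coefficients are padded to matrices with one nonzero row
    or column, so that all positions are covered by the same entry bound.\<close>
  define S where "S i j k = (if i = 1 then (\<lambda>x. if j = 0 then a k x else 0)
    else if i = m then (\<lambda>x. if k = 0 then c j x else 0) else b i j k)" for i j k :: nat
  have C1: "0 \<le> C 1" and Cm: "0 \<le> C m"
    using m Linf_ell2_carrier(1)[OF E a] Linf_ell2_carrier(1)[OF E c] by (auto simp: C_def haagerup_const_def)
  obtain G1 where G1: "carrier_set (M 1) (E 1) G1"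
    "\<And>x. x \<in> G1 \<Longrightarrow> (\<lambda>j. a j x) \<in> ell2 \<and> ell2_norm (\<lambda>j. a j x) \<le> C 1"
    using Linf_ell2_carrier(2)[OF E a] m by (auto simp: C_def haagerup_const_def)
  obtain Gm where Gm: "carrier_set (M m) (E m) Gm"
    "\<And>x. x \<in> Gm \<Longrightarrow> (\<lambda>j. c j x) \<in> ell2 \<and> ell2_norm (\<lambda>j. c j x) \<le> C m"
    using Linf_ell2_carrier(2)[OF E c] m by (auto simp: C_def haagerup_const_def)
  have "\<exists>G. carrier_set (M i) (E i) G \<and> (\<forall>x\<in>G. scalar_block (\<lambda>j k. b i j k x) (C i))" if "i \<in> {2..m-1}" for i
  proof -
    have "C i = Linf_matrix_norm (M i) (E i) (b i)" "i \<in> {1..m}" using that by (auto simp: C_def haagerup_const_def)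
    then show ?thesis using Linf_matrix_carrier(2)[OF E b, of i] that by simp
  qed
  then obtain Gb where Gb: "\<And>i. i \<in> {2..m-1} \<Longrightarrow> carrier_set (M i) (E i) (Gb i)"
    "\<And>i x. i \<in> {2..m-1} \<Longrightarrow> x \<in> Gb i \<Longrightarrow> scalar_block (\<lambda>j k. b i j k x) (C i)" by metis
  define G where "G i = (if i = 1 then G1 else if i = m then Gm else Gb i)" for i
  have G: "carrier_set (M i) (E i) (G i)" if "i \<in> {1..m}" for i
    using that G1(1) Gm(1) Gb(1)[of i] by (auto simp: G_def)
  have S: "scalar_block (\<lambda>j k. S i j k x) (C i)" if i: "i \<in> {1..m}" and x: "x \<in> G i" for i x
  proof -
    consider "i = 1" | "i = m" "i \<noteq> 1" | "i \<in> {2..m-1}" using i by force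
    then show ?thesis
    proof cases
      case 1
      then show ?thesis using x G1(2)[of x] scalar_block_row[OF _ _ C1] by (simp add: S_def G_def)
    next
      case 2
      then show ?thesis using x Gm(2)[of x] scalar_block_column[OF _ _ Cm] by (simp add: S_def G_def)
    next
      case 3
      then have "i \<noteq> 1" "i \<noteq> m" by auto
      then show ?thesis using x Gb(2)[OF 3, of x] by (simp add: S_def G_def)
    qed
  qed
  have factor: "cmod (haagerup_factor m a b c J i x) \<le> C i" if "i \<in> {1..m}" "x \<in> G i" for J i x
  proof -
    \<comment> \<open>Index 0 is the place of the row and of the column in the padded
      matrices.\<close>
    have "haagerup_factor m a b c J i x = S i (if i = 1 then 0 else J (i - 1)) (if i = m then 0 else J i) x"
      using m by (auto simp: haagerup_factor_def S_def)
    then show ?thesis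
      using block_entry[OF S[OF that], of "if i = 1 then 0 else J (i - 1)" "if i = m then 0 else J i" 1]
      by simp
  qed
  have "cmod (\<Sum>J\<in>rectangle m N. \<Prod>i\<in>{1..m}. haagerup_factor m a b c J i (x i)) \<le> (\<Prod>i\<in>{1..<m}. C i) * C m"
    if x: "\<forall>i\<in>{1..m}. x i \<in> G i" for x N
  proof -
    define X where "X i j k = (*) (S i j k (x i))" for i j k
    define w where "w j = c j (x m)" for j
    have block: "block (X i) (C i)" if "i \<in> {1..<m}" for i
      unfolding X_def using that x by (intro S) auto
    have xm: "x m \<in> Gm" using x m by (auto simp: G_def dest: bspec[of _ _ m] split: if_splits)
    have w: "l2s w" "l2n w \<le> C m"
      using Gm(2)[OF xm] by (simp_all add: l2s_def l2n_def w_def ell2_def ell2_norm_def)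
    have term_eq: "(\<Prod>i\<in>{1..m}. haagerup_factor m a b c J i (x i))
        = a (J 1) (x 1) * foldr (\<circ>) (map (\<lambda>l. X l (J (l - 1)) (J l)) [Suc 1..<m]) id (w (J (m - 1)))" for J
    proof -
      have "map (\<lambda>l. X l (J (l - 1)) (J l)) [Suc 1..<m] = map (\<lambda>l. (*) (b l (J (l - 1)) (J l) (x l))) [2..<m]"
        by (rule map_cong) (auto simp: X_def S_def numeral_2_eq_2)
      moreover have "prod_list (map (\<lambda>l. b l (J (l - 1)) (J l) (x l)) [2..<m]) = (\<Prod>l\<in>{2..m-1}. b l (J (l - 1)) (J l) (x l))"
      proof -
        have "{2..m-1} = set [2..<m]" using m by auto
        then show ?thesis by (simp only: prod.distinct_set_conv_list[OF distinct_upt])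
      qed
      ultimately show ?thesis unfolding prod_haagerup_factor[OF m] by (simp only: foldr_comp_mult w_def mult.assoc)
    qed
    have "(\<Sum>J\<in>rectangle m N. \<Prod>i\<in>{1..m}. haagerup_factor m a b c J i (x i))
        = (\<Sum>k\<le>N 1. a k (x 1) * tchain X m N w (m - 2) k)"
      unfolding term_eq rectangle_def
      by (rule sum_rectangle_chain[where C = C and \<Phi> = "\<lambda>k u. a k (x 1) * u"])
        (use m block in \<open>auto intro: bounded_linear.linear[OF bounded_linear_mult_right]\<close>)
    also have "\<dots> = tchain X m N w (m - 1) 0"
    proof -
      have "m - 1 = Suc (m - 2)" "m - Suc (m - 2) = 1" using m by auto
      moreover have "block (X 1) (C 1)" using m by (intro block) auto
      ultimately show ?thesis by (simp add: bapp_trunc) (simp add: X_def S_def)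
    qed
    also have "cmod \<dots> \<le> (\<Prod>i\<in>{m-(m-1)..<m}. C i) * l2n w"
    proof (rule order_trans[OF norm_le_l2n])
      have sub: "block (X i) (C i)" if "i \<in> {m - (m - 1)..<m}" for i using that by (intro block) auto
      show "l2s (tchain X m N w (m - 1))" by (rule tchain_bound(1)[where C = C, OF sub _ w(1)]) auto
      show "l2n (tchain X m N w (m - 1)) \<le> (\<Prod>i\<in>{m-(m-1)..<m}. C i) * l2n w"
        by (rule tchain_bound(2)[where C = C, OF sub _ w(1)]) auto
    qed
    also have "m - (m - 1) = 1" using m by simp
    also have "(\<Prod>i\<in>{1..<m}. C i) * l2n w \<le> (\<Prod>i\<in>{1..<m}. C i) * C m"
      using w(2) block by (intro mult_left_mono prod_nonneg) (auto simp: block_def)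
    finally show ?thesis .
  qed
  then show ?thesis using G factor
    by (intro exI[of _ G] exI[of _ "(\<Prod>i\<in>{1..<m}. C i) * C m"]) (auto simp: C_def)
qed

lemma haagerup_factor_measurable:
  assumes H: "haagerup_coeffs m M E a b c" and i: "i \<in> {1..m}"
  shows "haagerup_factor m a b c J i \<in> borel_measurable (M i)"
  using H i by (auto simp: haagerup_factor_def haagerup_coeffs_def Linf_ell2_def Linf_matrix_def)

text \<open>The exceptional points lie in a cylinder over a null set, and a product with a zero
  factor vanishes.\<close>

lemma AE_PiM_finite_component:
  assumes "product_sigma_finite \<mu>" "finite I" "i \<in> I" "AE x in \<mu> i. P x"
  shows "AE x in Pi\<^sub>M I \<mu>. P (x i)"
proof -
  interpret product_sigma_finite \<mu> by (rule assms(1))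
  obtain N where N: "N \<in> null_sets (\<mu> i)" "{x \<in> space (\<mu> i). \<not> P x} \<subseteq> N"
    using assms(4) by (auto simp: eventually_ae_filter)
  define A where "A j = (if j = i then N else space (\<mu> j))" for j
  have "emeasure (Pi\<^sub>M I \<mu>) (PiE I A) = (\<Prod>j\<in>I. emeasure (\<mu> j) (A j))"
    using N assms(2) by (intro emeasure_PiM) (auto simp: A_def)
  also have "\<dots> = 0" using N assms(2,3) by (intro prod_zero) (auto simp: A_def intro!: bexI[of _ i])
  finally have "PiE I A \<in> null_sets (Pi\<^sub>M I \<mu>)"
    using N assms(2) by (intro null_setsI sets_PiM_I_finite) (auto simp: A_def)
  moreover have "{x \<in> space (Pi\<^sub>M I \<mu>). \<not> P (x i)} \<subseteq> PiE I A"
    using N(2) assms(3) by (auto simp: space_PiM A_def PiE_iff extensional_def)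
  ultimately show ?thesis by (rule AE_I')
qed

lemma haagerup_representation_coeffs:
  "3 \<le> m \<Longrightarrow> (\<And>i. i \<in> {1..m} \<Longrightarrow> spectral_measure (M i) (E i)) \<Longrightarrow>
    haagerup_representation m M E \<Psi> a b c \<Longrightarrow> haagerup_coeffs m M E a b c"
  by (simp add: haagerup_representation_def haagerup_coeffs_def)

section \<open>Comparison of two representations of the same function\<close>

definition moi_scalar_sum ::
    "nat \<Rightarrow> (nat \<Rightarrow> 'x measure) \<Rightarrow> (nat \<Rightarrow> 'x set \<Rightarrow> 'h \<Rightarrow> 'h::complex_hilbert_space)
      \<Rightarrow> (nat \<Rightarrow> 'x \<Rightarrow> complex) \<Rightarrow> (nat \<Rightarrow> nat \<Rightarrow> nat \<Rightarrow> 'x \<Rightarrow> complex) \<Rightarrow> (nat \<Rightarrow> 'x \<Rightarrow> complex)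
      \<Rightarrow> (nat \<Rightarrow> 'h) \<Rightarrow> nat \<Rightarrow> complex" where
  "moi_scalar_sum m M E a b c h n = (\<Sum>J\<in>rectangle m (\<lambda>_. n).
     \<Prod>i\<in>{1..m}. integral\<^sup>L (scalar_measure (M i) (E i) (h i)) (haagerup_factor m a b c J i))"

text \<open>By Fubini, the scalar sums are integrals of the partial sums of the two representations over
  a product of finite measures; their difference tends to \<open>0\<close> boundedly almost everywhere.\<close>

lemma moi_scalar_sum_difference:
  fixes E :: "nat \<Rightarrow> 'x set \<Rightarrow> 'h \<Rightarrow> 'h::complex_hilbert_space"
  assumes m: "3 \<le> m" and E: "\<And>i. i \<in> {1..m} \<Longrightarrow> spectral_measure (M i) (E i)"
    and rep: "haagerup_representation m M E \<Psi> a b c" "haagerup_representation m M E \<Psi> a' b' c'"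
  shows "(\<lambda>n. moi_scalar_sum m M E a b c h n - moi_scalar_sum m M E a' b' c' h n) \<longlonglongrightarrow> 0"
proof -
  note H = haagerup_representation_coeffs[OF m E rep(1)] and H' = haagerup_representation_coeffs[OF m E rep(2)]
  \<comment> \<open>Outside the index range an arbitrary finite measure is inserted, because the
    product locale speaks about every index.\<close>
  define \<mu> where "\<mu> i = (if i \<in> {1..m} then scalar_measure (M i) (E i) (h i) else scalar_measure (M 1) (E 1) 0)" for i
  have fin: "finite_measure (\<mu> i)" for i
    unfolding \<mu>_def using m by (auto intro!: finite_measure_scalar_measure E)
  interpret \<mu>: product_sigma_finite \<mu>
    by (rule product_sigma_finite.intro, rule finite_measure.axioms(1), rule fin)
  define \<nu> where "\<nu> = Pi\<^sub>M {1..m} \<mu>"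
  have \<nu>_eq: "\<nu> = Pi\<^sub>M {1..m} (\<lambda>i. scalar_measure (M i) (E i) (h i))"
    unfolding \<nu>_def by (rule PiM_cong) (auto simp: \<mu>_def)
  have sets: "sets \<nu> = sets (Pi\<^sub>M {1..m} M)"
    unfolding \<nu>_eq by (rule sets_PiM_cong) (auto simp: sets_scalar_measure[OF E])
  have space: "space \<nu> = space (Pi\<^sub>M {1..m} M)" by (rule sets_eq_imp_space_eq[OF sets])
  have main: "integrable \<nu> (p n) \<and> integral\<^sup>L \<nu> (p n) = moi_scalar_sum m M E a b c h n \<and>
      (\<exists>K. AE x in \<nu>. \<forall>n. cmod (p n x) \<le> K) \<and> (AE x in \<nu>. (\<lambda>n. p n x) \<longlonglongrightarrow> \<Psi> x)"
    if p: "\<And>n x. p n x = (\<Sum>J\<in>rectangle m (\<lambda>_. n). \<Prod>i\<in>{1..m}. haagerup_factor m a b c J i (x i))"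
      and rep: "haagerup_representation m M E \<Psi> a b c" for a b c p n
  proof -
    have H: "haagerup_coeffs m M E a b c" by (rule haagerup_representation_coeffs[OF m E rep])
    obtain G K where G: "\<And>i. i \<in> {1..m} \<Longrightarrow> carrier_set (M i) (E i) (G i)"
      "\<And>i J x. i \<in> {1..m} \<Longrightarrow> x \<in> G i \<Longrightarrow> cmod (haagerup_factor m a b c J i x) \<le> haagerup_const m M E a b c i"
      and K: "\<And>x N. (\<forall>i\<in>{1..m}. x i \<in> G i) \<Longrightarrow>
        cmod (\<Sum>J\<in>rectangle m N. \<Prod>i\<in>{1..m}. haagerup_factor m a b c J i (x i)) \<le> K"
      using haagerup_partial_sums_bounded[OF H] by blast
    have int: "integrable (\<mu> i) (haagerup_factor m a b c J i)" if "i \<in> {1..m}" for i J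
      using that integrable_scalar_measure[OF E haagerup_factor_measurable[OF H] G(1) G(2)] by (simp add: \<mu>_def)
    have pn: "p n = (\<lambda>x. \<Sum>J\<in>rectangle m (\<lambda>_. n). \<Prod>i\<in>{1..m}. haagerup_factor m a b c J i (x i))" for n
      using p by auto
    have "integrable \<nu> (p n)"
      unfolding pn \<nu>_def by (intro Bochner_Integration.integrable_sum \<mu>.product_integrable_prod int) simp_all
    moreover have "integral\<^sup>L \<nu> (p n) = moi_scalar_sum m M E a b c h n"
    proof -
      have "integral\<^sup>L \<nu> (p n) = (\<Sum>J\<in>rectangle m (\<lambda>_. n). \<Prod>i\<in>{1..m}. integral\<^sup>L (\<mu> i) (haagerup_factor m a b c J i))"
        unfolding pn \<nu>_def
        by (subst Bochner_Integration.integral_sum)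
          (auto intro!: sum.cong \<mu>.product_integral_prod \<mu>.product_integrable_prod int)
      also have "\<dots> = moi_scalar_sum m M E a b c h n"
        unfolding moi_scalar_sum_def by (intro sum.cong prod.cong refl) (simp add: \<mu>_def)
      finally show ?thesis .
    qed
    moreover have "AE x in \<nu>. \<forall>n. cmod (p n x) \<le> K"
    proof -
      have "AE x in \<nu>. \<forall>i\<in>{1..m}. x i \<in> G i"
      proof (rule AE_finite_allI)
        fix i assume i: "i \<in> {1..m}"
        have "\<mu> i = scalar_measure (M i) (E i) (h i)" using i by (simp add: \<mu>_def)
        then have AE_i: "AE x in \<mu> i. x \<in> G i" using carrier_set_AE[OF E[OF i] G(1)[OF i]] by (rule ssubst)
        show "AE x in \<nu>. x i \<in> G i"
          unfolding \<nu>_def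
          by (rule AE_PiM_finite_component[OF \<mu>.product_sigma_finite_axioms _ i AE_i]) simp
      qed simp
      then show ?thesis by eventually_elim (use K in \<open>simp add: p\<close>)
    qed
    moreover have "AE x in \<nu>. (\<lambda>n. p n x) \<longlonglongrightarrow> \<Psi> x"
    proof -
      obtain N where N: "N \<in> sets (Pi\<^sub>M {1..m} M)"
        "\<And>h. emeasure (Pi\<^sub>M {1..m} (\<lambda>i. scalar_measure (M i) (E i) (h i))) N = 0"
        "\<And>x. x \<in> space (Pi\<^sub>M {1..m} M) - N \<Longrightarrow>
          ((\<lambda>N. \<Sum>J\<in>rectangle m N. a (J 1) (x 1) * (\<Prod>i\<in>{2..m-1}. b i (J (i-1)) (J i) (x i)) * c (J (m-1)) (x m))
            \<longlongrightarrow> \<Psi> x) (rect_limit m)"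
        using rep unfolding haagerup_representation_def AE_product_def by blast
      have "N \<in> null_sets \<nu>" using N(1,2) sets by (simp add: null_sets_def \<nu>_eq)
      moreover have "(\<lambda>n. p n x) \<longlonglongrightarrow> \<Psi> x" if "x \<in> space \<nu>" "x \<notin> N" for x
        using filterlim_compose[OF N(3) filterlim_rect_limit_diagonal, of x] that
        unfolding p prod_haagerup_factor[OF m] by (simp add: space)
      ultimately show ?thesis by (intro AE_I'[of N]) auto
    qed
    ultimately show ?thesis by blast
  qed
  define p where "p n x = (\<Sum>J\<in>rectangle m (\<lambda>_. n). \<Prod>i\<in>{1..m}. haagerup_factor m a b c J i (x i))" for n x
  define p' where "p' n x = (\<Sum>J\<in>rectangle m (\<lambda>_. n). \<Prod>i\<in>{1..m}. haagerup_factor m a' b' c' J i (x i))" for n x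
  note P = main[OF p_def rep(1)] and P' = main[OF p'_def rep(2)]
  obtain K K' where K: "AE x in \<nu>. \<forall>n. cmod (p n x) \<le> K" "AE x in \<nu>. \<forall>n. cmod (p' n x) \<le> K'"
    using P P' by blast
  have one: "integrable \<nu> (\<lambda>_. 1 :: real)"
  proof -
    have "integrable \<nu> (\<lambda>x. \<Prod>i\<in>{1..m}. (1 :: real))"
      unfolding \<nu>_def
      by (rule \<mu>.product_integrable_prod[where f = "\<lambda>_ _. 1"])
        (simp_all add: finite_measure.integrable_const[OF fin])
    then show ?thesis by simp
  qed
  \<comment> \<open>Dominated convergence is applied to the difference, whose limit is 0:
    \<open>\<Psi>\<close> itself carries no measurability assumption and is never
    integrated.\<close>
  have "(\<lambda>n. integral\<^sup>L \<nu> (\<lambda>x. p n x - p' n x)) \<longlonglongrightarrow> integral\<^sup>L \<nu> (\<lambda>_. 0)"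
  proof (rule integral_dominated_convergence)
    show "(\<lambda>x. p n x - p' n x) \<in> borel_measurable \<nu>" for n
      using P[of n] P'[of n] by (intro borel_measurable_diff) auto
    show "integrable \<nu> (\<lambda>_. K + K')" using integrable_mult_right[OF one, of "K + K'"] by simp
    have "AE x in \<nu>. (\<lambda>n. p n x) \<longlonglongrightarrow> \<Psi> x" "AE x in \<nu>. (\<lambda>n. p' n x) \<longlonglongrightarrow> \<Psi> x" using P P' by auto
    then show "AE x in \<nu>. (\<lambda>n. p n x - p' n x) \<longlonglongrightarrow> 0"
    proof eventually_elim
      case (elim x)
      then show ?case using tendsto_diff[OF elim] by simp
    qed
    show "AE x in \<nu>. cmod (p n x - p' n x) \<le> K + K'" for n
      using K
    proof eventually_elim
      case (elim x)
      then show ?case using norm_triangle_ineq4[of "p n x" "p' n x"] by (smt (verit))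
    qed
  qed simp
  moreover have "integral\<^sup>L \<nu> (\<lambda>x. p n x - p' n x) = moi_scalar_sum m M E a b c h n - moi_scalar_sum m M E a' b' c' h n" for n
    using P[of n] P'[of n] by simp
  ultimately show ?thesis by simp
qed

text \<open>Each of the \<open>m\<close> matrix elements is polarized into four integrals against
  scalar measures; \<tau> records which of the four is taken at each position when the product is
  expanded. The coefficients do not depend on the representation.\<close>

lemma cinner_sum_moi_terms_rank_one:
  assumes H: "haagerup_coeffs m M E a b c"
    and T: "\<forall>i\<in>{1..m-1}. T i = (\<lambda>x. cinner x (u i) *\<^sub>C v i)"
  shows "cinner (\<Sum>J\<in>rectangle m (\<lambda>_. n). moi_term m M E a b c T J g) h
    = (\<Sum>\<tau>\<in>(\<Pi>\<^sub>E i\<in>{1..m}. {..<4::nat}). (\<Prod>i\<in>{1..m}. \<i> ^ \<tau> i / 4) *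
        moi_scalar_sum m M E a b c
          (\<lambda>i. (if i = m then g else v i) + \<i> ^ \<tau> i *\<^sub>C (if i = 1 then h else u (i - 1))) n)"
proof -
  define y z where "y i = (if i = m then g else v i)" and "z i = (if i = 1 then h else u (i - 1))" for i
  define \<mu> where "\<mu> i t = scalar_measure (M i) (E i) (y i + \<i> ^ t *\<^sub>C z i)" for i and t :: nat
  obtain G where G: "\<And>i. i \<in> {1..m} \<Longrightarrow> carrier_set (M i) (E i) (G i)"
    "\<And>i J x. i \<in> {1..m} \<Longrightarrow> x \<in> G i \<Longrightarrow> cmod (haagerup_factor m a b c J i x) \<le> haagerup_const m M E a b c i"
    using haagerup_partial_sums_bounded[OF H] by blast
  have E: "spectral_measure (M i) (E i)" if "i \<in> {1..m}" for i using H that by (simp add: haagerup_coeffs_def)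
  have "cinner (spectral_integral (M i) (E i) (haagerup_factor m a b c J i) (y i)) (z i)
      = (\<Sum>t<4. \<i> ^ t / 4 * integral\<^sup>L (\<mu> i t) (haagerup_factor m a b c J i))" if "i \<in> {1..m}" for i J
    unfolding polarization[OF haagerup_factor_operators[OF H that], of J "y i" "z i"] \<mu>_def
    by (intro sum.cong refl arg_cong2[where f = "(*)"]
        cinner_spectral_integral[OF E[OF that] haagerup_factor_measurable[OF H that] G(1)[OF that] G(2)[OF that]])
  then have "cinner (moi_term m M E a b c T J g) h
      = (\<Prod>i\<in>{1..m}. \<Sum>t<4. \<i> ^ t / 4 * integral\<^sup>L (\<mu> i t) (haagerup_factor m a b c J i))" for J
    unfolding cinner_moi_term_rank_one[OF H T] y_def[symmetric] z_def[symmetric] by (intro prod.cong refl)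
  also have "\<dots> J = (\<Sum>\<tau>\<in>(\<Pi>\<^sub>E i\<in>{1..m}. {..<4::nat}). \<Prod>i\<in>{1..m}. \<i> ^ \<tau> i / 4 * integral\<^sup>L (\<mu> i (\<tau> i)) (haagerup_factor m a b c J i))" for J
    by (rule prod_sum_PiE) auto
  finally have summand: "cinner (moi_term m M E a b c T J g) h = (\<Sum>\<tau>\<in>(\<Pi>\<^sub>E i\<in>{1..m}. {..<4::nat}).
      \<Prod>i\<in>{1..m}. \<i> ^ \<tau> i / 4 * integral\<^sup>L (\<mu> i (\<tau> i)) (haagerup_factor m a b c J i))" for J .
  have "cinner (\<Sum>J\<in>rectangle m (\<lambda>_. n). moi_term m M E a b c T J g) h
      = (\<Sum>J\<in>rectangle m (\<lambda>_. n). \<Sum>\<tau>\<in>(\<Pi>\<^sub>E i\<in>{1..m}. {..<4::nat}).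
          (\<Prod>i\<in>{1..m}. \<i> ^ \<tau> i / 4) * (\<Prod>i\<in>{1..m}. integral\<^sup>L (\<mu> i (\<tau> i)) (haagerup_factor m a b c J i)))"
    unfolding cinner_sum_left summand prod.distrib ..
  then show ?thesis
    by (subst (asm) sum.swap)
      (simp add: sum_distrib_left moi_scalar_sum_def \<mu>_def y_def z_def)
qed

text \<open>Both partial sums are the same finite combination of scalar sums, and corresponding
  scalar sums differ by a null sequence.\<close>

lemma moi_operator_rank_one_unique:
  fixes E :: "nat \<Rightarrow> 'x set \<Rightarrow> 'h \<Rightarrow> 'h::complex_hilbert_space"
  assumes m: "3 \<le> m" and E: "\<And>i. i \<in> {1..m} \<Longrightarrow> spectral_measure (M i) (E i)"
    and rep: "haagerup_representation m M E \<Psi> a b c" "haagerup_representation m M E \<Psi> a' b' c'"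
    and R: "\<forall>i\<in>{1..m-1}. rank_one (R i)"
  shows "moi_operator m M E a b c R = moi_operator m M E a' b' c' R"
proof (rule ext, rule cinner_eqI)
  fix g h
  have H: "haagerup_coeffs m M E a b c" "haagerup_coeffs m M E a' b' c'"
    by (rule haagerup_representation_coeffs[OF m E rep(1)], assumption,
        rule haagerup_representation_coeffs[OF m E rep(2)], assumption)
  have "\<forall>i\<in>{1..m-1}. \<exists>u v. R i = (\<lambda>x. cinner x u *\<^sub>C v)" using R by (simp add: rank_one_def)
  then obtain u v where uv: "\<forall>i\<in>{1..m-1}. R i = (\<lambda>x. cinner x (u i) *\<^sub>C v i)" by metis
  then have Rb: "\<forall>i\<in>{1..m-1}. bounded_clinear (R i)" by (auto simp: bounded_clinear_rank_one)
  define S where "S a b c n = cinner (\<Sum>J\<in>rectangle m (\<lambda>_. n). moi_term m M E a b c R J g) h" for a b c n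
  define k where "k \<tau> i = (if i = m then g else v i) + \<i> ^ \<tau> i *\<^sub>C (if i = 1 then h else u (i - 1))" for \<tau> i
  have "(\<lambda>n. \<Sum>\<tau>\<in>(\<Pi>\<^sub>E i\<in>{1..m}. {..<4::nat}). (\<Prod>i\<in>{1..m}. \<i> ^ \<tau> i / 4) *
      (moi_scalar_sum m M E a b c (k \<tau>) n - moi_scalar_sum m M E a' b' c' (k \<tau>) n))
      \<longlonglongrightarrow> (\<Sum>\<tau>\<in>(\<Pi>\<^sub>E i\<in>{1..m}. {..<4::nat}). (\<Prod>i\<in>{1..m}. \<i> ^ \<tau> i / 4) * 0)"
    by (intro tendsto_sum tendsto_mult tendsto_const moi_scalar_sum_difference[OF m E rep])
  then have "(\<lambda>n. S a b c n - S a' b' c' n) \<longlonglongrightarrow> 0"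
    unfolding S_def cinner_sum_moi_terms_rank_one[OF H(1) uv] cinner_sum_moi_terms_rank_one[OF H(2) uv]
    by (simp add: k_def[abs_def] right_diff_distrib sum_subtractf)
  moreover have "(\<lambda>n. S a b c n - S a' b' c' n)
      \<longlonglongrightarrow> cinner (moi_operator m M E a b c R g) h - cinner (moi_operator m M E a' b' c' R g) h"
    unfolding S_def
    by (intro tendsto_diff tendsto_cinner tendsto_const sum_moi_terms_diagonal[OF H(1) Rb]
        sum_moi_terms_diagonal[OF H(2) Rb])
  ultimately have "cinner (moi_operator m M E a b c R g) h - cinner (moi_operator m M E a' b' c' R g) h = 0"
    by (rule LIMSEQ_unique[rotated])
  then show "cinner (moi_operator m M E a b c R g) h = cinner (moi_operator m M E a' b' c' R g) h"
    by (rule eq_iff_diff_eq_0[THEN iffD2])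
qed

text \<open>Evaluates the definite description with any chosen representation: convergence supplies
  existence, the reduction to rank-one factors uniqueness.\<close>

lemma multiple_operator_integral_eq:
  fixes E :: "nat \<Rightarrow> 'x set \<Rightarrow> 'h \<Rightarrow> 'h::complex_hilbert_space"
  assumes m: "3 \<le> m" and E: "\<And>i. i \<in> {1..m} \<Longrightarrow> spectral_measure (M i) (E i)"
    and rep: "haagerup_representation m M E \<Psi> a b c"
    and T: "\<forall>i\<in>{1..m-1}. bounded_clinear (T i)"
  shows "multiple_operator_integral m M E \<Psi> T = moi_operator m M E a b c T"
  unfolding multiple_operator_integral_def
proof (rule the_equality)
  have H: "haagerup_coeffs m M E a b c" by (rule haagerup_representation_coeffs[OF m E rep])
  show "\<exists>a' b' c'. haagerup_representation m M E \<Psi> a' b' c' \<and>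
      moi_series_sum m M E a' b' c' T (moi_operator m M E a b c T)"
    using rep moi_series_sum_iff[OF H T] by blast
  fix S assume "\<exists>a b c. haagerup_representation m M E \<Psi> a b c \<and> moi_series_sum m M E a b c T S"
  then obtain a' b' c' where rep': "haagerup_representation m M E \<Psi> a' b' c'"
    and S: "moi_series_sum m M E a' b' c' T S" by blast
  have H': "haagerup_coeffs m M E a' b' c'" by (rule haagerup_representation_coeffs[OF m E rep'])
  have "S = moi_operator m M E a' b' c' T" using S moi_series_sum_iff[OF H' T] by blast
  also have "\<dots> = moi_operator m M E a b c T"
    by (rule moi_operator_eq_of_rank_one[OF H' H moi_operator_rank_one_unique[OF m E rep' rep] T])
  finally show "S = moi_operator m M E a b c T" .
qed

theorem theorem3p1:
  fixes m :: nat
    and M :: "nat \<Rightarrow> 'x measure"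
    and E :: "nat \<Rightarrow> 'x set \<Rightarrow> 'h \<Rightarrow> 'h::complex_hilbert_space"
    and \<Psi> :: "(nat \<Rightarrow> 'x) \<Rightarrow> complex"
    and T :: "nat \<Rightarrow> 'h \<Rightarrow> 'h"
    and p q r :: ennreal
  assumes "3 \<le> m"
    and "\<And>i. i \<in> {1..m} \<Longrightarrow> spectral_measure (M i) (E i)"
    and "\<Psi> \<in> haagerup_space m M E"
    and "2 \<le> p" and "2 \<le> q"
    and "1 / r = 1 / p + 1 / q"
    and "\<And>i. i \<in> {2..m-2} \<Longrightarrow> bounded_clinear (T i)"
    and "T 1 \<in> schatten_class p"
    and "T (m-1) \<in> schatten_class q"
  shows "multiple_operator_integral m M E \<Psi> T \<in> schatten_class r \<and>
    schatten_norm r (multiple_operator_integral m M E \<Psi> T)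
      \<le> haagerup_norm m M E \<Psi> * schatten_norm p (T 1)
          * (\<Prod>i\<in>{2..m-2}. onorm (T i)) * schatten_norm q (T (m-1))"
proof -
  define I where "I = multiple_operator_integral m M E \<Psi> T"
  have T: "\<forall>i\<in>{1..m-1}. bounded_clinear (T i)"
  proof
    fix i assume "i \<in> {1..m-1}"
    then consider "i = 1" | "i = m - 1" | "i \<in> {2..m-2}" by force
    then show "bounded_clinear (T i)"
      using assms(7-9) by cases (auto simp: schatten_class_def)
  qed
  define Q where "Q = schatten_norm p (T 1) * (\<Prod>i\<in>{2..m-2}. onorm (T i)) * schatten_norm q (T (m-1))"
  have Q: "0 \<le> Q"
    using assms(7-9) unfolding Q_def
    by (intro mult_nonneg_nonneg prod_nonneg)
      (auto simp: schatten_norm_def schatten_class_def intro: onorm_clinear_nonneg)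
  define V where "V a b c = Linf_ell2_norm (M 1) (E 1) a
       * (\<Prod>i\<in>{2..m-1}. Linf_matrix_norm (M i) (E i) (b i)) * Linf_ell2_norm (M m) (E m) c" for a b c
  \<comment> \<open>The operator \<open>I\<close> is the same for all representations, so every one
    of them gives a bound for it.\<close>
  have bound: "I \<in> schatten_class r \<and> schatten_norm r I \<le> V a b c * Q"
    if rep: "haagerup_representation m M E \<Psi> a b c" for a b c
  proof -
    have H: "haagerup_coeffs m M E a b c"
      by (rule haagerup_representation_coeffs[OF assms(1,2) rep])
    have I: "I = moi_operator m M E a b c T"
      unfolding I_def by (rule multiple_operator_integral_eq[OF assms(1,2) rep T])
    define K where "K = (\<Prod>i\<in>{2..m-1}. Linf_matrix_norm (M i) (E i) (b i)) * (\<Prod>i\<in>{2..m-2}. onorm (T i))"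
    have "0 \<le> K"
      unfolding K_def using H T
      by (intro mult_nonneg_nonneg prod_nonneg ballI)
        (auto simp: haagerup_coeffs_def intro!: Linf_matrix_carrier(1) onorm_clinear_nonneg)
    then have "I \<in> schatten_class r \<and> schatten_norm r I \<le> K * (Linf_ell2_norm (M 1) (E 1) a * schatten_norm p (T 1)
        * (Linf_ell2_norm (M m) (E m) c * schatten_norm q (T (m - 1))))"
      unfolding I
      by (intro schatten_class_of_column_bounds[OF bounded_clinear_moi_operator[OF H T] assms(4-6,8,9)
            column_pair_sym[OF haagerup_coeffs_column_pairs(1)[OF H]] haagerup_coeffs_column_pairs(2)[OF H]])
        (use moi_operator_bound[OF H T] in \<open>simp_all add: K_def\<close>)
    then show ?thesis by (simp add: K_def V_def Q_def mult_ac)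
  qed
  have "{V a b c |a b c. haagerup_representation m M E \<Psi> a b c} \<noteq> {}"
    using assms(3) by (auto simp: haagerup_space_def)
  moreover have norm: "haagerup_norm m M E \<Psi> = Inf {V a b c |a b c. haagerup_representation m M E \<Psi> a b c}"
    by (simp add: haagerup_norm_def V_def)
  \<comment> \<open>Division by \<open>Q\<close> isolates the quantity whose infimum is the Haagerup
    norm. If \<open>Q\<close> is 0, a single representation already shows that the Schatten norm of
    \<open>I\<close> is at most 0.\<close>
  moreover have "schatten_norm r I / Q \<le> V a b c" if "Q > 0" "haagerup_representation m M E \<Psi> a b c" for a b c
    using bound[OF that(2)] that(1) by (simp add: divide_le_eq)
  ultimately have "schatten_norm r I / Q \<le> haagerup_norm m M E \<Psi>" if "Q > 0"
    using that by (auto intro!: cInf_greatest)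
  moreover obtain a b c where rep: "haagerup_representation m M E \<Psi> a b c"
    using assms(3) by (auto simp: haagerup_space_def)
  ultimately have "schatten_norm r I \<le> haagerup_norm m M E \<Psi> * Q"
    using bound[OF rep] Q by (cases "Q = 0") (auto simp: divide_le_eq less_le)
  then show ?thesis
    using bound[OF rep] by (simp add: I_def Q_def mult_ac)
qed

end
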